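(* Let $(M,\nabla,\langle\cdot,\cdot\rangle)$ be an affine-Riemann manifold with Koszul forms $\alpha,\xi$, and let $\theta_1$ be the Lee form of its canonical Hermitian structure $(TM,J_1,g_1)$. Then $$d^*\theta_1=d^*(\alpha-\xi)\circ\pi_1-\langle\mathrm{tr}_{\langle,\rangle}(\gamma^* )-\mathrm{tr}_{\langle,\rangle}(\gamma),\mathrm{tr}_{\langle,\rangle}(\gamma^* )\rangle\circ\pi_1,$$ where $d^*$ on the left is the codifferential of $g_1$ and $d^*$ on the right is that of $\langle\cdot,\cdot\rangle$. Hence $(TM,J_1,g_1)$ is Gauduchon if and only if $$d^*(\alpha-\xi)=|\mathrm{tr}_{\langle,\rangle}(\gamma^* )|^2-\langle\mathrm{tr}_{\langle,\rangle}(\gamma^* ),\mathrm{tr}_{\langle,\rangle}(\gamma)\rangle.$$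
   Context: An affine-Riemann manifold $(M,\nabla,\langle\cdot,\cdot\rangle)$ is a manifold $M$ of dimension $n$ with a flat torsionless connection $\nabla$ and a Riemannian metric $\langle\cdot,\cdot\rangle$. $D$ is the Levi-Civita connection of the metric; the difference tensor is $\gamma_XY=D_XY-\nabla_XY$, and $\gamma^*$ is defined by $\langle\gamma^*_XY,Z\rangle=\langle Y,\gamma_XZ\rangle$. For a local orthonormal frame $(E_i)$, $\mathrm{tr}_{\langle,\rangle}(\gamma)=\sum_i\gamma_{E_i}E_i$ and $\mathrm{tr}_{\langle,\rangle}(\gamma^* )=\sum_i\gamma^*_{E_i}E_i$. The Koszul forms are $\alpha(X)=\langle\mathrm{tr}_{\langle,\rangle}(\gamma^* ),X\rangle$ and $\xi(X)=\langle\mathrm{tr}_{\langle,\rangle}(\gamma),X\rangle$. Canonical Hermitian structure: $\pi_1:TM\to M$ is the projection; for a vector field $X$ on $M$, $X^h$ is the horizontal lift with respect to $\nabla$ and $X^v$ the vertical lift; $J_1X^h=X^v$, $J_1X^v=-X^h$; $g_1(X^h,Y^h)=g_1(X^v,Y^v)=\langle X,Y\rangle\circ\pi_1$, $g_1(X^h,Y^v)=0$. On a Riemannian manifold, $d^*\eta(X_1,\dots,X_{p-1})=-\sum_i(\nabla^{LC}_{E_i}\eta)(E_i,X_1,\dots,X_{p-1})$ with $\nabla^{LC}$ the Levi-Civita connection and $(E_i)$ a local orthonormal frame. For a Hermitian manifold $(N,J,g)$: fundamental form $\omega=g(J\cdot,\cdot)$, Lee form $\theta=-d^*\omega\circ J$;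 $(N,J,g)$ is Gauduchon if $d^*\theta=0$. *)

theory Defs
  imports "HOL-Analysis.Analysis"
begin

section \<open>Smooth manifolds\<close>

primrec Ck_on :: "nat \<Rightarrow> 'e::real_normed_vector set \<Rightarrow> ('e \<Rightarrow> 'f::real_normed_vector) \<Rightarrow> bool" where
  "Ck_on 0 S f \<longleftrightarrow> continuous_on S f"
| "Ck_on (Suc k) S f \<longleftrightarrow> (\<forall>x\<in>S. f differentiable (at x)) \<and>
     (\<forall>v. Ck_on k S (\<lambda>x. frechet_derivative f (at x) v))"

text \<open>Only used for open \<open>S\<close>.\<close>

definition smooth_on :: "'e::real_normed_vector set \<Rightarrow> ('e \<Rightarrow> 'f::real_normed_vector) \<Rightarrow> bool" where
  "smooth_on S f \<longleftrightarrow> (\<forall>k. Ck_on k S f)"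

text \<open>A manifold is represented by an atlas alone: the set of points is the union of the chart
  domains and the topology is the one induced by the charts. The dimension is \<open>DIM('e)\<close>.\<close>

type_synonym ('a, 'e) chart = "'a set \<times> ('a \<Rightarrow> 'e)"
type_synonym ('a, 'e) atlas = "('a, 'e) chart set"

definition points :: "('a, 'e) atlas \<Rightarrow> 'a set" where
  "points A = \<Union> (fst ` A)"

definition chart_inv :: "('a, 'e) chart \<Rightarrow> 'e \<Rightarrow> 'a" where
  "chart_inv c = inv_into (fst c) (snd c)"

definition manifold_topology :: "('a, 'e::euclidean_space) atlas \<Rightarrow> 'a topology" where
  "manifold_topology A = topology (\<lambda>U. U \<subseteq> points A \<and>
     (\<forall>c\<in>A. open {x \<in> snd c ` fst c. chart_inv c x \<in> U}))"

lemma openin_manifold_topology: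
  "openin (manifold_topology A) U \<longleftrightarrow> U \<subseteq> points A \<and>
     (\<forall>c\<in>A. open {x \<in> snd c ` fst c. chart_inv c x \<in> U})"
proof -
  have "istopology (\<lambda>U. U \<subseteq> points A \<and> (\<forall>c\<in>A. open {x \<in> snd c ` fst c. chart_inv c x \<in> U}))"
    unfolding istopology_def
  proof (intro conjI allI impI ballI)
    fix S T c
    assume S: "S \<subseteq> points A \<and> (\<forall>c\<in>A. open {x \<in> snd c ` fst c. chart_inv c x \<in> S})"
      and T: "T \<subseteq> points A \<and> (\<forall>c\<in>A. open {x \<in> snd c ` fst c. chart_inv c x \<in> T})"
    show "S \<inter> T \<subseteq> points A" using S by blast
    assume c: "c \<in> A"
    have "{x \<in> snd c ` fst c. chart_inv c x \<in> S \<inter> T} =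
      {x \<in> snd c ` fst c. chart_inv c x \<in> S} \<inter> {x \<in> snd c ` fst c. chart_inv c x \<in> T}" by blast
    then show "open {x \<in> snd c ` fst c. chart_inv c x \<in> S \<inter> T}"
      using S T c by (simp add: open_Int)
  next
    fix K
    assume K: "\<forall>U\<in>K. U \<subseteq> points A \<and> (\<forall>c\<in>A. open {x \<in> snd c ` fst c. chart_inv c x \<in> U})"
    show "\<Union> K \<subseteq> points A" using K by blast
    fix c assume c: "c \<in> A"
    have "{x \<in> snd c ` fst c. chart_inv c x \<in> \<Union> K} =
      (\<Union>U\<in>K. {x \<in> snd c ` fst c. chart_inv c x \<in> U})" by blast
    then show "open {x \<in> snd c ` fst c. chart_inv c x \<in> \<Union> K}"
      using K c by (simp add: open_UN)
  qed
  then show ?thesis by (simp add: manifold_topology_def)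
qed

definition smooth_manifold :: "('a, 'e::euclidean_space) atlas \<Rightarrow> bool" where
  "smooth_manifold A \<longleftrightarrow>
     (\<forall>c\<in>A. inj_on (snd c) (fst c) \<and> open (snd c ` fst c)) \<and>
     (\<forall>c\<in>A. \<forall>d\<in>A. open (snd c ` (fst c \<inter> fst d)) \<and>
        smooth_on (snd c ` (fst c \<inter> fst d)) (snd d \<circ> chart_inv c)) \<and>
     Hausdorff_space (manifold_topology A) \<and> second_countable (manifold_topology A)"

definition smooth_fun :: "('a, 'e::euclidean_space) atlas \<Rightarrow> 'a set \<Rightarrow> ('a \<Rightarrow> real) \<Rightarrow> bool" where
  "smooth_fun A U f \<longleftrightarrow> (\<forall>c\<in>A. smooth_on (snd c ` (U \<inter> fst c)) (f \<circ> chart_inv c))"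

definition smooth_at :: "('a, 'e::euclidean_space) atlas \<Rightarrow> 'a \<Rightarrow> ('a \<Rightarrow> real) \<Rightarrow> bool" where
  "smooth_at A p f \<longleftrightarrow> (\<exists>U. openin (manifold_topology A) U \<and> p \<in> U \<and> smooth_fun A U f)"


section \<open>Tangent vectors and vector fields\<close>

text \<open>A tangent vector at \<open>p\<close> is a directional derivative acting on the functions that are smooth
  near \<open>p\<close>. On all other functions it is \<open>0\<close>, so that equality of tangent vectors is
  equality of HOL functions; the zero vector is \<open>\<lambda>f. 0\<close>.\<close>

type_synonym 'a tvec = "('a \<Rightarrow> real) \<Rightarrow> real"
type_synonym 'a vfield = "'a \<Rightarrow> 'a tvec"

definition chart_vec :: "('a, 'e::euclidean_space) atlas \<Rightarrow> ('a, 'e) chart \<Rightarrow> 'a \<Rightarrow> 'e \<Rightarrow> 'a tvec" where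
  "chart_vec A c p x = (\<lambda>f. if smooth_at A p f
     then frechet_derivative (f \<circ> chart_inv c) (at (snd c p)) x else 0)"

definition tangent_space :: "('a, 'e::euclidean_space) atlas \<Rightarrow> 'a \<Rightarrow> 'a tvec set" where
  "tangent_space A p = {v. \<exists>c\<in>A. p \<in> fst c \<and> (\<exists>x. v = chart_vec A c p x)}"

text \<open>Vector fields are total functions; only their values on the open set \<open>U\<close> matter.\<close>

definition vector_field_on :: "('a, 'e::euclidean_space) atlas \<Rightarrow> 'a set \<Rightarrow> 'a vfield \<Rightarrow> bool" where
  "vector_field_on A U X \<longleftrightarrow> (\<forall>p\<in>U. X p \<in> tangent_space A p) \<and>
     (\<forall>V f. openin (manifold_topology A) V \<and> V \<subseteq> U \<and> smooth_fun A V f \<longrightarrow>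
        smooth_fun A V (\<lambda>p. X p f))"

definition vf_add :: "'a vfield \<Rightarrow> 'a vfield \<Rightarrow> 'a vfield" where
  "vf_add X Y = (\<lambda>p f. X p f + Y p f)"

definition vf_scale :: "('a \<Rightarrow> real) \<Rightarrow> 'a vfield \<Rightarrow> 'a vfield" where
  "vf_scale h X = (\<lambda>p f. h p * X p f)"

definition vf_diff :: "'a vfield \<Rightarrow> 'a vfield \<Rightarrow> 'a vfield" where
  "vf_diff X Y = (\<lambda>p f. X p f - Y p f)"

definition lie_bracket :: "('a, 'e::euclidean_space) atlas \<Rightarrow> 'a vfield \<Rightarrow> 'a vfield \<Rightarrow> 'a vfield" where
  "lie_bracket A X Y = (\<lambda>p f. if smooth_at A p f
     then X p (\<lambda>q. Y q f) - Y p (\<lambda>q. X q f) else 0)"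

definition differential :: "('b, 'd::euclidean_space) atlas \<Rightarrow> ('a \<Rightarrow> 'b) \<Rightarrow> 'a \<Rightarrow> 'a tvec \<Rightarrow> 'b tvec" where
  "differential B F p v = (\<lambda>f. if smooth_at B (F p) f then v (f \<circ> F) else 0)"


section \<open>Connections and metrics\<close>

text \<open>A connection acts on the vector fields of every open set, compatibly with restriction
  to smaller open sets (the last clause).\<close>

definition connection :: "('a, 'e::euclidean_space) atlas \<Rightarrow> ('a vfield \<Rightarrow> 'a vfield \<Rightarrow> 'a vfield) \<Rightarrow> bool" where
  "connection A nab \<longleftrightarrow> (\<forall>U. openin (manifold_topology A) U \<longrightarrow>
     (\<forall>X Y. vector_field_on A U X \<longrightarrow> vector_field_on A U Y \<longrightarrow>
        vector_field_on A U (nab X Y)) \<and>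
     (\<forall>X X' Y. vector_field_on A U X \<longrightarrow> vector_field_on A U X' \<longrightarrow> vector_field_on A U Y \<longrightarrow>
        (\<forall>p\<in>U. nab (vf_add X X') Y p = vf_add (nab X Y) (nab X' Y) p)) \<and>
     (\<forall>h X Y. smooth_fun A U h \<longrightarrow> vector_field_on A U X \<longrightarrow> vector_field_on A U Y \<longrightarrow>
        (\<forall>p\<in>U. nab (vf_scale h X) Y p = vf_scale h (nab X Y) p)) \<and>
     (\<forall>X Y Y'. vector_field_on A U X \<longrightarrow> vector_field_on A U Y \<longrightarrow> vector_field_on A U Y' \<longrightarrow>
        (\<forall>p\<in>U. nab X (vf_add Y Y') p = vf_add (nab X Y) (nab X Y') p)) \<and>
     (\<forall>h X Y. smooth_fun A U h \<longrightarrow> vector_field_on A U X \<longrightarrow> vector_field_on A U Y \<longrightarrow>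
        (\<forall>p\<in>U. nab X (vf_scale h Y) p =
           vf_add (vf_scale (\<lambda>q. X q h) Y) (vf_scale h (nab X Y)) p)) \<and>
     (\<forall>X X' Y Y'. vector_field_on A U X \<longrightarrow> vector_field_on A U X' \<longrightarrow>
        vector_field_on A U Y \<longrightarrow> vector_field_on A U Y' \<longrightarrow>
        (\<forall>p\<in>U. X p = X' p \<and> Y p = Y' p) \<longrightarrow> (\<forall>p\<in>U. nab X Y p = nab X' Y' p)))"

definition torsion_free :: "('a, 'e::euclidean_space) atlas \<Rightarrow> ('a vfield \<Rightarrow> 'a vfield \<Rightarrow> 'a vfield) \<Rightarrow> bool" where
  "torsion_free A nab \<longleftrightarrow> (\<forall>U X Y. openin (manifold_topology A) U \<longrightarrow>
     vector_field_on A U X \<longrightarrow> vector_field_on A U Y \<longrightarrow>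
     (\<forall>p\<in>U. vf_diff (nab X Y) (nab Y X) p = lie_bracket A X Y p))"

definition flat :: "('a, 'e::euclidean_space) atlas \<Rightarrow> ('a vfield \<Rightarrow> 'a vfield \<Rightarrow> 'a vfield) \<Rightarrow> bool" where
  "flat A nab \<longleftrightarrow> (\<forall>U X Y Z. openin (manifold_topology A) U \<longrightarrow>
     vector_field_on A U X \<longrightarrow> vector_field_on A U Y \<longrightarrow> vector_field_on A U Z \<longrightarrow>
     (\<forall>p\<in>U. vf_diff (vf_diff (nab X (nab Y Z)) (nab Y (nab X Z))) (nab (lie_bracket A X Y) Z) p
        = (\<lambda>f. 0)))"

definition riemannian_metric :: "('a, 'e::euclidean_space) atlas \<Rightarrow> ('a \<Rightarrow> 'a tvec \<Rightarrow> 'a tvec \<Rightarrow> real) \<Rightarrow> bool" where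
  "riemannian_metric A g \<longleftrightarrow>
     (\<forall>p\<in>points A.
        (\<forall>u\<in>tangent_space A p. \<forall>v\<in>tangent_space A p. g p u v = g p v u) \<and>
        (\<forall>u\<in>tangent_space A p. \<forall>v\<in>tangent_space A p. \<forall>w\<in>tangent_space A p. \<forall>a b.
           g p (\<lambda>f. a * u f + b * v f) w = a * g p u w + b * g p v w) \<and>
        (\<forall>u\<in>tangent_space A p. u \<noteq> (\<lambda>f. 0) \<longrightarrow> g p u u > 0)) \<and>
     (\<forall>U X Y. openin (manifold_topology A) U \<longrightarrow> vector_field_on A U X \<longrightarrow>
        vector_field_on A U Y \<longrightarrow> smooth_fun A U (\<lambda>p. g p (X p) (Y p)))"

definition affine_riemann_manifold ::
  "('a, 'e::euclidean_space) atlas \<Rightarrow> ('a vfield \<Rightarrow> 'a vfield \<Rightarrow> 'a vfield) \<Rightarrow>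
   ('a \<Rightarrow> 'a tvec \<Rightarrow> 'a tvec \<Rightarrow> real) \<Rightarrow> bool" where
  "affine_riemann_manifold A nab g \<longleftrightarrow> smooth_manifold A \<and>
     connection A nab \<and> flat A nab \<and> torsion_free A nab \<and> riemannian_metric A g"

definition metric_connection ::
  "('a, 'e::euclidean_space) atlas \<Rightarrow> ('a \<Rightarrow> 'a tvec \<Rightarrow> 'a tvec \<Rightarrow> real) \<Rightarrow>
   ('a vfield \<Rightarrow> 'a vfield \<Rightarrow> 'a vfield) \<Rightarrow> bool" where
  "metric_connection A g D \<longleftrightarrow> (\<forall>U X Y Z. openin (manifold_topology A) U \<longrightarrow>
     vector_field_on A U X \<longrightarrow> vector_field_on A U Y \<longrightarrow> vector_field_on A U Z \<longrightarrow>
     (\<forall>p\<in>U. X p (\<lambda>q. g q (Y q) (Z q)) = g p (D X Y p) (Z p) + g p (Y p) (D X Z p)))"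

text \<open>Unique as an operator on smooth local vector fields; the values of the HOL function on
  other arguments are irrelevant.\<close>

definition levi_civita ::
  "('a, 'e::euclidean_space) atlas \<Rightarrow> ('a \<Rightarrow> 'a tvec \<Rightarrow> 'a tvec \<Rightarrow> real) \<Rightarrow>
   'a vfield \<Rightarrow> 'a vfield \<Rightarrow> 'a vfield" where
  "levi_civita A g = (SOME D. connection A D \<and> torsion_free A D \<and> metric_connection A g D)"

text \<open>Frames are indexed by the standard basis of the model space, which has as many elements
  as the dimension of the manifold.\<close>

definition orthonormal_frame_on ::
  "('a, 'e::euclidean_space) atlas \<Rightarrow> ('a \<Rightarrow> 'a tvec \<Rightarrow> 'a tvec \<Rightarrow> real) \<Rightarrow> 'a set \<Rightarrow>
   ('e \<Rightarrow> 'a vfield) \<Rightarrow> bool" where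
  "orthonormal_frame_on A g U E \<longleftrightarrow> (\<forall>i\<in>Basis. vector_field_on A U (E i)) \<and>
     (\<forall>p\<in>U. \<forall>i\<in>Basis. \<forall>j\<in>Basis. g p (E i p) (E j p) = (if i = j then 1 else 0))"

definition frame_at ::
  "('a, 'e::euclidean_space) atlas \<Rightarrow> ('a \<Rightarrow> 'a tvec \<Rightarrow> 'a tvec \<Rightarrow> real) \<Rightarrow> 'a \<Rightarrow> 'e \<Rightarrow> 'a vfield" where
  "frame_at A g p = (SOME E. \<exists>U. openin (manifold_topology A) U \<and> p \<in> U \<and>
     orthonormal_frame_on A g U E)"

definition metric_trace ::
  "('a, 'e::euclidean_space) atlas \<Rightarrow> ('a \<Rightarrow> 'a tvec \<Rightarrow> 'a tvec \<Rightarrow> real) \<Rightarrow>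
   ('a vfield \<Rightarrow> 'a vfield \<Rightarrow> 'a vfield) \<Rightarrow> 'a vfield" where
  "metric_trace A g S = (\<lambda>p f. \<Sum>i\<in>Basis. S (frame_at A g p i) (frame_at A g p i) p f)"


section \<open>Differential forms and the codifferential\<close>

text \<open>A \<open>k\<close>-form maps a list of \<open>k\<close> local vector fields to a function.\<close>

type_synonym 'a form = "'a vfield list \<Rightarrow> 'a \<Rightarrow> real"

definition covariant_derivative ::
  "('a vfield \<Rightarrow> 'a vfield \<Rightarrow> 'a vfield) \<Rightarrow> 'a vfield \<Rightarrow> 'a form \<Rightarrow> 'a form" where
  "covariant_derivative D X \<eta> = (\<lambda>Ys p. X p (\<eta> Ys) -
     (\<Sum>i<length Ys. \<eta> (Ys[i := D X (Ys ! i)]) p))"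

definition codifferential ::
  "('a, 'e::euclidean_space) atlas \<Rightarrow> ('a \<Rightarrow> 'a tvec \<Rightarrow> 'a tvec \<Rightarrow> real) \<Rightarrow> 'a form \<Rightarrow> 'a form" where
  "codifferential A g \<eta> = (\<lambda>Xs p. - (\<Sum>i\<in>Basis.
     covariant_derivative (levi_civita A g) (frame_at A g p i) \<eta> (frame_at A g p i # Xs) p))"


section \<open>The difference tensor and the Koszul forms\<close>

definition difference_tensor ::
  "('a, 'e::euclidean_space) atlas \<Rightarrow> ('a vfield \<Rightarrow> 'a vfield \<Rightarrow> 'a vfield) \<Rightarrow>
   ('a \<Rightarrow> 'a tvec \<Rightarrow> 'a tvec \<Rightarrow> real) \<Rightarrow> 'a vfield \<Rightarrow> 'a vfield \<Rightarrow> 'a vfield" where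
  "difference_tensor A nab g X Y = vf_diff (levi_civita A g X Y) (nab X Y)"

definition difference_tensor_adj ::
  "('a, 'e::euclidean_space) atlas \<Rightarrow> ('a vfield \<Rightarrow> 'a vfield \<Rightarrow> 'a vfield) \<Rightarrow>
   ('a \<Rightarrow> 'a tvec \<Rightarrow> 'a tvec \<Rightarrow> real) \<Rightarrow> 'a vfield \<Rightarrow> 'a vfield \<Rightarrow> 'a vfield" where
  "difference_tensor_adj A nab g X Y = (\<lambda>p. THE w. w \<in> tangent_space A p \<and>
     (\<forall>U Z. openin (manifold_topology A) U \<and> p \<in> U \<and> vector_field_on A U Z \<longrightarrow>
        g p w (Z p) = g p (Y p) (difference_tensor A nab g X Z p)))"

definition tr_gamma ::
  "('a, 'e::euclidean_space) atlas \<Rightarrow> ('a vfield \<Rightarrow> 'a vfield \<Rightarrow> 'a vfield) \<Rightarrow>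
   ('a \<Rightarrow> 'a tvec \<Rightarrow> 'a tvec \<Rightarrow> real) \<Rightarrow> 'a vfield" where
  "tr_gamma A nab g = metric_trace A g (difference_tensor A nab g)"

definition tr_gamma_adj ::
  "('a, 'e::euclidean_space) atlas \<Rightarrow> ('a vfield \<Rightarrow> 'a vfield \<Rightarrow> 'a vfield) \<Rightarrow>
   ('a \<Rightarrow> 'a tvec \<Rightarrow> 'a tvec \<Rightarrow> real) \<Rightarrow> 'a vfield" where
  "tr_gamma_adj A nab g = metric_trace A g (difference_tensor_adj A nab g)"

definition koszul_alpha ::
  "('a, 'e::euclidean_space) atlas \<Rightarrow> ('a vfield \<Rightarrow> 'a vfield \<Rightarrow> 'a vfield) \<Rightarrow>
   ('a \<Rightarrow> 'a tvec \<Rightarrow> 'a tvec \<Rightarrow> real) \<Rightarrow> 'a form" where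
  "koszul_alpha A nab g = (\<lambda>Xs p. g p (tr_gamma_adj A nab g p) ((Xs ! 0) p))"

definition koszul_xi ::
  "('a, 'e::euclidean_space) atlas \<Rightarrow> ('a vfield \<Rightarrow> 'a vfield \<Rightarrow> 'a vfield) \<Rightarrow>
   ('a \<Rightarrow> 'a tvec \<Rightarrow> 'a tvec \<Rightarrow> real) \<Rightarrow> 'a form" where
  "koszul_xi A nab g = (\<lambda>Xs p. g p (tr_gamma A nab g p) ((Xs ! 0) p))"


section \<open>Hermitian structures\<close>

definition fundamental_form ::
  "('a \<Rightarrow> 'a tvec \<Rightarrow> 'a tvec) \<Rightarrow> ('a \<Rightarrow> 'a tvec \<Rightarrow> 'a tvec \<Rightarrow> real) \<Rightarrow> 'a form" where
  "fundamental_form J g = (\<lambda>Xs p. g p (J p ((Xs ! 0) p)) ((Xs ! 1) p))"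

definition lee_form ::
  "('a, 'e::euclidean_space) atlas \<Rightarrow> ('a \<Rightarrow> 'a tvec \<Rightarrow> 'a tvec) \<Rightarrow>
   ('a \<Rightarrow> 'a tvec \<Rightarrow> 'a tvec \<Rightarrow> real) \<Rightarrow> 'a form" where
  "lee_form A J g = (\<lambda>Xs p. - codifferential A g (fundamental_form J g)
     [\<lambda>q. J q ((Xs ! 0) q)] p)"

definition gauduchon ::
  "('a, 'e::euclidean_space) atlas \<Rightarrow> ('a \<Rightarrow> 'a tvec \<Rightarrow> 'a tvec) \<Rightarrow>
   ('a \<Rightarrow> 'a tvec \<Rightarrow> 'a tvec \<Rightarrow> real) \<Rightarrow> bool" where
  "gauduchon A J g \<longleftrightarrow> (\<forall>p\<in>points A. codifferential A g (lee_form A J g) [] p = 0)"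


section \<open>The tangent bundle and its canonical Hermitian structure\<close>

text \<open>Points of the tangent bundle are pairs \<open>(p, u)\<close> with \<open>u\<close> tangent at \<open>p\<close>, so the bundle
  projection is \<open>fst\<close>. The fibre coordinates of \<open>u\<close> in a chart are the derivatives by \<open>u\<close> of the
  coordinate functions.\<close>

definition tangent_chart ::
  "('a, 'e::euclidean_space) atlas \<Rightarrow> ('a, 'e) chart \<Rightarrow> ('a \<times> 'a tvec, 'e \<times> 'e) chart" where
  "tangent_chart A c = ({(p, u). p \<in> fst c \<and> u \<in> tangent_space A p},
     \<lambda>(p, u). (snd c p, \<Sum>i\<in>Basis. u (\<lambda>q. snd c q \<bullet> i) *\<^sub>R i))"

definition tangent_atlas ::
  "('a, 'e::euclidean_space) atlas \<Rightarrow> ('a \<times> 'a tvec, 'e \<times> 'e) atlas" where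
  "tangent_atlas A = tangent_chart A ` A"

text \<open>The lifts are defined for single tangent vectors: \<open>X\<^sup>v (p, u) = vertical_lift A (p, u) (X p)\<close>,
  and likewise for \<open>X\<^sup>h\<close>.\<close>

definition vertical_lift ::
  "('a, 'e::euclidean_space) atlas \<Rightarrow> 'a \<times> 'a tvec \<Rightarrow> 'a tvec \<Rightarrow> ('a \<times> 'a tvec) tvec" where
  "vertical_lift A z v = (\<lambda>f. if smooth_at (tangent_atlas A) z f
     then deriv (\<lambda>t. f (fst z, \<lambda>h. snd z h + t * v h)) 0 else 0)"

text \<open>The horizontal lift of \<open>v\<close> at \<open>(p, u)\<close> is the image of \<open>v\<close> under the differential of any
  local section \<open>Y\<close> of the tangent bundle with \<open>Y p = u\<close> that is parallel at \<open>p\<close> in direction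
  \<open>v\<close>. The field \<open>X\<close> serves to evaluate the connection in direction \<open>v\<close>.\<close>

definition horizontal_lift ::
  "('a, 'e::euclidean_space) atlas \<Rightarrow> ('a vfield \<Rightarrow> 'a vfield \<Rightarrow> 'a vfield) \<Rightarrow>
   'a \<times> 'a tvec \<Rightarrow> 'a tvec \<Rightarrow> ('a \<times> 'a tvec) tvec" where
  "horizontal_lift A nab z v = (THE w. \<exists>U X Y. openin (manifold_topology A) U \<and> fst z \<in> U \<and>
     vector_field_on A U X \<and> vector_field_on A U Y \<and> X (fst z) = v \<and> Y (fst z) = snd z \<and>
     nab X Y (fst z) = (\<lambda>f. 0) \<and>
     w = differential (tangent_atlas A) (\<lambda>q. (q, Y q)) (fst z) v)"

text \<open>The pair \<open>(x, y)\<close> such that \<open>w\<close> is the sum of the horizontal lift of \<open>x\<close> and the vertical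
  lift of \<open>y\<close>.\<close>

definition lift_parts ::
  "('a, 'e::euclidean_space) atlas \<Rightarrow> ('a vfield \<Rightarrow> 'a vfield \<Rightarrow> 'a vfield) \<Rightarrow>
   'a \<times> 'a tvec \<Rightarrow> ('a \<times> 'a tvec) tvec \<Rightarrow> 'a tvec \<times> 'a tvec" where
  "lift_parts A nab z w = (THE xy. fst xy \<in> tangent_space A (fst z) \<and>
     snd xy \<in> tangent_space A (fst z) \<and>
     w = (\<lambda>f. horizontal_lift A nab z (fst xy) f + vertical_lift A z (snd xy) f))"

definition canonical_J ::
  "('a, 'e::euclidean_space) atlas \<Rightarrow> ('a vfield \<Rightarrow> 'a vfield \<Rightarrow> 'a vfield) \<Rightarrow>
   'a \<times> 'a tvec \<Rightarrow> ('a \<times> 'a tvec) tvec \<Rightarrow> ('a \<times> 'a tvec) tvec" where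
  "canonical_J A nab z w = (case lift_parts A nab z w of (x, y) \<Rightarrow>
     (\<lambda>f. vertical_lift A z x f - horizontal_lift A nab z y f))"

definition canonical_metric ::
  "('a, 'e::euclidean_space) atlas \<Rightarrow> ('a vfield \<Rightarrow> 'a vfield \<Rightarrow> 'a vfield) \<Rightarrow>
   ('a \<Rightarrow> 'a tvec \<Rightarrow> 'a tvec \<Rightarrow> real) \<Rightarrow>
   'a \<times> 'a tvec \<Rightarrow> ('a \<times> 'a tvec) tvec \<Rightarrow> ('a \<times> 'a tvec) tvec \<Rightarrow> real" where
  "canonical_metric A nab g z w w' =
     (case lift_parts A nab z w of (x, y) \<Rightarrow> case lift_parts A nab z w' of (x', y') \<Rightarrow>
        g (fst z) x x' + g (fst z) y y')"

end

theory Submission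
  imports Defs
begin

text \<open>
  Let \<open>T = tr(\<gamma>\<^sup>*) - tr(\<gamma>)\<close>. The point is that the Lee form is \<open>g\<^sub>1(T\<^sup>h, \<cdot>)\<close>. Writing the codifferential of the
  fundamental form as the trace of \<open>D\<^sup>1J\<^sub>1\<close> and using a frame \<open>(E\<^sub>i\<^sup>h, E\<^sub>i\<^sup>v)\<close> lifted from an orthonormal
  frame \<open>(E\<^sub>i)\<close> of the base, the mixed terms combine to \<open>[E\<^sub>i\<^sup>h, E\<^sub>i\<^sup>v] = (\<nabla>\<^bsub>E\<^sub>i\<^esub>E\<^sub>i)\<^sup>v\<close>, while metric
  compatibility, torsion-freeness and \<open>\<langle>E\<^sub>i, E\<^sub>i\<rangle> = 1\<close> give \<open>D\<^sup>1\<^bsub>E\<^sub>i\<^sup>h\<^esub>E\<^sub>i\<^sup>h = (D\<^bsub>E\<^sub>i\<^esub>E\<^sub>i)\<^sup>h\<close> and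
  \<open>D\<^sup>1\<^bsub>E\<^sub>i\<^sup>v\<^esub>E\<^sub>i\<^sup>v = -(\<gamma>\<^sup>*\<^bsub>E\<^sub>i\<^esub>E\<^sub>i)\<^sup>h\<close>. The codifferential of a one-form \<open>\<langle>T, \<cdot>\<rangle>\<close> is minus the divergence of
  \<open>T\<close>; in the divergence of \<open>T\<^sup>h\<close> the horizontal part of the frame contributes the divergence of \<open>T\<close> and the
  vertical part contributes \<open>\<langle>T, tr(\<gamma>\<^sup>*)\<rangle>\<close>.
\<close>

section \<open>Calculus of smooth maps\<close>

text \<open>The definitions evaluate traces and codifferentials in \<open>frame_at A g p\<close>, a
  frame chosen anew at every point and unrelated to any lifted frame. The obstacle is to pass from
  it to a convenient frame. This rests on tensoriality: an expression in vector fields that is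
  additive, homogeneous over smooth functions and local at p depends only on values at p, so its
  trace is the same in all orthonormal frames. Both \<open>levi_civita\<close> and the lifts are
  picked out by description operators, so existence comes before any computation: the Koszul
  formula, on M and again on TM, for the former, and the Christoffel symbols of \<nabla> for the
  latter. The full Levi-Civita connection of \<open>g\<^sub>1\<close> is never determined. Only
  derivatives of the lifted frame along itself enter, and since g(D_Z E, E) = 0 for a unit field E,
  the torsion identity expresses them through brackets of lifts, which are explicit in
  coordinates.\<close>

lemma Ck_on_cong:
  assumes "open S" "\<And>x. x \<in> S \<Longrightarrow> f x = h x" "Ck_on k S f"
  shows "Ck_on k S h"
  using assms(2,3)
proof (induction k arbitrary: f h)
  case 0
  then show ?case by (simp add: continuous_on_cong[of S S f h])
next
  case (Suc k)
  have "h differentiable (at x)" if "x \<in> S" for x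
    using Suc.prems that assms(1) unfolding differentiable_def Ck_on.simps
    by (meson has_derivative_transform_within_open)
  moreover have "Ck_on k S (\<lambda>x. frechet_derivative h (at x) v)" for v
  proof (rule Suc.IH)
    show "Ck_on k S (\<lambda>x. frechet_derivative f (at x) v)" using Suc.prems by simp
    show "frechet_derivative f (at x) v = frechet_derivative h (at x) v" if "x \<in> S" for x
      using frechet_derivative_transform_within_open[of f x S h] Suc.prems that assms(1) by simp
  qed
  ultimately show ?case by simp
qed

text \<open>On an open set the derivative is unique, so a closed formula for it may replace
  \<open>frechet_derivative\<close>. Most closure rules below are inductions that use this rule in
  the step.\<close>

lemma Ck_on_SucI:
  assumes "open S" "\<And>x. x \<in> S \<Longrightarrow> (f has_derivative f' x) (at x)"
    and "\<And>v. Ck_on k S (\<lambda>x. f' x v)"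
  shows "Ck_on (Suc k) S f"
proof -
  have "f' x = frechet_derivative f (at x)" if "x \<in> S" for x
    using assms(2)[OF that] by (rule frechet_derivative_at)
  then have "Ck_on k S (\<lambda>x. frechet_derivative f (at x) v)" for v
    by (intro Ck_on_cong[OF assms(1) _ assms(3)[of v]]) simp
  then show ?thesis using assms(2) by (auto simp: differentiable_def)
qed

lemma Ck_on_SucD:
  assumes "Ck_on (Suc k) S f"
  shows "x \<in> S \<Longrightarrow> (f has_derivative frechet_derivative f (at x)) (at x)"
    and "Ck_on k S (\<lambda>x. frechet_derivative f (at x) v)"
  using assms frechet_derivative_works by auto

text \<open>In the product and chain rules one factor stays undifferentiated, so the induction also
  asks for it at the lower order.\<close>

lemma Ck_on_Suc_imp: "Ck_on (Suc k) S f \<Longrightarrow> Ck_on k S f"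
proof (induction k arbitrary: f)
  case 0
  then show ?case
    by (auto intro!: continuous_at_imp_continuous_on differentiable_imp_continuous_within)
next
  case (Suc k)
  then have "Ck_on k S (\<lambda>x. frechet_derivative f (at x) v)" for v
    using Ck_on.simps(2) by blast
  then show ?case using Suc.prems by simp
qed

lemma Ck_on_subset: "Ck_on k S f \<Longrightarrow> T \<subseteq> S \<Longrightarrow> Ck_on k T f"
  by (induction k arbitrary: f) (auto intro: continuous_on_subset)

text \<open>Differentiability and, for open T, continuity are conditions at single points, so
  nothing has to be glued.\<close>

lemma Ck_on_local:
  assumes "\<And>x. x \<in> S \<Longrightarrow> \<exists>T. open T \<and> x \<in> T \<and> Ck_on k T f"
  shows "Ck_on k S f"
  using assms
proof (induction k arbitrary: f)
  case 0
  then show ?case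
    by (auto intro!: continuous_at_imp_continuous_on simp: continuous_on_eq_continuous_at)
      (metis continuous_on_eq_continuous_at)
next
  case (Suc k)
  have "Ck_on k S (\<lambda>x. frechet_derivative f (at x) v)" for v
  proof (rule Suc.IH)
    fix x assume "x \<in> S"
    then obtain T where "open T" "x \<in> T" "Ck_on (Suc k) T f" using Suc.prems by blast
    then show "\<exists>T. open T \<and> x \<in> T \<and> Ck_on k T (\<lambda>x. frechet_derivative f (at x) v)"
      using Ck_on_SucD(2) by blast
  qed
  moreover have "f differentiable (at x)" if "x \<in> S" for x
    using Suc.prems[OF that] by auto
  ultimately show ?case by simp
qed

lemma Ck_on_const: "open S \<Longrightarrow> Ck_on k S (\<lambda>x. c)"
proof (induction k arbitrary: c)
  case (Suc k)
  then show ?case by (auto intro!: Ck_on_SucI[where f' = "\<lambda>_ _. 0"])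
qed simp

lemma Ck_on_linear: "open S \<Longrightarrow> bounded_linear f \<Longrightarrow> Ck_on k S f"
proof (cases k)
  case (Suc j)
  assume "open S" "bounded_linear f"
  then show ?thesis
    unfolding Suc by (intro Ck_on_SucI[where f' = "\<lambda>_. f"] Ck_on_const)
      (auto intro: bounded_linear_imp_has_derivative)
qed (simp add: linear_continuous_on)

lemma Ck_on_linear_compose:
  assumes "open S" "bounded_linear L"
  shows "Ck_on k S f \<Longrightarrow> Ck_on k S (\<lambda>x. L (f x))"
proof (induction k arbitrary: f)
  case 0
  then show ?case
    using assms(2) by (simp add: bounded_linear.continuous_on)
next
  case (Suc k)
  show ?case
    by (intro Ck_on_SucI[where f' = "\<lambda>x v. L (frechet_derivative f (at x) v)"] assms Suc.IH
        bounded_linear.has_derivative[OF assms(2)] Ck_on_SucD[OF Suc.prems])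
qed

lemma Ck_on_add:
  assumes "open S"
  shows "Ck_on k S f \<Longrightarrow> Ck_on k S h \<Longrightarrow> Ck_on k S (\<lambda>x. f x + h x)"
proof (induction k arbitrary: f h)
  case 0
  then show ?case by (simp add: continuous_on_add)
next
  case (Suc k)
  show ?case
    by (intro Ck_on_SucI[where f' = "\<lambda>x v. frechet_derivative f (at x) v + frechet_derivative h (at x) v"]
        assms Suc.IH has_derivative_add Ck_on_SucD[OF Suc.prems(1)] Ck_on_SucD[OF Suc.prems(2)])
qed

lemma Ck_on_scaleR:
  fixes f :: "'e::real_normed_vector \<Rightarrow> real"
  assumes "open S"
  shows "Ck_on k S f \<Longrightarrow> Ck_on k S h \<Longrightarrow> Ck_on k S (\<lambda>x. f x *\<^sub>R h x)"
proof (induction k arbitrary: f h)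
  case 0
  then show ?case by (simp add: continuous_on_scaleR)
next
  case (Suc k)
  show ?case
    by (intro Ck_on_SucI[where f' = "\<lambda>x v. f x *\<^sub>R frechet_derivative h (at x) v
            + frechet_derivative f (at x) v *\<^sub>R h x"] assms Ck_on_add Suc.IH
        has_derivative_scaleR Ck_on_SucD[OF Suc.prems(1)] Ck_on_SucD[OF Suc.prems(2)]
        Suc.prems[THEN Ck_on_Suc_imp])
qed

lemma Ck_on_sum:
  assumes "open S" "\<And>i. i \<in> I \<Longrightarrow> Ck_on k S (f i)"
  shows "Ck_on k S (\<lambda>x. \<Sum>i\<in>I. f i x)"
  using assms(2)
  by (induction I rule: infinite_finite_induct) (auto intro!: Ck_on_const Ck_on_add assms(1))

lemma Ck_on_componentwise:
  fixes f :: "'e::real_normed_vector \<Rightarrow> 'f::euclidean_space"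
  assumes "open S" "\<And>i. i \<in> Basis \<Longrightarrow> Ck_on k S (\<lambda>x. f x \<bullet> i)"
  shows "Ck_on k S f"
proof -
  have "Ck_on k S (\<lambda>x. \<Sum>i\<in>Basis. (f x \<bullet> i) *\<^sub>R i)"
    by (intro Ck_on_sum Ck_on_scaleR Ck_on_const assms)
  then show ?thesis by (simp add: euclidean_representation)
qed

text \<open>\<open>Ck_on\<close> speaks of derivatives in a fixed direction, whereas the chain rule
  differentiates h in the direction f'(x) v, which moves with x. Expanding that direction in the
  basis of the Euclidean middle space gives a sum of products to which the induction hypothesis
  applies.\<close>

lemma Ck_on_compose:
  fixes f :: "'e::real_normed_vector \<Rightarrow> 'f::euclidean_space"
  assumes "open S" "open T" "f ` S \<subseteq> T"
  shows "Ck_on k S f \<Longrightarrow> Ck_on k T h \<Longrightarrow> Ck_on k S (\<lambda>x. h (f x))"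
proof (induction k arbitrary: h)
  case 0
  then show ?case using continuous_on_compose2 assms(3) by (simp) blast
next
  case (Suc k)
  let ?D = "\<lambda>x v. \<Sum>j\<in>Basis. (frechet_derivative f (at x) v \<bullet> j) *\<^sub>R frechet_derivative h (at (f x)) j"
  show ?case
  proof (rule Ck_on_SucI[where f' = ?D])
    fix x assume x: "x \<in> S"
    have h: "(h has_derivative frechet_derivative h (at (f x))) (at (f x))"
      using Ck_on_SucD(1)[OF Suc.prems(2)] x assms(3) by blast
    interpret h': bounded_linear "frechet_derivative h (at (f x))"
      using h by (rule has_derivative_bounded_linear)
    have "frechet_derivative h (at (f x)) (frechet_derivative f (at x) v) = ?D x v" for v
      using arg_cong[OF euclidean_representation[of "frechet_derivative f (at x) v"],
          of "frechet_derivative h (at (f x))", symmetric]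
      by (simp add: h'.sum h'.scaleR)
    with has_derivative_compose[OF Ck_on_SucD(1)[OF Suc.prems(1) x] h]
    show "((\<lambda>x. h (f x)) has_derivative ?D x) (at x)" by simp
  next
    fix v show "Ck_on k S (\<lambda>x. ?D x v)"
      by (intro Ck_on_sum Ck_on_scaleR assms(1) Suc.IH Ck_on_SucD(2)[OF Suc.prems(2)]
          Ck_on_Suc_imp[OF Suc.prems(1)]
          Ck_on_linear_compose[OF _ bounded_linear_inner_left Ck_on_SucD(2)[OF Suc.prems(1)]])
  qed (rule assms)
qed

text \<open>Wanted for the exponent -1/2 of a normalising factor; the exponent is general because
  differentiation lowers it by one.\<close>

lemma Ck_on_powr: "Ck_on k {0<..} (\<lambda>x::real. x powr a)"
proof (induction k arbitrary: a)
  case 0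
  then show ?case by (auto intro!: continuous_intros)
next
  case (Suc k)
  show ?case
  proof (rule Ck_on_SucI[where f' = "\<lambda>x v. (v * a) *\<^sub>R x powr (a - 1)"])
    fix x :: real assume "x \<in> {0<..}"
    then show "((\<lambda>x. x powr a) has_derivative (\<lambda>v. (v * a) *\<^sub>R x powr (a - 1))) (at x)"
      using has_derivative_eq_rhs[OF has_real_derivative_powr[of x a, unfolded has_field_derivative_def]]
      by (auto simp: fun_eq_iff)
  qed (intro Ck_on_scaleR Ck_on_const Suc.IH open_greaterThan)+
qed

lemma smooth_on_cong: "open S \<Longrightarrow> (\<And>x. x \<in> S \<Longrightarrow> f x = h x) \<Longrightarrow> smooth_on S f \<Longrightarrow> smooth_on S h"
  unfolding smooth_on_def using Ck_on_cong by blast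

lemma smooth_on_subset: "smooth_on S f \<Longrightarrow> T \<subseteq> S \<Longrightarrow> smooth_on T f"
  unfolding smooth_on_def using Ck_on_subset by blast

lemma smooth_on_local:
  assumes "\<And>x. x \<in> S \<Longrightarrow> \<exists>T. open T \<and> x \<in> T \<and> smooth_on T f"
  shows "smooth_on S f"
  using assms unfolding smooth_on_def by (metis Ck_on_local)

lemma smooth_on_imp_has_derivative:
  "smooth_on S f \<Longrightarrow> x \<in> S \<Longrightarrow> (f has_derivative frechet_derivative f (at x)) (at x)"
  unfolding smooth_on_def using Ck_on_SucD(1) by blast

lemma smooth_on_frechet_derivative:
  "smooth_on S f \<Longrightarrow> smooth_on S (\<lambda>x. frechet_derivative f (at x) v)"
  unfolding smooth_on_def using Ck_on_SucD(2) by blast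

lemma smooth_on_const: "open S \<Longrightarrow> smooth_on S (\<lambda>x. c)"
  by (simp add: smooth_on_def Ck_on_const)

lemma smooth_on_linear: "open S \<Longrightarrow> bounded_linear f \<Longrightarrow> smooth_on S f"
  by (simp add: smooth_on_def Ck_on_linear)

lemma smooth_on_add:
  "open S \<Longrightarrow> smooth_on S f \<Longrightarrow> smooth_on S h \<Longrightarrow> smooth_on S (\<lambda>x. f x + h x)"
  by (simp add: smooth_on_def Ck_on_add)

lemma smooth_on_mult:
  fixes f :: "'e::real_normed_vector \<Rightarrow> real"
  shows "open S \<Longrightarrow> smooth_on S f \<Longrightarrow> smooth_on S h \<Longrightarrow> smooth_on S (\<lambda>x. f x * h x)"
  using Ck_on_scaleR[of S _ f h] by (simp add: smooth_on_def)

lemma smooth_on_sum: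
  "open S \<Longrightarrow> (\<And>i. i \<in> I \<Longrightarrow> smooth_on S (f i)) \<Longrightarrow> smooth_on S (\<lambda>x. \<Sum>i\<in>I. f i x)"
  by (simp add: smooth_on_def Ck_on_sum)

lemma smooth_on_componentwise:
  fixes f :: "'e::real_normed_vector \<Rightarrow> 'f::euclidean_space"
  shows "open S \<Longrightarrow> (\<And>i. i \<in> Basis \<Longrightarrow> smooth_on S (\<lambda>x. f x \<bullet> i)) \<Longrightarrow> smooth_on S f"
  by (simp add: smooth_on_def Ck_on_componentwise)

lemma smooth_on_inner_left:
  "open S \<Longrightarrow> smooth_on S f \<Longrightarrow> smooth_on S (\<lambda>x. f x \<bullet> i)"
  unfolding smooth_on_def using Ck_on_linear_compose[OF _ bounded_linear_inner_left] by blast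

lemma smooth_on_compose:
  fixes f :: "'e::real_normed_vector \<Rightarrow> 'f::euclidean_space"
  shows "open S \<Longrightarrow> open T \<Longrightarrow> f ` S \<subseteq> T \<Longrightarrow> smooth_on S f \<Longrightarrow> smooth_on T h \<Longrightarrow>
    smooth_on S (\<lambda>x. h (f x))"
  unfolding smooth_on_def using Ck_on_compose by blast

lemma smooth_on_powr: "smooth_on {0<..} (\<lambda>x::real. x powr a)"
  by (simp add: smooth_on_def Ck_on_powr)

section \<open>Symmetry of second derivatives\<close>

lemma has_real_derivative_along_line:
  fixes f :: "'e::real_normed_vector \<Rightarrow> real"
  assumes "(f has_derivative f') (at (x + s *\<^sub>R v))"
  shows "((\<lambda>s. f (x + s *\<^sub>R v)) has_real_derivative f' v) (at s)"
proof -
  interpret f': bounded_linear f' using assms by (rule has_derivative_bounded_linear)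
  have "((\<lambda>s. x + s *\<^sub>R v) has_derivative (\<lambda>t. t *\<^sub>R v)) (at s)"
    by (auto intro!: derivative_eq_intros)
  from has_derivative_compose[OF this assms]
  show ?thesis by (simp add: has_field_derivative_def f'.scaleR mult_commute_abs)
qed

text \<open>Two applications of the mean value theorem: along v to the difference of f on two
  opposite sides of the parallelogram, then along w to the derivative in direction v.\<close>

lemma second_difference_mvt:
  fixes f :: "'e::real_normed_vector \<Rightarrow> real"
  assumes h: "0 < h"
    and S: "\<And>s t. 0 \<le> s \<Longrightarrow> s \<le> h \<Longrightarrow> 0 \<le> t \<Longrightarrow> t \<le> h \<Longrightarrow> x + s *\<^sub>R v + t *\<^sub>R w \<in> S"
    and f: "\<And>y. y \<in> S \<Longrightarrow> (f has_derivative f' y) (at y)"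
    and f'': "\<And>y. y \<in> S \<Longrightarrow> ((\<lambda>y. f' y v) has_derivative f'' y) (at y)"
  shows "\<exists>s t. 0 < s \<and> s < h \<and> 0 < t \<and> t < h \<and>
    f (x + h *\<^sub>R v + h *\<^sub>R w) - f (x + h *\<^sub>R v) - f (x + h *\<^sub>R w) + f x
      = h * h * f'' (x + s *\<^sub>R v + t *\<^sub>R w) w"
proof -
  define p where "p s = f ((x + h *\<^sub>R w) + s *\<^sub>R v) - f (x + s *\<^sub>R v)" for s
  have "(p has_real_derivative f' (x + h *\<^sub>R w + s *\<^sub>R v) v - f' (x + s *\<^sub>R v) v) (at s)"
    if "0 \<le> s" "s \<le> h" for s
  proof -
    have "x + h *\<^sub>R w + s *\<^sub>R v \<in> S" "x + s *\<^sub>R v \<in> S"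
      using S[of s h] S[of s 0] that h by (auto simp: algebra_simps)
    then show ?thesis unfolding p_def
      by (intro DERIV_diff has_real_derivative_along_line f)
  qed
  from MVT2[OF h this] obtain s where s: "0 < s" "s < h"
    "p h - p 0 = h * (f' (x + h *\<^sub>R w + s *\<^sub>R v) v - f' (x + s *\<^sub>R v) v)" by auto
  have "((\<lambda>t. f' (x + s *\<^sub>R v + t *\<^sub>R w) v) has_real_derivative f'' (x + s *\<^sub>R v + t *\<^sub>R w) w) (at t)"
    if "0 \<le> t" "t \<le> h" for t
    using has_real_derivative_along_line[OF f''[OF S[of s t]]] s that by auto
  from MVT2[OF h this] obtain t where t: "0 < t" "t < h"
    "f' (x + s *\<^sub>R v + h *\<^sub>R w) v - f' (x + s *\<^sub>R v) v = h * f'' (x + s *\<^sub>R v + t *\<^sub>R w) w" by auto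
  have "p h - p 0 = h * h * f'' (x + s *\<^sub>R v + t *\<^sub>R w) w"
    using s(3) t(3) by (simp add: algebra_simps)
  then show ?thesis using s t unfolding p_def
    by (intro exI[of _ s] exI[of _ t]) (simp add: algebra_simps)
qed

text \<open>The second difference of f over the parallelogram spanned by h v and h w is symmetric in
  v and w. It is h squared times either mixed derivative at some point of the parallelogram, so by
  continuity two different values at x would contradict each other for small h.\<close>

lemma smooth_on_symmetric_second_derivative:
  fixes f :: "'e::real_normed_vector \<Rightarrow> real"
  assumes "open S" "x \<in> S" "smooth_on S f"
  shows "frechet_derivative (\<lambda>y. frechet_derivative f (at y) v) (at x) w =
         frechet_derivative (\<lambda>y. frechet_derivative f (at y) w) (at x) v" (is "?a v w x = ?a w v x")
proof (rule ccontr)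
  assume ne: "?a v w x \<noteq> ?a w v x"
  define e where "e = \<bar>?a v w x - ?a w v x\<bar> / 2"
  have "e > 0" using ne by (simp add: e_def)
  have cont: "isCont (?a v w) x" for v w
    using smooth_on_frechet_derivative[OF smooth_on_frechet_derivative[OF assms(3)], of v w] assms
    by (metis Ck_on.simps(1) continuous_on_eq_continuous_at smooth_on_def)
  obtain d1 where d1: "d1 > 0" "\<And>y. dist y x < d1 \<Longrightarrow> dist (?a v w y) (?a v w x) < e"
    using cont[of v w] \<open>e > 0\<close> unfolding continuous_at_eps_delta by blast
  obtain d2 where d2: "d2 > 0" "\<And>y. dist y x < d2 \<Longrightarrow> dist (?a w v y) (?a w v x) < e"
    using cont[of w v] \<open>e > 0\<close> unfolding continuous_at_eps_delta by blast
  obtain d3 where d3: "d3 > 0" "ball x d3 \<subseteq> S" using assms open_contains_ball by blast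
  define d where "d = min d1 (min d2 d3)"
  have d: "d > 0" using d1 d2 d3 by (simp add: d_def)
  \<comment> \<open>The denominator puts every point of the parallelogram within d of x; the summand
    1 keeps it positive when v and w vanish.\<close>
  define h where "h = d / (norm v + norm w + 1)"
  have n: "norm v + norm w + 1 > 0" by (smt (verit) norm_ge_zero)
  have h: "h > 0" unfolding h_def using d n by simp
  have near: "dist (x + s *\<^sub>R v + t *\<^sub>R w) x < d" if "0 \<le> s" "s \<le> h" "0 \<le> t" "t \<le> h" for s t
  proof -
    have "norm (s *\<^sub>R v + t *\<^sub>R w) \<le> s * norm v + t * norm w"
      using norm_triangle_ineq[of "s *\<^sub>R v" "t *\<^sub>R w"] that by simp
    also have "\<dots> \<le> h * norm v + h * norm w" using that by (intro add_mono mult_right_mono) auto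
    also have "\<dots> < h * (norm v + norm w + 1)" using h by (simp add: algebra_simps)
    also have "\<dots> = d" using n by (simp add: h_def)
    finally show ?thesis by (simp add: dist_norm add.assoc)
  qed
  have S: "x + s *\<^sub>R v + t *\<^sub>R w \<in> S" if "0 \<le> s" "s \<le> h" "0 \<le> t" "t \<le> h" for s t
    using near[OF that] d3(2) by (auto simp: d_def dist_commute subset_iff)
  note f = smooth_on_imp_has_derivative[OF assms(3)]
  note f'' = smooth_on_imp_has_derivative[OF smooth_on_frechet_derivative[OF assms(3)]]
  obtain s t where st: "0 < s" "s < h" "0 < t" "t < h"
    "f (x + h *\<^sub>R v + h *\<^sub>R w) - f (x + h *\<^sub>R v) - f (x + h *\<^sub>R w) + f x
      = h * h * ?a v w (x + s *\<^sub>R v + t *\<^sub>R w)"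
    using second_difference_mvt[OF h S f f''] by blast
  have S': "x + s *\<^sub>R w + t *\<^sub>R v \<in> S" if "0 \<le> s" "s \<le> h" "0 \<le> t" "t \<le> h" for s t
    using S[of t s] that by (simp add: algebra_simps)
  obtain s' t' where st': "0 < s'" "s' < h" "0 < t'" "t' < h"
    "f (x + h *\<^sub>R w + h *\<^sub>R v) - f (x + h *\<^sub>R w) - f (x + h *\<^sub>R v) + f x
      = h * h * ?a w v (x + s' *\<^sub>R w + t' *\<^sub>R v)"
    using second_difference_mvt[OF h S' f f''] by blast
  have "x + h *\<^sub>R w + h *\<^sub>R v = x + h *\<^sub>R v + h *\<^sub>R w" by simp
  then have "h * h * ?a v w (x + s *\<^sub>R v + t *\<^sub>R w) = h * h * ?a w v (x + s' *\<^sub>R w + t' *\<^sub>R v)"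
    using st(5) st'(5) by (metis diff_diff_eq add.commute)
  with h have eq: "?a v w (x + s *\<^sub>R v + t *\<^sub>R w) = ?a w v (x + s' *\<^sub>R w + t' *\<^sub>R v)"
    by simp
  have swap: "x + s' *\<^sub>R w + t' *\<^sub>R v = x + t' *\<^sub>R v + s' *\<^sub>R w" by simp
  have "dist (x + s' *\<^sub>R w + t' *\<^sub>R v) x < d"
    unfolding swap by (rule near) (use st' in auto)
  then have "\<bar>?a w v (x + s' *\<^sub>R w + t' *\<^sub>R v) - ?a w v x\<bar> < e"
    using d2(2) by (auto simp: d_def dist_real_def)
  moreover have "\<bar>?a v w (x + s *\<^sub>R v + t *\<^sub>R w) - ?a v w x\<bar> < e"
    using d1(2) near[of s t] st by (auto simp: d_def dist_real_def)
  \<comment> \<open>The common value k of both second difference quotients cannot be closer than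
    half the gap to each of the two distinct values at x.\<close>
  moreover have "\<not> (\<bar>k - b\<bar> < \<bar>a - b\<bar> / 2 \<and> \<bar>k - a\<bar> < \<bar>a - b\<bar> / 2)" for a b k :: real
    by (auto simp: abs_if split: if_splits)
  ultimately show False unfolding eq e_def by blast
qed

text \<open>Splits sums over a frame of TM, indexed by the basis of the product space, into a
  horizontal and a vertical half.\<close>

lemma sum_Basis_prod:
  fixes f :: "'b::euclidean_space \<times> 'c::euclidean_space \<Rightarrow> real"
  shows "sum f Basis = (\<Sum>i\<in>Basis. f (i, 0)) + (\<Sum>i\<in>Basis. f (0, i))"
proof -
  have inj: "inj_on (\<lambda>u. (u::'b, 0::'c)) Basis" "inj_on (\<lambda>u. (0::'b, u::'c)) Basis"
    by (auto intro!: inj_onI)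
  have "sum f Basis = sum f ((\<lambda>u. (u, 0)) ` Basis) + sum f ((\<lambda>u. (0, u)) ` Basis)"
    unfolding Basis_prod_def by (rule sum.union_disjoint) auto
  then show ?thesis by (simp add: sum.reindex inj)
qed

section \<open>Tangent vectors and vector fields\<close>

text \<open>The chart axioms form a locale of their own so that the theory below applies to the
  atlas of M and, by \<open>charted_tangent\<close>, once more to that of TM.\<close>

locale charted =
  fixes A :: "('a, 'e::euclidean_space) atlas"
  assumes chart_inj: "c \<in> A \<Longrightarrow> inj_on (snd c) (fst c)"
    and chart_open: "c \<in> A \<Longrightarrow> open (snd c ` fst c)"
    and chart_overlap_open: "c \<in> A \<Longrightarrow> d \<in> A \<Longrightarrow> open (snd c ` (fst c \<inter> fst d))"
    and chart_transition: "c \<in> A \<Longrightarrow> d \<in> A \<Longrightarrow>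
      smooth_on (snd c ` (fst c \<inter> fst d)) (snd d \<circ> chart_inv c)"
begin

abbreviation mopen :: "'a set \<Rightarrow> bool" where "mopen \<equiv> openin (manifold_topology A)"
abbreviation vf :: "'a set \<Rightarrow> 'a vfield \<Rightarrow> bool" where "vf \<equiv> vector_field_on A"
abbreviation TS :: "'a \<Rightarrow> 'a tvec set" where "TS \<equiv> tangent_space A"
abbreviation sfun :: "'a set \<Rightarrow> ('a \<Rightarrow> real) \<Rightarrow> bool" where "sfun \<equiv> smooth_fun A"
abbreviation crd :: "('a, 'e) chart \<Rightarrow> 'e \<Rightarrow> 'a \<Rightarrow> real" where "crd c i \<equiv> (\<lambda>q. snd c q \<bullet> i)"

lemma chart_inv_left: "c \<in> A \<Longrightarrow> p \<in> fst c \<Longrightarrow> chart_inv c (snd c p) = p"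
  by (simp add: chart_inv_def chart_inj)

lemma mopen_iff: "mopen U \<longleftrightarrow> U \<subseteq> points A \<and> (\<forall>c\<in>A. open (snd c ` (U \<inter> fst c)))"
proof -
  have "{x \<in> snd c ` fst c. chart_inv c x \<in> U} = snd c ` (U \<inter> fst c)" if "c \<in> A" for c
    using chart_inv_left[OF that] by auto
  then show ?thesis unfolding openin_manifold_topology by (metis (no_types, lifting))
qed

lemma mopen_imp_open: "mopen U \<Longrightarrow> c \<in> A \<Longrightarrow> open (snd c ` (U \<inter> fst c))"
  by (simp add: mopen_iff)

lemma mopen_chart: "c \<in> A \<Longrightarrow> mopen (fst c)"
  using chart_overlap_open by (auto simp: mopen_iff points_def Int_commute)

lemma mopen_imp_chart:
  assumes "mopen U" "p \<in> U"
  obtains c where "c \<in> A" "p \<in> fst c"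
  using assms by (auto simp: mopen_iff points_def)

lemma smooth_fun_subset: "sfun U f \<Longrightarrow> V \<subseteq> U \<Longrightarrow> sfun V f"
  unfolding smooth_fun_def by (meson Int_mono image_mono order_refl smooth_on_subset)

lemma smooth_fun_local:
  assumes "\<And>p. p \<in> U \<Longrightarrow> \<exists>W. mopen W \<and> p \<in> W \<and> sfun W f"
  shows "sfun U f"
  unfolding smooth_fun_def
proof (intro ballI smooth_on_local)
  fix c x assume c: "c \<in> A" "x \<in> snd c ` (U \<inter> fst c)"
  then obtain p where p: "p \<in> U" "p \<in> fst c" "x = snd c p" by auto
  then obtain W where "mopen W" "p \<in> W" "sfun W f" using assms by blast
  then show "\<exists>T. open T \<and> x \<in> T \<and> smooth_on T (f \<circ> chart_inv c)"
    using c p by (intro exI[of _ "snd c ` (W \<inter> fst c)"]) (auto simp: mopen_imp_open smooth_fun_def)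
qed

lemma smooth_fun_cong:
  assumes "mopen U" "\<And>p. p \<in> U \<Longrightarrow> f p = h p" "sfun U f"
  shows "sfun U h"
  unfolding smooth_fun_def
proof
  fix c assume c: "c \<in> A"
  show "smooth_on (snd c ` (U \<inter> fst c)) (h \<circ> chart_inv c)"
  proof (rule smooth_on_cong)
    show "smooth_on (snd c ` (U \<inter> fst c)) (f \<circ> chart_inv c)" using assms c by (simp add: smooth_fun_def)
  qed (use assms c in \<open>auto simp: mopen_imp_open chart_inv_left\<close>)
qed

text \<open>One chart around U is enough: in any other chart the function is the same expression
  composed with a smooth transition map.\<close>

lemma smooth_fun_chartI:
  assumes c: "c \<in> A" and U: "mopen U" "U \<subseteq> fst c"
    and f: "smooth_on (snd c ` U) (f \<circ> chart_inv c)"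
  shows "sfun U f"
  unfolding smooth_fun_def
proof
  fix d assume d: "d \<in> A"
  let ?S = "snd d ` (U \<inter> fst d)"
  have oS: "open ?S" using U d by (simp add: mopen_imp_open)
  have 1: "smooth_on ?S (snd c \<circ> chart_inv d)"
    by (rule smooth_on_subset[OF chart_transition[OF d c]]) (use U in auto)
  have 2: "(snd c \<circ> chart_inv d) ` ?S \<subseteq> snd c ` U"
    using d by (auto simp: chart_inv_left)
  have 3: "open (snd c ` U)" using mopen_imp_open[OF U(1) c] U(2) by (simp add: Int_absorb2)
  have "smooth_on ?S (\<lambda>x. (f \<circ> chart_inv c) ((snd c \<circ> chart_inv d) x))"
    by (rule smooth_on_compose[OF oS 3 2 1 f])
  then show "smooth_on ?S (f \<circ> chart_inv d)"
    by (rule smooth_on_cong[OF oS, rotated]) (use c d U in \<open>auto simp: chart_inv_left\<close>)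
qed

lemma smooth_fun_chartD:
  "sfun U f \<Longrightarrow> c \<in> A \<Longrightarrow> U \<subseteq> fst c \<Longrightarrow> smooth_on (snd c ` U) (f \<circ> chart_inv c)"
  unfolding smooth_fun_def by (metis Int_absorb2)

lemma smooth_fun_const: "mopen U \<Longrightarrow> sfun U (\<lambda>p. k)"
  by (simp add: smooth_fun_def o_def mopen_imp_open smooth_on_const)

lemma smooth_fun_add:
  "mopen U \<Longrightarrow> sfun U f \<Longrightarrow> sfun U h \<Longrightarrow> sfun U (\<lambda>p. f p + h p)"
  by (simp add: smooth_fun_def o_def mopen_imp_open smooth_on_add)

lemma smooth_fun_mult:
  "mopen U \<Longrightarrow> sfun U f \<Longrightarrow> sfun U h \<Longrightarrow> sfun U (\<lambda>p. f p * h p)"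
  by (simp add: smooth_fun_def o_def mopen_imp_open smooth_on_mult)

lemma smooth_fun_diff:
  assumes "mopen U" "sfun U f" "sfun U h"
  shows "sfun U (\<lambda>p. f p - h p)"
  using smooth_fun_add[OF assms(1,2) smooth_fun_mult[OF assms(1) smooth_fun_const[OF assms(1), of "-1"] assms(3)]]
  by simp

lemma smooth_fun_sum:
  "mopen U \<Longrightarrow> (\<And>i. i \<in> I \<Longrightarrow> sfun U (f i)) \<Longrightarrow> sfun U (\<lambda>p. \<Sum>i\<in>I. f i p)"
  by (simp add: smooth_fun_def o_def mopen_imp_open smooth_on_sum)

lemma smooth_fun_powr:
  assumes U: "mopen U" and f: "sfun U f" and pos: "\<And>p. p \<in> U \<Longrightarrow> 0 < f p"
  shows "sfun U (\<lambda>p. f p powr a)"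
  unfolding smooth_fun_def
proof
  fix c assume c: "c \<in> A"
  have "smooth_on (snd c ` (U \<inter> fst c)) (\<lambda>x. (f \<circ> chart_inv c) x powr a)"
  proof (rule smooth_on_compose[OF mopen_imp_open[OF U c] _ _ _ smooth_on_powr])
    show "smooth_on (snd c ` (U \<inter> fst c)) (f \<circ> chart_inv c)" using f c by (simp add: smooth_fun_def)
  qed (use c pos in \<open>auto simp: chart_inv_left\<close>)
  then show "smooth_on (snd c ` (U \<inter> fst c)) ((\<lambda>p. f p powr a) \<circ> chart_inv c)"
    by (simp add: o_def)
qed

lemmas smooth_fun_intros = smooth_fun_const smooth_fun_add smooth_fun_mult smooth_fun_diff smooth_fun_sum

lemma smooth_fun_coord:
  assumes c: "c \<in> A"
  shows "sfun (fst c) (crd c i)"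
proof (rule smooth_fun_chartI[OF c mopen_chart[OF c] order_refl])
  show "smooth_on (snd c ` fst c) (crd c i \<circ> chart_inv c)"
    by (rule smooth_on_cong[OF _ _ smooth_on_linear[OF _ bounded_linear_inner_left[of i]]])
      (use c in \<open>auto simp: chart_open chart_inv_left\<close>)
qed

lemma smooth_atI: "mopen U \<Longrightarrow> p \<in> U \<Longrightarrow> sfun U f \<Longrightarrow> smooth_at A p f"
  unfolding smooth_at_def by blast

lemma smooth_at_cong:
  assumes "mopen U" "p \<in> U" "\<And>q. q \<in> U \<Longrightarrow> f q = h q"
  shows "smooth_at A p f \<longleftrightarrow> smooth_at A p h"
proof -
  have *: "smooth_at A p h" if f: "smooth_at A p f" and fh: "\<And>q. q \<in> U \<Longrightarrow> f q = h q" for f h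
  proof -
    obtain V where V: "mopen V" "p \<in> V" "sfun V f" using f by (auto simp: smooth_at_def)
    have "sfun (U \<inter> V) h"
      by (rule smooth_fun_cong[of _ f]) (use V assms fh in \<open>auto intro: smooth_fun_subset\<close>)
    then show ?thesis using V assms by (intro smooth_atI[of "U \<inter> V"]) auto
  qed
  show ?thesis using *[of f h] *[of h f] assms(3) by auto
qed

lemma smooth_at_common:
  assumes "smooth_at A p f" "smooth_at A p h"
  obtains U where "mopen U" "p \<in> U" "sfun U f" "sfun U h"
proof -
  obtain U V where "mopen U" "p \<in> U" "sfun U f" "mopen V" "p \<in> V" "sfun V h"
    using assms by (auto simp: smooth_at_def)
  then show thesis using that[of "U \<inter> V"] by (auto intro: smooth_fun_subset)
qed

lemma smooth_at_coord: "c \<in> A \<Longrightarrow> p \<in> fst c \<Longrightarrow> smooth_at A p (crd c i)"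
  by (rule smooth_atI[OF mopen_chart _ smooth_fun_coord])

lemma smooth_at_has_derivative:
  assumes "c \<in> A" "p \<in> fst c" "smooth_at A p f"
  shows "((f \<circ> chart_inv c) has_derivative frechet_derivative (f \<circ> chart_inv c) (at (snd c p))) (at (snd c p))"
proof -
  obtain U where "mopen U" "p \<in> U" "sfun U f" using assms(3) by (auto simp: smooth_at_def)
  then show ?thesis using assms
    by (intro smooth_on_imp_has_derivative[of "snd c ` (U \<inter> fst c)"]) (auto simp: smooth_fun_def)
qed

lemma chart_vec_eqI:
  assumes "c \<in> A" "p \<in> fst c" "smooth_at A p f" "((f \<circ> chart_inv c) has_derivative f') (at (snd c p))"
  shows "chart_vec A c p x f = f' x"
  using frechet_derivative_at[OF assms(4)] assms(3) by (simp add: chart_vec_def)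

lemma chart_vec_lincomb:
  assumes "c \<in> A" "p \<in> fst c"
  shows "chart_vec A c p (a *\<^sub>R x + b *\<^sub>R y) f = a * chart_vec A c p x f + b * chart_vec A c p y f"
proof (cases "smooth_at A p f")
  case True
  interpret bounded_linear "frechet_derivative (f \<circ> chart_inv c) (at (snd c p))"
    using smooth_at_has_derivative[OF assms True] by (rule has_derivative_bounded_linear)
  show ?thesis using True by (simp add: chart_vec_def add scaleR)
qed (simp add: chart_vec_def)

lemma chart_vec_zero: "c \<in> A \<Longrightarrow> p \<in> fst c \<Longrightarrow> chart_vec A c p 0 = (\<lambda>f. 0)"
  using chart_vec_lincomb[of c p 0 0 0 0] by auto

lemma chart_vec_sum:
  assumes "c \<in> A" "p \<in> fst c" "finite I"
  shows "chart_vec A c p (\<Sum>i\<in>I. a i *\<^sub>R x i) f = (\<Sum>i\<in>I. a i * chart_vec A c p (x i) f)"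
  using assms(3)
proof (induction I)
  case (insert i I)
  then show ?case using chart_vec_lincomb[OF assms(1,2), of "a i" "x i" 1 "\<Sum>i\<in>I. a i *\<^sub>R x i" f] by simp
qed (simp add: chart_vec_zero assms)

lemma chart_vec_coord:
  assumes "c \<in> A" "p \<in> fst c"
  shows "chart_vec A c p x (crd c i) = x \<bullet> i"
proof (rule chart_vec_eqI[OF assms smooth_at_coord[OF assms]])
  have "((\<lambda>x. x \<bullet> i) has_derivative (\<lambda>x. x \<bullet> i)) (at (snd c p))"
    by (rule bounded_linear_imp_has_derivative[OF bounded_linear_inner_left])
  then show "((crd c i \<circ> chart_inv c) has_derivative (\<lambda>x. x \<bullet> i)) (at (snd c p))"
    by (rule has_derivative_transform_within_open[OF _ chart_open[OF assms(1)]])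
      (use assms in \<open>auto simp: chart_inv_left\<close>)
qed

text \<open>Chain rule: components transform by the Jacobian of the transition map, so every chart
  at p yields the whole tangent space.\<close>

lemma chart_vec_change:
  assumes c: "c \<in> A" "p \<in> fst c" and d: "d \<in> A" "p \<in> fst d"
  shows "chart_vec A c p x = chart_vec A d p (frechet_derivative (snd d \<circ> chart_inv c) (at (snd c p)) x)"
proof
  fix f
  show "chart_vec A c p x f = chart_vec A d p (frechet_derivative (snd d \<circ> chart_inv c) (at (snd c p)) x) f"
  proof (cases "smooth_at A p f")
    case True
    let ?t = "snd d \<circ> chart_inv c"
    have t: "(?t has_derivative frechet_derivative ?t (at (snd c p))) (at (snd c p))"
      by (rule smooth_on_imp_has_derivative[OF chart_transition[OF c(1) d(1)]]) (use c d in auto)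
    have eq: "?t (snd c p) = snd d p" using c by (simp add: chart_inv_left)
    have "((\<lambda>x. (f \<circ> chart_inv d) (?t x)) has_derivative
        (\<lambda>x. frechet_derivative (f \<circ> chart_inv d) (at (snd d p)) (frechet_derivative ?t (at (snd c p)) x))) (at (snd c p))"
      by (rule has_derivative_compose[OF t], unfold eq, rule smooth_at_has_derivative[OF d True])
    then have "((f \<circ> chart_inv c) has_derivative
        (\<lambda>x. frechet_derivative (f \<circ> chart_inv d) (at (snd d p)) (frechet_derivative ?t (at (snd c p)) x))) (at (snd c p))"
      by (rule has_derivative_transform_within_open[OF _ chart_overlap_open[OF c(1) d(1)]])
        (use c d in \<open>auto simp: chart_inv_left\<close>)
    from chart_vec_eqI[OF c True this] show ?thesis using True by (simp add: chart_vec_def)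
  qed (simp add: chart_vec_def)
qed

lemma chart_vec_in_tangent_space: "c \<in> A \<Longrightarrow> p \<in> fst c \<Longrightarrow> chart_vec A c p x \<in> TS p"
  unfolding tangent_space_def by blast

text \<open>The components of a derivation are its values on the coordinate functions; these are
  also the fibre coordinates in \<open>tangent_chart\<close>.\<close>

definition chart_coords :: "('a, 'e) chart \<Rightarrow> 'a tvec \<Rightarrow> 'e" where
  "chart_coords c v = (\<Sum>i\<in>Basis. v (crd c i) *\<^sub>R i)"

lemma chart_coords_inner: "i \<in> Basis \<Longrightarrow> chart_coords c v \<bullet> i = v (crd c i)"
  by (simp add: chart_coords_def inner_sum_left inner_Basis if_distrib sum.delta cong: if_cong)

lemma chart_coords_chart_vec: "c \<in> A \<Longrightarrow> p \<in> fst c \<Longrightarrow> chart_coords c (chart_vec A c p x) = x"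
  by (rule euclidean_eqI) (simp add: chart_coords_inner chart_vec_coord)

lemma chart_vec_chart_coords:
  assumes "c \<in> A" "p \<in> fst c" "v \<in> TS p"
  shows "chart_vec A c p (chart_coords c v) = v"
proof -
  obtain d x where d: "d \<in> A" "p \<in> fst d" "v = chart_vec A d p x"
    using assms(3) by (auto simp: tangent_space_def)
  then obtain y where "v = chart_vec A c p y" using chart_vec_change[OF d(1,2) assms(1,2)] by metis
  then show ?thesis using chart_coords_chart_vec assms by simp
qed

lemma tangent_expand:
  assumes "c \<in> A" "p \<in> fst c" "v \<in> TS p"
  shows "v f = (\<Sum>i\<in>Basis. v (crd c i) * chart_vec A c p i f)"
  using chart_vec_sum[OF assms(1,2), of Basis "\<lambda>i. v (crd c i)" "\<lambda>i. i" f] chart_vec_chart_coords[OF assms]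
  by (simp add: chart_coords_def)

lemma tangent_eqI:
  assumes "c \<in> A" "p \<in> fst c" "v \<in> TS p" "w \<in> TS p"
    and "\<And>i. i \<in> Basis \<Longrightarrow> v (crd c i) = w (crd c i)"
  shows "v = w"
proof
  fix f
  have "v f = (\<Sum>i\<in>Basis. v (crd c i) * chart_vec A c p i f)" by (rule tangent_expand[OF assms(1-3)])
  also have "\<dots> = (\<Sum>i\<in>Basis. w (crd c i) * chart_vec A c p i f)" using assms(5) by (intro sum.cong) auto
  also have "\<dots> = w f" by (rule tangent_expand[OF assms(1,2,4), symmetric])
  finally show "v f = w f" .
qed

lemma tangent_space_chart: "v \<in> TS p \<Longrightarrow> \<exists>c\<in>A. p \<in> fst c"
  by (auto simp: tangent_space_def)

lemma tangent_lincomb: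
  assumes "v \<in> TS p" "w \<in> TS p"
  shows "(\<lambda>f. a * v f + b * w f) \<in> TS p"
proof -
  obtain c where c: "c \<in> A" "p \<in> fst c" using tangent_space_chart assms(1) by blast
  have "(\<lambda>f. a * v f + b * w f) = chart_vec A c p (a *\<^sub>R chart_coords c v + b *\<^sub>R chart_coords c w)"
    using chart_vec_lincomb[OF c] chart_vec_chart_coords[OF c] assms by auto
  then show ?thesis using chart_vec_in_tangent_space[OF c] by simp
qed

lemma tangent_add: "v \<in> TS p \<Longrightarrow> w \<in> TS p \<Longrightarrow> (\<lambda>f. v f + w f) \<in> TS p"
  using tangent_lincomb[of v p w 1 1] by simp

lemma tangent_diff: "v \<in> TS p \<Longrightarrow> w \<in> TS p \<Longrightarrow> (\<lambda>f. v f - w f) \<in> TS p"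
  using tangent_lincomb[of v p w 1 "-1"] by simp

lemma tangent_scale: "v \<in> TS p \<Longrightarrow> (\<lambda>f. a * v f) \<in> TS p"
  using tangent_lincomb[of v p v a 0] by simp

lemma tangent_zero: "c \<in> A \<Longrightarrow> p \<in> fst c \<Longrightarrow> (\<lambda>f. 0) \<in> TS p"
  using chart_vec_zero chart_vec_in_tangent_space by metis

lemma tangent_sum:
  assumes "c \<in> A" "p \<in> fst c" "\<And>i. i \<in> I \<Longrightarrow> v i \<in> TS p"
  shows "(\<lambda>f. \<Sum>i\<in>I. a i * v i f) \<in> TS p"
  using assms(3)
proof (induction I rule: infinite_finite_induct)
  case (insert i I)
  then show ?case using tangent_lincomb[of "v i" p "\<lambda>f. \<Sum>i\<in>I. a i * v i f" "a i" 1] by simp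
qed (use tangent_zero assms in auto)

lemma tangent_nonsmooth: "v \<in> TS p \<Longrightarrow> \<not> smooth_at A p f \<Longrightarrow> v f = 0"
  by (auto simp: tangent_space_def chart_vec_def)

text \<open>Derivations see germs only. If f is not smooth at p then neither is h, and the default
  value 0 makes the two sides agree.\<close>

lemma tangent_cong:
  assumes v: "v \<in> TS p" and U: "mopen U" "p \<in> U" "\<And>q. q \<in> U \<Longrightarrow> f q = h q"
  shows "v f = v h"
proof (cases "smooth_at A p f")
  case True
  then have h: "smooth_at A p h" using smooth_at_cong[OF U] by simp
  obtain c x where c: "c \<in> A" "p \<in> fst c" "v = chart_vec A c p x"
    using v by (auto simp: tangent_space_def)
  have "((h \<circ> chart_inv c) has_derivative frechet_derivative (f \<circ> chart_inv c) (at (snd c p))) (at (snd c p))"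
    by (rule has_derivative_transform_within_open[OF smooth_at_has_derivative[OF c(1,2) True]
          mopen_imp_open[OF U(1) c(1)]]) (use c U in \<open>auto simp: chart_inv_left\<close>)
  from chart_vec_eqI[OF c(1,2) h this] show ?thesis using True c by (simp add: chart_vec_def)
next
  case False
  then show ?thesis using tangent_nonsmooth[OF v] smooth_at_cong[OF U] by simp
qed

lemma tangent_fun_add:
  assumes v: "v \<in> TS p" and f: "smooth_at A p f" and h: "smooth_at A p h"
  shows "v (\<lambda>q. f q + h q) = v f + v h"
proof -
  obtain c x where c: "c \<in> A" "p \<in> fst c" "v = chart_vec A c p x"
    using v by (auto simp: tangent_space_def)
  have "smooth_at A p (\<lambda>q. f q + h q)"
    using smooth_at_common[OF f h] by (metis smooth_atI smooth_fun_add)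
  from chart_vec_eqI[OF c(1,2) this] has_derivative_add[OF smooth_at_has_derivative[OF c(1,2) f] smooth_at_has_derivative[OF c(1,2) h]]
  show ?thesis using f h c(3) by (simp add: chart_vec_def o_def)
qed

lemma tangent_fun_mult:
  assumes v: "v \<in> TS p" and f: "smooth_at A p f" and h: "smooth_at A p h"
  shows "v (\<lambda>q. f q * h q) = f p * v h + v f * h p"
proof -
  obtain c x where c: "c \<in> A" "p \<in> fst c" "v = chart_vec A c p x"
    using v by (auto simp: tangent_space_def)
  have "smooth_at A p (\<lambda>q. f q * h q)"
    using smooth_at_common[OF f h] by (metis smooth_atI smooth_fun_mult)
  from chart_vec_eqI[OF c(1,2) this] has_derivative_mult[OF smooth_at_has_derivative[OF c(1,2) f] smooth_at_has_derivative[OF c(1,2) h]]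
  show ?thesis using f h c chart_inv_left by (simp add: chart_vec_def o_def)
qed

lemma tangent_fun_const:
  assumes v: "v \<in> TS p"
  shows "v (\<lambda>q. k) = 0"
proof -
  obtain c x where c: "c \<in> A" "p \<in> fst c" "v = chart_vec A c p x"
    using v by (auto simp: tangent_space_def)
  then show ?thesis by (simp add: chart_vec_def o_def)
qed

lemma tangent_fun_sum:
  assumes v: "v \<in> TS p" and "mopen U" "p \<in> U" and f: "\<And>i. i \<in> I \<Longrightarrow> sfun U (f i)"
  shows "v (\<lambda>q. \<Sum>i\<in>I. f i q) = (\<Sum>i\<in>I. v (f i))"
  using f
proof (induction I rule: infinite_finite_induct)
  case (insert i I)
  then have "v (\<lambda>q. f i q + (\<Sum>i\<in>I. f i q)) = v (f i) + v (\<lambda>q. \<Sum>i\<in>I. f i q)"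
    by (intro tangent_fun_add[OF v] smooth_atI[OF assms(2,3)] smooth_fun_sum assms(2)) auto
  then show ?case using insert by simp
qed (simp_all add: tangent_fun_const[OF v])

section \<open>Smooth local vector fields\<close>

lemma vf_tangent: "vf U X \<Longrightarrow> p \<in> U \<Longrightarrow> X p \<in> TS p"
  by (simp add: vector_field_on_def)

lemma vf_smooth: "vf U X \<Longrightarrow> mopen U \<Longrightarrow> sfun U f \<Longrightarrow> sfun U (\<lambda>p. X p f)"
  by (simp add: vector_field_on_def)

lemma vf_subset: "vf U X \<Longrightarrow> V \<subseteq> U \<Longrightarrow> vf V X"
  unfolding vector_field_on_def by (meson order_trans subsetD)

lemma vf_local:
  assumes "\<And>p. p \<in> U \<Longrightarrow> \<exists>W. mopen W \<and> p \<in> W \<and> vf W X"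
  shows "vf U X"
  unfolding vector_field_on_def
proof (intro conjI allI impI ballI)
  show "X p \<in> TS p" if "p \<in> U" for p using assms[OF that] vf_tangent by blast
  fix V f assume V: "mopen V \<and> V \<subseteq> U \<and> sfun V f"
  show "sfun V (\<lambda>p. X p f)"
  proof (rule smooth_fun_local)
    fix p assume "p \<in> V"
    then obtain W where W: "mopen W" "p \<in> W" "vf W X" using assms V by blast
    have "sfun (V \<inter> W) (\<lambda>p. X p f)"
      by (rule vf_smooth[OF vf_subset[OF W(3)] _ smooth_fun_subset[of V f]]) (use V W in auto)
    then show "\<exists>W. mopen W \<and> p \<in> W \<and> sfun W (\<lambda>p. X p f)"
      using V W \<open>p \<in> V\<close> by (intro exI[of _ "V \<inter> W"]) auto
  qed
qed

lemma vf_cong: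
  assumes "mopen U" "\<And>p. p \<in> U \<Longrightarrow> X p = Y p" "vf U X"
  shows "vf U Y"
  unfolding vector_field_on_def
proof (intro conjI allI impI ballI)
  show "Y p \<in> TS p" if "p \<in> U" for p using assms vf_tangent that by metis
  fix V f assume V: "mopen V \<and> V \<subseteq> U \<and> sfun V f"
  show "sfun V (\<lambda>p. Y p f)"
  proof (rule smooth_fun_cong)
    show "sfun V (\<lambda>p. X p f)"
      using V by (intro vf_smooth[OF vf_subset[OF assms(3)]]) auto
  qed (use V assms(2) in auto)
qed

lemma smooth_fun_partial:
  assumes c: "c \<in> A" and V: "mopen V" "V \<subseteq> fst c" and f: "sfun V f"
  shows "sfun V (\<lambda>p. chart_vec A c p x f)"
proof (rule smooth_fun_chartI[OF c V])
  have "open (snd c ` V)" using mopen_imp_open[OF V(1) c] V(2) by (simp add: Int_absorb2)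
  then show "smooth_on (snd c ` V) ((\<lambda>p. chart_vec A c p x f) \<circ> chart_inv c)"
    by (rule smooth_on_cong[OF _ _ smooth_on_frechet_derivative[OF smooth_fun_chartD[OF f c V(2)], of x]])
      (use c V smooth_atI[OF V(1) _ f] in \<open>auto simp: chart_inv_left chart_vec_def subset_iff\<close>)
qed

text \<open>The action on any smooth function is the sum of components times partial derivatives, so
  testing the coordinate functions suffices.\<close>

lemma vf_chartI:
  assumes c: "c \<in> A" and U: "mopen U" "U \<subseteq> fst c" and X: "\<And>p. p \<in> U \<Longrightarrow> X p \<in> TS p"
    and sm: "\<And>i. i \<in> Basis \<Longrightarrow> sfun U (\<lambda>p. X p (crd c i))"
  shows "vf U X"
  unfolding vector_field_on_def
proof (intro conjI allI impI ballI X)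
  fix V f assume V: "mopen V \<and> V \<subseteq> U \<and> sfun V f"
  have "sfun V (\<lambda>p. \<Sum>i\<in>Basis. X p (crd c i) * chart_vec A c p i f)"
    using V U by (intro smooth_fun_intros smooth_fun_partial c smooth_fun_subset[OF sm]) auto
  then show "sfun V (\<lambda>p. X p f)"
    by (rule smooth_fun_cong[rotated 2]) (use V U c X in \<open>auto intro!: tangent_expand[symmetric]\<close>)
qed

lemma vf_chart_vec: "c \<in> A \<Longrightarrow> vf (fst c) (\<lambda>p. chart_vec A c p x)"
  by (intro vf_chartI[of c] mopen_chart chart_vec_in_tangent_space smooth_fun_partial smooth_fun_coord) auto

lemma vf_coord_smooth:
  "vf U X \<Longrightarrow> mopen U \<Longrightarrow> c \<in> A \<Longrightarrow> U \<subseteq> fst c \<Longrightarrow> sfun U (\<lambda>p. X p (crd c i))"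
  by (rule vf_smooth[OF _ _ smooth_fun_subset[OF smooth_fun_coord]])

lemma vf_sum:
  assumes U: "mopen U" and "\<And>i. i \<in> I \<Longrightarrow> sfun U (a i)" "\<And>i. i \<in> I \<Longrightarrow> vf U (X i)"
  shows "vf U (\<lambda>p f. \<Sum>i\<in>I. a i p * X i p f)"
  unfolding vector_field_on_def
proof (intro conjI allI impI ballI)
  fix p assume p: "p \<in> U"
  obtain c where c: "c \<in> A" "p \<in> fst c" using mopen_imp_chart U p by blast
  then show "(\<lambda>f. \<Sum>i\<in>I. a i p * X i p f) \<in> TS p"
    using assms p by (intro tangent_sum) (auto intro: vf_tangent)
next
  fix V f assume V: "mopen V \<and> V \<subseteq> U \<and> sfun V f"
  then show "sfun V (\<lambda>p. \<Sum>i\<in>I. a i p * X i p f)"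
    using assms by (intro smooth_fun_intros) (auto intro: smooth_fun_subset vf_smooth vf_subset)
qed

lemma vf_add:
  assumes "mopen U" "vf U X" "vf U Y"
  shows "vf U (vf_add X Y)"
  \<comment> \<open>A sum of two terms, indexed by the two booleans.\<close>
  using vf_sum[of U "UNIV::bool set" "\<lambda>_ _. 1" "\<lambda>b. if b then X else Y"] assms
  by (simp add: UNIV_bool vf_add_def smooth_fun_const add.commute)

lemma vf_scale:
  assumes "mopen U" "sfun U h" "vf U X"
  shows "vf U (vf_scale h X)"
  using vf_sum[of U "{()}" "\<lambda>_. h" "\<lambda>_. X"] assms by (simp add: vf_scale_def)

lemma vf_diff:
  assumes "mopen U" "vf U X" "vf U Y"
  shows "vf U (vf_diff X Y)"
  using vf_sum[of U "UNIV::bool set" "\<lambda>b _. if b then 1 else -1" "\<lambda>b. if b then X else Y"] assms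
  by (simp add: UNIV_bool vf_diff_def smooth_fun_const)

text \<open>The second-order terms cancel by the symmetry of second derivatives.\<close>

lemma lie_bracket_tangent:
  assumes U: "mopen U" "p \<in> U" and X: "vf U X" and Y: "vf U Y"
  shows "lie_bracket A X Y p \<in> TS p"
proof -
  obtain c where c: "c \<in> A" "p \<in> fst c" using mopen_imp_chart U by blast
  have sym: "chart_vec A c p i (\<lambda>q. chart_vec A c q j f) = chart_vec A c p j (\<lambda>q. chart_vec A c q i f)"
    if f: "smooth_at A p f" for f i j
  proof -
    obtain V where V: "mopen V" "p \<in> V" "sfun V f" using f by (auto simp: smooth_at_def)
    let ?V = "V \<inter> fst c"
    have oV: "mopen ?V" "?V \<subseteq> fst c" "p \<in> ?V" using V c openin_Int[OF V(1) mopen_chart] by auto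
    have fV: "sfun ?V f" using V smooth_fun_subset by blast
    have sm: "smooth_on (snd c ` ?V) (f \<circ> chart_inv c)" by (rule smooth_fun_chartD[OF fV c(1) oV(2)])
    have o: "open (snd c ` ?V)" using mopen_imp_open[OF V(1) c(1)] by simp
    have "chart_vec A c p i (\<lambda>q. chart_vec A c q j f) =
        frechet_derivative (\<lambda>x. frechet_derivative (f \<circ> chart_inv c) (at x) j) (at (snd c p)) i" for i j
    proof (rule chart_vec_eqI[OF c])
      show "smooth_at A p (\<lambda>q. chart_vec A c q j f)"
        using smooth_fun_partial[OF c(1) oV(1,2) fV] oV smooth_atI by blast
      have "((\<lambda>x. frechet_derivative (f \<circ> chart_inv c) (at x) j) has_derivative
          frechet_derivative (\<lambda>x. frechet_derivative (f \<circ> chart_inv c) (at x) j) (at (snd c p))) (at (snd c p))"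
        by (rule smooth_on_imp_has_derivative[OF smooth_on_frechet_derivative[OF sm]]) (use oV in auto)
      then show "((\<lambda>q. chart_vec A c q j f) \<circ> chart_inv c has_derivative
          frechet_derivative (\<lambda>x. frechet_derivative (f \<circ> chart_inv c) (at x) j) (at (snd c p))) (at (snd c p))"
        by (rule has_derivative_transform_within_open[OF _ o])
          (use c oV smooth_atI[OF oV(1) _ fV] in \<open>auto simp: chart_inv_left chart_vec_def\<close>)
    qed
    then show ?thesis using smooth_on_symmetric_second_derivative[OF o _ sm] oV by auto
  qed
  let ?W = "U \<inter> fst c"
  have W: "mopen ?W" "p \<in> ?W" "?W \<subseteq> fst c" using U c openin_Int[OF U(1) mopen_chart] by auto
  \<comment> \<open>X(Y f) is a first-order part plus the Hessian of f in the chart, contracted with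
    the components of X and Y. By \<open>sym\<close> the Hessian part is unchanged when X and Y are
    exchanged.\<close>
  have second: "X p (\<lambda>q. Y q f) = (\<Sum>j\<in>Basis. X p (\<lambda>q. Y q (crd c j)) * chart_vec A c p j f)
      + (\<Sum>j\<in>Basis. \<Sum>i\<in>Basis. Y p (crd c j) * X p (crd c i) * chart_vec A c p i (\<lambda>q. chart_vec A c q j f))"
    if f: "smooth_at A p f" and X: "vf U X" and Y: "vf U Y" for f X Y
  proof -
    obtain V where V: "mopen V" "p \<in> V" "sfun V f" using f by (auto simp: smooth_at_def)
    let ?V = "V \<inter> ?W"
    have oV: "mopen ?V" "?V \<subseteq> fst c" "p \<in> ?V" using V W by auto
    have fV: "sfun ?V f" using V smooth_fun_subset by blast
    have Xp: "X p \<in> TS p" using vf_tangent X U by blast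
    have sy: "sfun ?V (\<lambda>q. Y q (crd c j))" for j
      by (intro vf_coord_smooth[OF vf_subset[OF Y]] oV c) auto
    have sp: "sfun ?V (\<lambda>q. chart_vec A c q j f)" for j
      by (intro smooth_fun_partial c oV fV)
    have "X p (\<lambda>q. Y q f) = X p (\<lambda>q. \<Sum>j\<in>Basis. Y q (crd c j) * chart_vec A c q j f)"
      by (rule tangent_cong[OF Xp oV(1,3)]) (use c Y in \<open>auto intro!: tangent_expand simp: vf_tangent\<close>)
    also have "\<dots> = (\<Sum>j\<in>Basis. X p (\<lambda>q. Y q (crd c j) * chart_vec A c q j f))"
      by (intro tangent_fun_sum[OF Xp oV(1,3)] smooth_fun_mult oV sy sp)
    also have "\<dots> = (\<Sum>j\<in>Basis. Y p (crd c j) * X p (\<lambda>q. chart_vec A c q j f)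
        + X p (\<lambda>q. Y q (crd c j)) * chart_vec A c p j f)"
      by (intro sum.cong refl tangent_fun_mult[OF Xp] smooth_atI[OF oV(1,3)] sy sp)
    also have "\<dots> = (\<Sum>j\<in>Basis. X p (\<lambda>q. Y q (crd c j)) * chart_vec A c p j f)
      + (\<Sum>j\<in>Basis. Y p (crd c j) * X p (\<lambda>q. chart_vec A c q j f))"
      by (simp add: sum.distrib)
    also have "(\<Sum>j\<in>Basis. Y p (crd c j) * X p (\<lambda>q. chart_vec A c q j f)) =
        (\<Sum>j\<in>Basis. Y p (crd c j) * (\<Sum>i\<in>Basis. X p (crd c i) * chart_vec A c p i (\<lambda>q. chart_vec A c q j f)))"
      by (intro sum.cong refl arg_cong2[where f = "(*)"] tangent_expand[OF c Xp])
    finally show ?thesis by (simp add: sum_distrib_left mult.assoc)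
  qed
  have "lie_bracket A X Y p f = chart_vec A c p (\<Sum>j\<in>Basis. (X p (\<lambda>q. Y q (crd c j)) - Y p (\<lambda>q. X q (crd c j))) *\<^sub>R j) f" for f
  proof (cases "smooth_at A p f")
    case True
    have "(\<Sum>j\<in>Basis. \<Sum>i\<in>Basis. Y p (crd c j) * X p (crd c i) * chart_vec A c p i (\<lambda>q. chart_vec A c q j f)) =
        (\<Sum>j\<in>Basis. \<Sum>i\<in>Basis. X p (crd c j) * Y p (crd c i) * chart_vec A c p i (\<lambda>q. chart_vec A c q j f))"
      by (subst sum.swap) (simp add: sym[OF True] mult.commute)
    then show ?thesis
      using second[OF True X Y] second[OF True Y X] chart_vec_sum[OF c, of Basis _ "\<lambda>j. j" f] True
      by (simp add: lie_bracket_def sum_subtractf left_diff_distrib)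
  qed (simp add: lie_bracket_def chart_vec_def)
  then show ?thesis using chart_vec_in_tangent_space[OF c] by presburger
qed

lemma vf_lie_bracket:
  assumes U: "mopen U" and X: "vf U X" and Y: "vf U Y"
  shows "vf U (lie_bracket A X Y)"
  unfolding vector_field_on_def
proof (intro conjI allI impI ballI)
  show "lie_bracket A X Y p \<in> TS p" if "p \<in> U" for p
    using lie_bracket_tangent U X Y that by blast
  fix V f assume V: "mopen V \<and> V \<subseteq> U \<and> sfun V f"
  have "sfun V (\<lambda>p. X p (\<lambda>q. Y q f) - Y p (\<lambda>q. X q f))"
    using V by (intro smooth_fun_diff vf_smooth[OF vf_subset[OF X]] vf_smooth[OF vf_subset[OF Y]]) auto
  then show "sfun V (\<lambda>p. lie_bracket A X Y p f)"
    by (rule smooth_fun_cong[rotated 2]) (use V smooth_atI in \<open>auto simp: lie_bracket_def\<close>)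
qed

end

lemma smooth_manifold_charted: "smooth_manifold A \<Longrightarrow> charted A"
  unfolding smooth_manifold_def charted_def by blast

section \<open>Connections\<close>

context charted
begin

text \<open>Fields with unrelated domains can be combined at p after shrinking, which lets
  statements at a point avoid naming a domain.\<close>

definition vf_near :: "'a \<Rightarrow> 'a vfield \<Rightarrow> bool" where
  "vf_near p X \<longleftrightarrow> (\<exists>U. mopen U \<and> p \<in> U \<and> vf U X)"

lemma vf_nearI: "mopen U \<Longrightarrow> p \<in> U \<Longrightarrow> vf U X \<Longrightarrow> vf_near p X"
  unfolding vf_near_def by blast

lemma vf_near_common:
  assumes "vf_near p X" "vf_near p Y"
  obtains U where "mopen U" "p \<in> U" "vf U X" "vf U Y"
proof -
  obtain U V where "mopen U" "p \<in> U" "vf U X" "mopen V" "p \<in> V" "vf V Y"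
    using assms unfolding vf_near_def by blast
  then show thesis using that[of "U \<inter> V"] by (auto intro: vf_subset)
qed

lemma vf_near_tangent: "vf_near p X \<Longrightarrow> X p \<in> TS p"
  unfolding vf_near_def using vf_tangent by blast

text \<open>Connections act on local fields, so an extension near the point is enough, and constant
  components in a chart provide one.\<close>

lemma vf_extend:
  assumes "v \<in> TS p"
  obtains X where "vf_near p X" "X p = v"
proof -
  obtain c x where c: "c \<in> A" "p \<in> fst c" "v = chart_vec A c p x"
    using assms by (auto simp: tangent_space_def)
  then show thesis
    using that[of "\<lambda>q. chart_vec A c q x"] vf_nearI[OF mopen_chart _ vf_chart_vec] by blast
qed

lemma lie_bracket_antisym: "lie_bracket A Y X p = (\<lambda>f. - lie_bracket A X Y p f)"
  by (auto simp: lie_bracket_def)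

lemma lie_bracket_cong:
  assumes U: "mopen U" "p \<in> U" and vf: "vf U X" "vf U Y"
    and eq: "\<And>q. q \<in> U \<Longrightarrow> X q = X' q" "\<And>q. q \<in> U \<Longrightarrow> Y q = Y' q"
  shows "lie_bracket A X Y p = lie_bracket A X' Y' p"
proof
  fix f
  have "X p (\<lambda>q. Y q f) = X' p (\<lambda>q. Y' q f)" "Y p (\<lambda>q. X q f) = Y' p (\<lambda>q. X' q f)"
    using tangent_cong[OF _ U] vf_tangent[OF vf(1) U(2)] vf_tangent[OF vf(2) U(2)] eq U(2) by metis+
  then show "lie_bracket A X Y p f = lie_bracket A X' Y' p f" by (simp add: lie_bracket_def)
qed

lemma lie_bracket_add_right:
  assumes U: "mopen U" "p \<in> U"
    and vf: "vf U X" "vf U Y" "vf U Y'"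
  shows "lie_bracket A X (vf_add Y Y') p = (\<lambda>f. lie_bracket A X Y p f + lie_bracket A X Y' p f)"
proof
  fix f
  show "lie_bracket A X (vf_add Y Y') p f = lie_bracket A X Y p f + lie_bracket A X Y' p f"
  proof (cases "smooth_at A p f")
    case True
    then obtain V where V: "mopen V" "p \<in> V" "sfun V f" by (auto simp: smooth_at_def)
    have "smooth_at A p (\<lambda>q. Z q f)" if "vf U Z" for Z
      using V U that by (intro smooth_atI[of "U \<inter> V"] vf_smooth[OF vf_subset[OF that]])
        (auto intro: smooth_fun_subset)
    then show ?thesis using tangent_fun_add[OF vf_tangent[OF vf(1) U(2)]] True vf
      by (simp add: lie_bracket_def vf_add_def)
  qed (simp add: lie_bracket_def)
qed

lemma lie_bracket_scale_right:
  assumes U: "mopen U" "p \<in> U" and h: "sfun U h"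
    and vf: "vf U X" "vf U Y"
  shows "lie_bracket A X (vf_scale h Y) p = (\<lambda>f. X p h * Y p f + h p * lie_bracket A X Y p f)"
proof
  fix f
  show "lie_bracket A X (vf_scale h Y) p f = X p h * Y p f + h p * lie_bracket A X Y p f"
  proof (cases "smooth_at A p f")
    case True
    then obtain V where V: "mopen V" "p \<in> V" "sfun V f" by (auto simp: smooth_at_def)
    have "smooth_at A p (\<lambda>q. Y q f)"
      using V U by (intro smooth_atI[of "U \<inter> V"] vf_smooth[OF vf_subset[OF vf(2)]])
        (auto intro: smooth_fun_subset)
    moreover have "smooth_at A p h" using h U smooth_atI by blast
    ultimately show ?thesis using tangent_fun_mult[OF vf_tangent[OF vf(1) U(2)]] True
      by (simp add: lie_bracket_def vf_scale_def algebra_simps)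
  next
    case False
    \<comment> \<open>Both sides are 0 by the default values of tangent vectors and of the
      bracket.\<close>
    then show ?thesis using tangent_nonsmooth[OF vf_tangent[OF vf(2) U(2)]]
      by (simp add: lie_bracket_def)
  qed
qed

text \<open>Linearity over smooth functions, at p. Locality is a separate clause: L takes total
  functions as arguments, and linearity alone does not relate its values on two fields that agree
  only near p.\<close>

definition tensorial_at :: "'a \<Rightarrow> ('a vfield \<Rightarrow> real) \<Rightarrow> bool" where
  "tensorial_at p L \<longleftrightarrow> (\<forall>U X Y h. mopen U \<longrightarrow> p \<in> U \<longrightarrow> vf U X \<longrightarrow> vf U Y \<longrightarrow>
     sfun U h \<longrightarrow> L (vf_add X Y) = L X + L Y \<and> L (vf_scale h X) = h p * L X \<and>
     ((\<forall>q\<in>U. X q = Y q) \<longrightarrow> L X = L Y))"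

lemma tensorial_atI:
  assumes "\<And>U X Y. mopen U \<Longrightarrow> p \<in> U \<Longrightarrow> vf U X \<Longrightarrow> vf U Y \<Longrightarrow>
      L (vf_add X Y) = L X + L Y"
    and "\<And>U h X. mopen U \<Longrightarrow> p \<in> U \<Longrightarrow> vf U X \<Longrightarrow> sfun U h \<Longrightarrow>
      L (vf_scale h X) = h p * L X"
    and "\<And>U X Y. mopen U \<Longrightarrow> p \<in> U \<Longrightarrow> vf U X \<Longrightarrow> vf U Y \<Longrightarrow>
      (\<And>q. q \<in> U \<Longrightarrow> X q = Y q) \<Longrightarrow> L X = L Y"
  shows "tensorial_at p L"
  unfolding tensorial_at_def using assms by (metis (no_types, lifting))

lemma tensorial_cong:
  "tensorial_at p L \<Longrightarrow> mopen U \<Longrightarrow> p \<in> U \<Longrightarrow> vf U X \<Longrightarrow> vf U Y \<Longrightarrow>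
     (\<And>q. q \<in> U \<Longrightarrow> X q = Y q) \<Longrightarrow> L X = L Y"
  unfolding tensorial_at_def using smooth_fun_const by blast

lemma tensorial_sum:
  assumes L: "tensorial_at p L" and U: "mopen U" "p \<in> U" and I: "finite I"
    and a: "\<And>i. i \<in> I \<Longrightarrow> sfun U (a i)" and X: "\<And>i. i \<in> I \<Longrightarrow> vf U (X i)"
  shows "L (\<lambda>q f. \<Sum>i\<in>I. a i q * X i q f) = (\<Sum>i\<in>I. a i p * L (X i))"
  using I a X
proof (induction I)
  case empty
  have "vf U (\<lambda>q f. 0)" using vf_sum[OF U(1), of "{}"] by simp
  \<comment> \<open>The empty sum is the zero field, which equals 0 times itself.\<close>
  then have "L (vf_scale (\<lambda>_. 0) (\<lambda>q f. 0)) = 0 * L (\<lambda>q f. 0)"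
    using L U smooth_fun_const[OF U(1), of 0] unfolding tensorial_at_def by blast
  then show ?case by (simp add: vf_scale_def)
next
  case (insert i I)
  let ?Y = "\<lambda>q f. \<Sum>i\<in>I. a i q * X i q f"
  have v: "vf U (vf_scale (a i) (X i))" "vf U ?Y"
    using insert U by (auto intro!: vf_scale vf_sum)
  have "(\<lambda>q f. \<Sum>i\<in>insert i I. a i q * X i q f) = vf_add (vf_scale (a i) (X i)) ?Y"
    using insert.hyps by (simp add: vf_add_def vf_scale_def)
  moreover have "L (vf_add (vf_scale (a i) (X i)) ?Y) = L (vf_scale (a i) (X i)) + L ?Y"
    using L U v smooth_fun_const[OF U(1), of 0] unfolding tensorial_at_def by blast
  moreover have "L (vf_scale (a i) (X i)) = a i p * L (X i)"
    using L U insert unfolding tensorial_at_def by blast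
  ultimately show ?case using insert by simp
qed

text \<open>Locality replaces X by its expansion in coordinate fields near p, and linearity then
  pulls out the values of the coefficients at p.\<close>

lemma tensorial_chart:
  assumes L: "tensorial_at p L" and c: "c \<in> A" "p \<in> fst c" and X: "vf_near p X"
  shows "L X = (\<Sum>i\<in>Basis. X p (crd c i) * L (\<lambda>q. chart_vec A c q i))"
proof -
  obtain U where U: "mopen U" "p \<in> U" "vf U X" using X unfolding vf_near_def by blast
  let ?U = "U \<inter> fst c"
  have oU: "mopen ?U" "p \<in> ?U" using U c openin_Int[OF U(1) mopen_chart] by auto
  have vX: "vf ?U X" using U vf_subset by blast
  have a: "sfun ?U (\<lambda>q. X q (crd c i))" for i
    using vf_coord_smooth[OF vX oU(1) c(1)] by simp
  have b: "vf ?U (\<lambda>q. chart_vec A c q i)" for i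
    using vf_subset[OF vf_chart_vec[OF c(1)]] by simp
  have "L X = L (\<lambda>q f. \<Sum>i\<in>Basis. X q (crd c i) * chart_vec A c q i f)"
  proof (rule tensorial_cong[OF L oU vX])
    show "vf ?U (\<lambda>q f. \<Sum>i\<in>Basis. X q (crd c i) * chart_vec A c q i f)"
      by (intro vf_sum oU a b)
    show "X q = (\<lambda>f. \<Sum>i\<in>Basis. X q (crd c i) * chart_vec A c q i f)" if "q \<in> ?U" for q
      using tangent_expand[OF c(1)] vf_tangent[OF vX that] that by auto
  qed
  also have "\<dots> = (\<Sum>i\<in>Basis. X p (crd c i) * L (\<lambda>q. chart_vec A c q i))"
    by (intro tensorial_sum[OF L oU] a b) auto
  finally show ?thesis .
qed

lemma tensorial_pointwise:
  assumes L: "tensorial_at p L" and "vf_near p X" "vf_near p Y" "X p = Y p"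
  shows "L X = L Y"
proof -
  obtain c where "c \<in> A" "p \<in> fst c" using tangent_space_chart[OF vf_near_tangent[OF assms(2)]] by blast
  then show ?thesis using tensorial_chart[OF L] assms by simp
qed

section \<open>Rules for a connection on a fixed open set\<close>

context
  fixes nab U
  assumes nab: "connection A nab" and U: "mopen U"
begin

private lemmas axioms = nab[unfolded connection_def, THEN spec, THEN mp, OF U]

lemma connection_vf: "vf U X \<Longrightarrow> vf U Y \<Longrightarrow> vf U (nab X Y)"
  using axioms[THEN conjunct1] by blast

lemma connection_add_left:
  assumes "p \<in> U" "vf U X" "vf U X'" "vf U Y"
  shows "nab (vf_add X X') Y p f = nab X Y p f + nab X' Y p f"
  using axioms[THEN conjunct2, THEN conjunct1, rule_format, OF assms(2-4,1)] by (simp add: vf_add_def)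

lemma connection_scale_left:
  assumes "p \<in> U" "sfun U h" "vf U X" "vf U Y"
  shows "nab (vf_scale h X) Y p f = h p * nab X Y p f"
  using axioms[THEN conjunct2, THEN conjunct2, THEN conjunct1, rule_format, OF assms(2-4,1)]
  by (simp add: vf_scale_def)

lemma connection_add_right:
  assumes "p \<in> U" "vf U X" "vf U Y" "vf U Y'"
  shows "nab X (vf_add Y Y') p f = nab X Y p f + nab X Y' p f"
  using axioms[THEN conjunct2, THEN conjunct2, THEN conjunct2, THEN conjunct1, rule_format, OF assms(2-4,1)]
  by (simp add: vf_add_def)

lemma connection_leibniz:
  assumes "p \<in> U" "sfun U h" "vf U X" "vf U Y"
  shows "nab X (vf_scale h Y) p f = X p h * Y p f + h p * nab X Y p f"
  using axioms[THEN conjunct2, THEN conjunct2, THEN conjunct2, THEN conjunct2, THEN conjunct1,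
      rule_format, OF assms(2-4,1)]
  by (simp add: vf_add_def vf_scale_def)

lemma connection_cong:
  assumes "p \<in> U" "vf U X" "vf U Y" "vf U X'"
    "vf U Y'" "\<And>q. q \<in> U \<Longrightarrow> X q = X' q" "\<And>q. q \<in> U \<Longrightarrow> Y q = Y' q"
  shows "nab X Y p = nab X' Y' p"
proof -
  have "\<forall>q\<in>U. X q = X' q \<and> Y q = Y' q" using assms by blast
  then show ?thesis
    using axioms[THEN conjunct2, THEN conjunct2, THEN conjunct2, THEN conjunct2, THEN conjunct2,
        THEN spec, THEN spec, THEN spec, THEN spec, THEN mp, THEN mp, THEN mp, THEN mp, THEN mp,
        OF assms(2,4,3,5)] assms(1) by blast
qed

end

lemma connection_near:
  assumes "connection A nab" "vf_near p X" "vf_near p Y"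
  shows "vf_near p (nab X Y)"
  using vf_near_common[OF assms(2,3)] connection_vf[OF assms(1)] vf_nearI by metis

lemma connection_tensorial_left:
  assumes nab: "connection A nab" and Y: "vf_near p Y"
  shows "tensorial_at p (\<lambda>X. nab X Y p f)"
proof -
  obtain V where V: "mopen V" "p \<in> V" "vf V Y" using Y unfolding vf_near_def by blast
  have *: "mopen (U \<inter> V)" "p \<in> U \<inter> V" "vf (U \<inter> V) Y" if "mopen U" "p \<in> U" for U
    using that V by (auto intro: vf_subset)
  show ?thesis
  proof (rule tensorial_atI)
    fix U X X' assume U: "mopen U" "p \<in> U" and X: "vf U X" "vf U X'"
    note X' = X[THEN vf_subset[of U _ "U \<inter> V"]]
    show "nab (vf_add X X') Y p f = nab X Y p f + nab X' Y p f"
      using connection_add_left[OF nab *(1,2)[OF U] X' *(3)[OF U]] by simp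
    show "nab X Y p f = nab X' Y p f" if "\<And>q. q \<in> U \<Longrightarrow> X q = X' q"
      using connection_cong[OF nab *(1,2)[OF U] X'(1) *(3)[OF U] X'(2) *(3)[OF U]] that by simp
  next
    fix U h X assume U: "mopen U" "p \<in> U" and X: "vf U X" "sfun U h"
    show "nab (vf_scale h X) Y p f = h p * nab X Y p f"
      by (rule connection_scale_left[OF nab *(1,2)[OF U]])
        (use X *(3)[OF U] in \<open>auto intro: vf_subset smooth_fun_subset\<close>)
  qed
qed

text \<open>Each connection alone is a derivation in Y; the terms X(h) Y are the same for both and
  cancel.\<close>

lemma connection_tensorial_diff_right:
  assumes nab: "connection A nab" "connection A nab'" and X: "vf_near p X"
  shows "tensorial_at p (\<lambda>Y. nab X Y p f - nab' X Y p f)"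
proof -
  obtain V where V: "mopen V" "p \<in> V" "vf V X" using X unfolding vf_near_def by blast
  have *: "mopen (U \<inter> V)" "p \<in> U \<inter> V" "vf (U \<inter> V) X" if "mopen U" "p \<in> U" for U
    using that V by (auto intro: vf_subset)
  show ?thesis
  proof (rule tensorial_atI)
    fix U Y Y' assume U: "mopen U" "p \<in> U" and Y: "vf U Y" "vf U Y'"
    have Y': "vf (U \<inter> V) Y" "vf (U \<inter> V) Y'"
      using Y by (auto intro: vf_subset)
    show "nab X (vf_add Y Y') p f - nab' X (vf_add Y Y') p f
        = nab X Y p f - nab' X Y p f + (nab X Y' p f - nab' X Y' p f)"
      using connection_add_right[OF nab(1) *[OF U] Y'] connection_add_right[OF nab(2) *[OF U] Y'] by simp
    show "nab X Y p f - nab' X Y p f = nab X Y' p f - nab' X Y' p f" if "\<And>q. q \<in> U \<Longrightarrow> Y q = Y' q"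
      using connection_cong[OF nab(1) *[OF U] Y'(1) *(3)[OF U] Y'(2)]
        connection_cong[OF nab(2) *[OF U] Y'(1) *(3)[OF U] Y'(2)] that by simp
  next
    fix U h Y assume U: "mopen U" "p \<in> U" and Y: "vf U Y" "sfun U h"
    have Y': "vf (U \<inter> V) Y" "sfun (U \<inter> V) h"
      using Y by (auto intro: vf_subset smooth_fun_subset)
    show "nab X (vf_scale h Y) p f - nab' X (vf_scale h Y) p f = h p * (nab X Y p f - nab' X Y p f)"
      using connection_leibniz[OF nab(1) *(1,2)[OF U] Y'(2) *(3)[OF U] Y'(1)]
        connection_leibniz[OF nab(2) *(1,2)[OF U] Y'(2) *(3)[OF U] Y'(1)] by (simp add: algebra_simps)
  qed
qed

end

section \<open>Riemannian metrics\<close>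

locale riemannian = charted A for A :: "('a, 'e::euclidean_space) atlas" +
  fixes g :: "'a \<Rightarrow> 'a tvec \<Rightarrow> 'a tvec \<Rightarrow> real"
  assumes metric: "riemannian_metric A g"
begin

lemma tangent_points: "v \<in> TS p \<Longrightarrow> p \<in> points A"
  by (auto simp: tangent_space_def points_def)

lemma metric_sym: "u \<in> TS p \<Longrightarrow> v \<in> TS p \<Longrightarrow> g p u v = g p v u"
  using metric tangent_points unfolding riemannian_metric_def by blast

lemma metric_lincomb_left:
  "u \<in> TS p \<Longrightarrow> v \<in> TS p \<Longrightarrow> w \<in> TS p \<Longrightarrow>
    g p (\<lambda>f. a * u f + b * v f) w = a * g p u w + b * g p v w"
  using metric tangent_points unfolding riemannian_metric_def by blast

lemma metric_pos: "u \<in> TS p \<Longrightarrow> u \<noteq> (\<lambda>f. 0) \<Longrightarrow> g p u u > 0"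
  using metric tangent_points unfolding riemannian_metric_def by blast

lemma metric_smooth:
  "mopen U \<Longrightarrow> vf U X \<Longrightarrow> vf U Y \<Longrightarrow> sfun U (\<lambda>p. g p (X p) (Y p))"
  using metric unfolding riemannian_metric_def by blast

lemma metric_add_left:
  "u \<in> TS p \<Longrightarrow> v \<in> TS p \<Longrightarrow> w \<in> TS p \<Longrightarrow>
    g p (\<lambda>f. u f + v f) w = g p u w + g p v w"
  using metric_lincomb_left[of u p v w 1 1] by simp

lemma metric_diff_left:
  "u \<in> TS p \<Longrightarrow> v \<in> TS p \<Longrightarrow> w \<in> TS p \<Longrightarrow>
    g p (\<lambda>f. u f - v f) w = g p u w - g p v w"
  using metric_lincomb_left[of u p v w 1 "-1"] by simp

lemma metric_scale_left:
  "u \<in> TS p \<Longrightarrow> w \<in> TS p \<Longrightarrow> g p (\<lambda>f. a * u f) w = a * g p u w"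
  using metric_lincomb_left[of u p u w a 0] by simp

lemma metric_minus_left:
  "u \<in> TS p \<Longrightarrow> w \<in> TS p \<Longrightarrow> g p (\<lambda>f. - u f) w = - g p u w"
  using metric_scale_left[of u p w "-1"] by simp

lemma metric_zero_left: "w \<in> TS p \<Longrightarrow> g p (\<lambda>f. 0) w = 0"
  using metric_scale_left[of w p w 0] by simp

lemma metric_lincomb_right:
  assumes "u \<in> TS p" "v \<in> TS p" "w \<in> TS p"
  shows "g p w (\<lambda>f. a * u f + b * v f) = a * g p w u + b * g p w v"
  unfolding metric_sym[OF assms(3) tangent_lincomb[OF assms(1,2)]] metric_lincomb_left[OF assms]
  using metric_sym[OF assms(1,3)] metric_sym[OF assms(2,3)] by simp

lemma metric_add_right:
  "u \<in> TS p \<Longrightarrow> v \<in> TS p \<Longrightarrow> w \<in> TS p \<Longrightarrow>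
    g p w (\<lambda>f. u f + v f) = g p w u + g p w v"
  using metric_lincomb_right[of u p v w 1 1] by simp

lemma metric_scale_right:
  "u \<in> TS p \<Longrightarrow> w \<in> TS p \<Longrightarrow> g p w (\<lambda>f. a * u f) = a * g p w u"
  using metric_lincomb_right[of u p u w a 0] by simp

lemma metric_diff_right:
  "u \<in> TS p \<Longrightarrow> v \<in> TS p \<Longrightarrow> w \<in> TS p \<Longrightarrow>
    g p w (\<lambda>f. u f - v f) = g p w u - g p w v"
  using metric_lincomb_right[of u p v w 1 "-1"] by simp

lemma metric_sum_left:
  assumes w: "w \<in> TS p" and "\<And>i. i \<in> I \<Longrightarrow> u i \<in> TS p"
  shows "g p (\<lambda>f. \<Sum>i\<in>I. a i * u i f) w = (\<Sum>i\<in>I. a i * g p (u i) w)"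
  using assms(2)
proof (induction I rule: infinite_finite_induct)
  case (insert i I)
  obtain c where "c \<in> A" "p \<in> fst c" using tangent_space_chart[OF w] by blast
  then have "(\<lambda>f. \<Sum>i\<in>I. a i * u i f) \<in> TS p" using insert by (intro tangent_sum) auto
  then show ?case
    using insert metric_lincomb_left[of "u i" p "\<lambda>f. \<Sum>i\<in>I. a i * u i f" w "a i" 1] w by simp
qed (use metric_zero_left[OF w] in auto)

lemma metric_sum_right:
  assumes w: "w \<in> TS p" and u: "\<And>i. i \<in> I \<Longrightarrow> u i \<in> TS p"
  shows "g p w (\<lambda>f. \<Sum>i\<in>I. a i * u i f) = (\<Sum>i\<in>I. a i * g p w (u i))"
proof -
  obtain c where "c \<in> A" "p \<in> fst c" using tangent_space_chart[OF w] by blast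
  then have "(\<lambda>f. \<Sum>i\<in>I. a i * u i f) \<in> TS p" using u by (intro tangent_sum) auto
  then show ?thesis using metric_sum_left[OF w u] metric_sym[OF w] u by simp
qed

text \<open>Positive definiteness, applied to v - w.\<close>

lemma metric_eqI:
  assumes v: "v \<in> TS p" "w \<in> TS p"
    and "\<And>u. u \<in> TS p \<Longrightarrow> g p v u = g p w u"
  shows "v = w"
proof (rule ccontr)
  let ?d = "\<lambda>f. v f - w f"
  assume "v \<noteq> w"
  then have "?d \<noteq> (\<lambda>f. 0)" by (auto simp: fun_eq_iff)
  moreover have d: "?d \<in> TS p" using tangent_diff v by blast
  ultimately have "g p ?d ?d > 0" using metric_pos by blast
  then show False using metric_diff_left[OF v d] assms(3)[OF d] by simp
qed

section \<open>Orthonormal frames and traces\<close>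

abbreviation onf :: "'a set \<Rightarrow> ('e \<Rightarrow> 'a vfield) \<Rightarrow> bool" where "onf \<equiv> orthonormal_frame_on A g"

lemma onf_vf: "onf U E \<Longrightarrow> i \<in> Basis \<Longrightarrow> vf U (E i)"
  by (simp add: orthonormal_frame_on_def)

lemma onf_tangent: "onf U E \<Longrightarrow> i \<in> Basis \<Longrightarrow> p \<in> U \<Longrightarrow> E i p \<in> TS p"
  using onf_vf vf_tangent by blast

lemma onf_inner:
  "onf U E \<Longrightarrow> i \<in> Basis \<Longrightarrow> j \<in> Basis \<Longrightarrow> p \<in> U \<Longrightarrow> g p (E i p) (E j p) = (if i = j then 1 else 0)"
  by (simp add: orthonormal_frame_on_def)

lemma onf_near: "onf U E \<Longrightarrow> i \<in> Basis \<Longrightarrow> mopen U \<Longrightarrow> p \<in> U \<Longrightarrow> vf_near p (E i)"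
  using onf_vf vf_nearI by blast

lemma onf_subset: "onf U E \<Longrightarrow> V \<subseteq> U \<Longrightarrow> onf V E"
  unfolding orthonormal_frame_on_def by (meson subsetD vf_subset)

text \<open>Gram--Schmidt. The vanishing coordinates keep the next orthogonalised field nonzero.\<close>

lemma orthonormal_frame_chart:
  assumes c: "c \<in> A"
  shows "\<exists>E. onf (fst c) E"
proof -
  let ?U = "fst c"
  have U: "mopen ?U" using c by (rule mopen_chart)
  have "\<exists>E. (\<forall>i\<in>S. vf ?U (E i)) \<and>
      (\<forall>p\<in>?U. \<forall>i\<in>S. \<forall>j\<in>S. g p (E i p) (E j p) = (if i = j then 1 else 0)) \<and>
      (\<forall>p\<in>?U. \<forall>i\<in>S. \<forall>k\<in>Basis - S. E i p (crd c k) = 0)"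
    if "finite S" "S \<subseteq> Basis" for S
    using that
  proof (induction S)
    case (insert k S)
    then obtain E where "\<forall>i\<in>S. vf ?U (E i)"
      "\<forall>p\<in>?U. \<forall>i\<in>S. \<forall>j\<in>S. g p (E i p) (E j p) = (if i = j then 1 else 0)"
      "\<forall>p\<in>?U. \<forall>i\<in>S. \<forall>k\<in>Basis - S. E i p (crd c k) = 0" by auto
    then have E: "\<And>i. i \<in> S \<Longrightarrow> vf ?U (E i)"
      "\<And>p i j. p \<in> ?U \<Longrightarrow> i \<in> S \<Longrightarrow> j \<in> S \<Longrightarrow> g p (E i p) (E j p) = (if i = j then 1 else 0)"
      "\<And>p i l. p \<in> ?U \<Longrightarrow> i \<in> S \<Longrightarrow> l \<in> Basis - S \<Longrightarrow> E i p (crd c l) = 0" by blast+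
    let ?b = "\<lambda>p. chart_vec A c p k"
    let ?P = "\<lambda>p f. \<Sum>i\<in>S. g p (?b p) (E i p) * E i p f"
    let ?N = "vf_diff ?b ?P"
    have b: "vf ?U ?b" using c by (rule vf_chart_vec)
    have P: "vf ?U ?P" by (intro vf_sum U metric_smooth b E(1))
    have N: "vf ?U ?N" by (intro vf_diff U b P)
    have Et: "E i p \<in> TS p" if "p \<in> ?U" "i \<in> S" for p i
      using E(1) vf_tangent that by blast
    note bt = vf_tangent[OF b] and Pt = vf_tangent[OF P] and Nt = vf_tangent[OF N]
    have NE: "g p (?N p) (E j p) = 0" if p: "p \<in> ?U" "j \<in> S" for p j
    proof -
      have "g p (?P p) (E j p) = (\<Sum>i\<in>S. g p (?b p) (E i p) * g p (E i p) (E j p))"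
        using metric_sum_left[OF Et[OF p], of S "\<lambda>i. E i p"] Et p by simp
      also have "\<dots> = (\<Sum>i\<in>S. if i = j then g p (?b p) (E j p) else 0)"
        by (intro sum.cong refl) (use E(2) p in auto)
      also have "\<dots> = g p (?b p) (E j p)" using insert.hyps p by (simp add: sum.delta')
      finally show ?thesis
        using metric_diff_left[OF bt Pt Et] p by (simp add: vf_diff_def)
    qed
    have Nc: "?N p (crd c l) = k \<bullet> l" if p: "p \<in> ?U" "l \<in> Basis - S" for p l
      using chart_vec_coord[OF c p(1)] E(3)[OF p(1) _ p(2)] by (simp add: vf_diff_def)
    have Npos: "g p (?N p) (?N p) > 0" if p: "p \<in> ?U" for p
    proof (rule metric_pos[OF Nt[OF p]])
      have "?N p (crd c k) = 1" using Nc[OF p, of k] insert.hyps insert.prems by simp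
      then show "?N p \<noteq> (\<lambda>f. 0)" by (metis zero_neq_one)
    qed
    \<comment> \<open>The reciprocal length, written as a power so that
      \<open>smooth_fun_powr\<close> applies.\<close>
    let ?r = "\<lambda>p. g p (?N p) (?N p) powr (-1/2)"
    let ?F = "vf_scale ?r ?N"
    have F: "vf ?U ?F"
      by (intro vf_scale U N smooth_fun_powr metric_smooth Npos)
    have FF: "g p (?F p) (?F p) = 1" if p: "p \<in> ?U" for p
    proof -
      have "g p (?F p) (?F p) = ?r p * ?r p * g p (?N p) (?N p)"
        using metric_scale_left[OF Nt[OF p] vf_tangent[OF F p], of "?r p"]
          metric_scale_right[OF Nt[OF p] Nt[OF p], of "?r p"]
        by (simp add: vf_scale_def)
      also have "?r p * ?r p = g p (?N p) (?N p) powr (-1)" by (simp flip: powr_add)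
      finally show ?thesis using Npos[OF p] by (simp add: powr_minus)
    qed
    have FE: "g p (?F p) (E j p) = 0" "g p (E j p) (?F p) = 0" if p: "p \<in> ?U" "j \<in> S" for p j
      using metric_scale_left[OF Nt Et] metric_sym[OF Et[OF p] vf_tangent[OF F p(1)]] NE[OF p] p
      by (auto simp: vf_scale_def)
    have Fc: "?F p (crd c l) = 0" if p: "p \<in> ?U" "l \<in> Basis - insert k S" for p l
      using Nc[OF p(1), of l] p insert.prems by (auto simp: vf_scale_def inner_Basis)
    show ?case
    proof (intro exI[of _ "E(k := ?F)"] conjI ballI)
      show "vf ?U ((E(k := ?F)) i)" if "i \<in> insert k S" for i
        using that F E(1) by auto
      show "g p ((E(k := ?F)) i p) ((E(k := ?F)) j p) = (if i = j then 1 else 0)"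
        if "p \<in> ?U" "i \<in> insert k S" "j \<in> insert k S" for p i j
        using that FF FE E(2) insert.hyps by auto
      show "(E(k := ?F)) i p (crd c l) = 0"
        if "p \<in> ?U" "i \<in> insert k S" "l \<in> Basis - insert k S" for p i l
        using that Fc E(3) by auto
    qed
  qed auto
  from this[OF finite_Basis order_refl] show ?thesis unfolding orthonormal_frame_on_def by blast
qed

text \<open>A dimension count. The linear map L from coefficients to chart components is injective,
  since inner products with the frame recover the coefficients; hence it is onto.\<close>

lemma frame_expand:
  assumes E: "onf U E" "p \<in> U" and v: "v \<in> TS p"
  shows "v = (\<lambda>f. \<Sum>i\<in>Basis. g p v (E i p) * E i p f)"
proof -
  obtain c where c: "c \<in> A" "p \<in> fst c" using tangent_space_chart[OF v] by blast
  note Et = onf_tangent[OF E(1) _ E(2)]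
  define L where "L x = (\<Sum>i\<in>Basis. (x \<bullet> i) *\<^sub>R chart_coords c (E i p))" for x :: 'e
  have L: "chart_vec A c p (L x) = (\<lambda>f. \<Sum>i\<in>Basis. (x \<bullet> i) * E i p f)" for x
    using chart_vec_sum[OF c, of Basis "\<lambda>i. x \<bullet> i"] chart_vec_chart_coords[OF c Et]
    by (simp add: L_def fun_eq_iff)
  have coeff: "g p (chart_vec A c p (L x)) (E j p) = x \<bullet> j" if j: "j \<in> Basis" for x j
  proof -
    have "g p (chart_vec A c p (L x)) (E j p) = (\<Sum>i\<in>Basis. (x \<bullet> i) * g p (E i p) (E j p))"
      unfolding L using metric_sum_left[OF Et[OF j], of Basis "\<lambda>i. E i p"] Et by simp
    also have "\<dots> = (\<Sum>i\<in>Basis. if i = j then x \<bullet> j else 0)"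
      by (intro sum.cong refl) (use onf_inner[OF E(1) _ j E(2)] in auto)
    finally show ?thesis using j by simp
  qed
  have lin: "linear L"
    unfolding L_def by (intro linearI) (simp_all add: inner_add_left scaleR_left_distrib sum.distrib scaleR_sum_right)
  have "inj L"
  proof (rule injI)
    fix x y assume "L x = L y"
    then have "x \<bullet> j = y \<bullet> j" if "j \<in> Basis" for j using coeff[OF that] by metis
    then show "x = y" by (rule euclidean_eqI)
  qed
  then have "surj L" using linear_injective_imp_surjective lin by blast
  then obtain x where x: "chart_coords c v = L x" by (metis surjD)
  have v': "v = chart_vec A c p (L x)" using chart_vec_chart_coords[OF c v] x by simp
  then have "g p v (E i p) = x \<bullet> i" if "i \<in> Basis" for i using coeff[OF that] by simp
  then show ?thesis using v' L[of x] by simp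
qed

text \<open>The coefficients are taken on a whole neighbourhood, where they are smooth, so that
  tensoriality can extract them.\<close>

lemma frame_expand_vf:
  assumes L: "tensorial_at p L" and E: "onf U E" "mopen U" "p \<in> U" and X: "vf_near p X"
  shows "L X = (\<Sum>i\<in>Basis. g p (X p) (E i p) * L (E i))"
proof -
  obtain V where V: "mopen V" "p \<in> V" "vf V X" using X unfolding vf_near_def by blast
  let ?U = "U \<inter> V"
  have oU: "mopen ?U" "p \<in> ?U" using V E by auto
  have EU: "onf ?U E" using onf_subset[OF E(1)] by auto
  have vX: "vf ?U X" using V vf_subset by blast
  have a: "sfun ?U (\<lambda>q. g q (X q) (E i q))" if "i \<in> Basis" for i
    using metric_smooth[OF oU(1) vX onf_vf[OF EU that]] .
  have "L X = L (\<lambda>q f. \<Sum>i\<in>Basis. g q (X q) (E i q) * E i q f)"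
  proof (rule tensorial_cong[OF L oU vX])
    show "vf ?U (\<lambda>q f. \<Sum>i\<in>Basis. g q (X q) (E i q) * E i q f)"
      by (intro vf_sum oU a onf_vf[OF EU])
    show "X q = (\<lambda>f. \<Sum>i\<in>Basis. g q (X q) (E i q) * E i q f)" if "q \<in> ?U" for q
      using frame_expand[OF EU that vf_tangent[OF vX that]] .
  qed
  also have "\<dots> = (\<Sum>i\<in>Basis. g p (X p) (E i p) * L (E i))"
    by (intro tensorial_sum[OF L oU] a onf_vf[OF EU]) auto
  finally show ?thesis .
qed

lemma frame_inner:
  assumes E: "onf U E" "p \<in> U" and v: "v \<in> TS p" and w: "w \<in> TS p"
  shows "g p v w = (\<Sum>i\<in>Basis. g p v (E i p) * g p (E i p) w)"
  using metric_sum_left[OF w, of Basis "\<lambda>i. E i p" "\<lambda>i. g p v (E i p)"] frame_expand[OF E v]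
    onf_tangent[OF E(1) _ E(2)] by simp

text \<open>Both slots are expanded in E. The coefficients of the change of frame form an orthogonal
  matrix, and summing over i contracts it with its transpose to the identity. B acts on fields
  because covariant derivatives do; tensoriality in each slot stands in for bilinearity on the
  tangent space.\<close>

lemma trace_frame_independent:
  assumes E: "onf U E" "mopen U" "p \<in> U" and F: "onf V F" "mopen V" "p \<in> V"
    and B1: "\<And>Y. vf_near p Y \<Longrightarrow> tensorial_at p (\<lambda>X. B X Y)"
    and B2: "\<And>X. vf_near p X \<Longrightarrow> tensorial_at p (\<lambda>Y. B X Y)"
  shows "(\<Sum>i\<in>Basis. B (F i) (F i)) = (\<Sum>i\<in>Basis. B (E i) (E i))"
proof -
  note En = onf_near[OF E(1) _ E(2,3)] and Fn = onf_near[OF F(1) _ F(2,3)]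
  note Et = onf_tangent[OF E(1) _ E(3)] and Ft = onf_tangent[OF F(1) _ F(3)]
  have "B (F i) (F i) = (\<Sum>j\<in>Basis. \<Sum>k\<in>Basis. g p (E j p) (F i p) * g p (F i p) (E k p) * B (E j) (E k))"
    if i: "i \<in> Basis" for i
  proof -
    have "B (F i) (F i) = (\<Sum>j\<in>Basis. g p (F i p) (E j p) * B (E j) (F i))"
      by (rule frame_expand_vf[OF B1[OF Fn[OF i]] E Fn[OF i]])
    also have "\<dots> = (\<Sum>j\<in>Basis. g p (F i p) (E j p) * (\<Sum>k\<in>Basis. g p (F i p) (E k p) * B (E j) (E k)))"
      by (intro sum.cong refl arg_cong2[where f = "(*)"] frame_expand_vf[OF B2 E Fn[OF i]] En)
    finally show ?thesis
      using metric_sym[OF Ft[OF i] Et] by (simp add: sum_distrib_left mult.assoc)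
  qed
  then have "(\<Sum>i\<in>Basis. B (F i) (F i)) =
      (\<Sum>i\<in>Basis. \<Sum>j\<in>Basis. \<Sum>k\<in>Basis. g p (E j p) (F i p) * g p (F i p) (E k p) * B (E j) (E k))"
    by (rule sum.cong[OF refl])
  also have "\<dots> = (\<Sum>j\<in>Basis. \<Sum>i\<in>Basis. \<Sum>k\<in>Basis. g p (E j p) (F i p) * g p (F i p) (E k p) * B (E j) (E k))"
    by (rule sum.swap)
  also have "\<dots> = (\<Sum>j\<in>Basis. \<Sum>k\<in>Basis. \<Sum>i\<in>Basis. g p (E j p) (F i p) * g p (F i p) (E k p) * B (E j) (E k))"
    by (intro sum.cong refl sum.swap)
  also have "\<dots> = (\<Sum>j\<in>Basis. \<Sum>k\<in>Basis. g p (E j p) (E k p) * B (E j) (E k))"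
    using frame_inner[OF F(1,3) Et Et] by (intro sum.cong refl) (simp add: sum_distrib_right)
  also have "\<dots> = (\<Sum>j\<in>Basis. \<Sum>k\<in>Basis. if j = k then B (E j) (E k) else 0)"
    by (intro sum.cong refl) (simp add: onf_inner[OF E(1) _ _ E(3)])
  also have "\<dots> = (\<Sum>j\<in>Basis. B (E j) (E j))" by simp
  finally show ?thesis .
qed

lemma frame_at:
  assumes "p \<in> points A"
  obtains U where "mopen U" "p \<in> U" "onf U (frame_at A g p)"
proof -
  obtain c where c: "c \<in> A" "p \<in> fst c" using assms by (auto simp: points_def)
  then have "\<exists>E U. mopen U \<and> p \<in> U \<and> onf U E" using mopen_chart orthonormal_frame_chart by blast
  then have "\<exists>U. mopen U \<and> p \<in> U \<and> onf U (frame_at A g p)"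
    unfolding frame_at_def by (rule someI_ex)
  then show thesis using that by blast
qed

text \<open>Trades the frame chosen in \<open>metric_trace\<close> for any orthonormal frame near
  the point.\<close>

lemma metric_trace_frame:
  assumes E: "onf U E" "mopen U" "p \<in> U"
    and "\<And>Y. vf_near p Y \<Longrightarrow> tensorial_at p (\<lambda>X. S X Y p f)"
    and "\<And>X. vf_near p X \<Longrightarrow> tensorial_at p (\<lambda>Y. S X Y p f)"
  shows "metric_trace A g S p f = (\<Sum>i\<in>Basis. S (E i) (E i) p f)"
proof -
  have "p \<in> points A" using E openin_subset by (auto simp: mopen_iff)
  then obtain V where "mopen V" "p \<in> V" "onf V (frame_at A g p)" using frame_at by blast
  then show ?thesis unfolding metric_trace_def
    using trace_frame_independent[OF E _ _ _ assms(4,5)] by blast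
qed

section \<open>The Levi-Civita connection\<close>

lemma smooth_at_metric:
  "mopen U \<Longrightarrow> p \<in> U \<Longrightarrow> vf U X \<Longrightarrow> vf U Y \<Longrightarrow>
    smooth_at A p (\<lambda>q. g q (X q) (Y q))"
  using metric_smooth smooth_atI by blast

text \<open>The right side of Koszul's formula, that is, 2 g(D_X Y, Z) for the Levi-Civita
  connection D.\<close>

definition koszul :: "'a vfield \<Rightarrow> 'a vfield \<Rightarrow> 'a vfield \<Rightarrow> 'a \<Rightarrow> real" where
  "koszul X Y Z p = X p (\<lambda>q. g q (Y q) (Z q)) + Y p (\<lambda>q. g q (X q) (Z q)) - Z p (\<lambda>q. g q (X q) (Y q))
     + g p (lie_bracket A X Y p) (Z p) - g p (lie_bracket A X Z p) (Y p) - g p (lie_bracket A Y Z p) (X p)"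

context
  fixes U p
  assumes U: "mopen U" "p \<in> U"
begin

lemma derivative_metric_sym:
  assumes "v \<in> TS p" and vf: "vf U X" "vf U Y"
  shows "v (\<lambda>q. g q (X q) (Y q)) = v (\<lambda>q. g q (Y q) (X q))"
  by (rule tangent_cong[OF assms(1) U]) (use vf metric_sym vf_tangent in blast)

lemma derivative_metric_add:
  assumes "v \<in> TS p" and vf: "vf U X" "vf U Y" "vf U Y'"
  shows "v (\<lambda>q. g q (X q) (vf_add Y Y' q)) = v (\<lambda>q. g q (X q) (Y q)) + v (\<lambda>q. g q (X q) (Y' q))"
proof -
  have "v (\<lambda>q. g q (X q) (vf_add Y Y' q)) = v (\<lambda>q. g q (X q) (Y q) + g q (X q) (Y' q))"
    by (rule tangent_cong[OF assms(1) U])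
      (use metric_add_right vf[THEN vf_tangent] in \<open>simp add: vf_add_def\<close>)
  then show ?thesis
    using tangent_fun_add[OF assms(1) smooth_at_metric[OF U vf(1,2)] smooth_at_metric[OF U vf(1,3)]] by simp
qed

lemma derivative_metric_scale:
  assumes "v \<in> TS p" and vf: "vf U X" "vf U Y" and h: "sfun U h"
  shows "v (\<lambda>q. g q (X q) (vf_scale h Y q)) = h p * v (\<lambda>q. g q (X q) (Y q)) + v h * g p (X p) (Y p)"
proof -
  have "v (\<lambda>q. g q (X q) (vf_scale h Y q)) = v (\<lambda>q. h q * g q (X q) (Y q))"
    by (rule tangent_cong[OF assms(1) U])
      (use metric_scale_right vf[THEN vf_tangent] in \<open>simp add: vf_scale_def\<close>)
  then show ?thesis
    using tangent_fun_mult[OF assms(1) smooth_atI[OF U h] smooth_at_metric[OF U vf]] by simp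
qed

context
  fixes X Y
  assumes X: "vf U X" and Y: "vf U Y"
begin

text \<open>Together with \<open>koszul_metric\<close> this permutes the three arguments. It yields
  torsion-freeness of the connection, and it also carries additivity and homogeneity over from the
  third argument to the other two.\<close>

lemma koszul_torsion:
  assumes Z: "vf U Z"
  shows "koszul X Y Z p = koszul Y X Z p + 2 * g p (lie_bracket A X Y p) (Z p)"
proof -
  note b = lie_bracket_tangent[OF U X Y]
  have "Z p (\<lambda>q. g q (X q) (Y q)) = Z p (\<lambda>q. g q (Y q) (X q))"
    by (rule derivative_metric_sym[OF vf_tangent[OF Z U(2)] X Y])
  moreover have "g p (lie_bracket A Y X p) (Z p) = - g p (lie_bracket A X Y p) (Z p)"
    unfolding lie_bracket_antisym[of Y X] using metric_minus_left[OF b vf_tangent[OF Z U(2)]] by simp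
  ultimately show ?thesis by (simp add: koszul_def)
qed

lemma koszul_metric:
  assumes Z: "vf U Z"
  shows "koszul X Y Z p = 2 * X p (\<lambda>q. g q (Y q) (Z q)) - koszul X Z Y p"
proof -
  note b = lie_bracket_tangent[OF U Y Z]
  have "X p (\<lambda>q. g q (Z q) (Y q)) = X p (\<lambda>q. g q (Y q) (Z q))"
    by (rule derivative_metric_sym[OF vf_tangent[OF X U(2)] Z Y])
  moreover have "g p (lie_bracket A Z Y p) (X p) = - g p (lie_bracket A Y Z p) (X p)"
    unfolding lie_bracket_antisym[of Z Y] using metric_minus_left[OF b vf_tangent[OF X U(2)]] by simp
  ultimately show ?thesis by (simp add: koszul_def)
qed

lemma koszul_add_3:
  assumes Z: "vf U Z" "vf U Z'"
  shows "koszul X Y (vf_add Z Z') p = koszul X Y Z p + koszul X Y Z' p"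
proof -
  note Xp = vf_tangent[OF X U(2)] and Yp = vf_tangent[OF Y U(2)]
  note Zp = Z[THEN vf_tangent[OF _ U(2)]]
  have 1: "X p (\<lambda>q. g q (Y q) (vf_add Z Z' q)) = X p (\<lambda>q. g q (Y q) (Z q)) + X p (\<lambda>q. g q (Y q) (Z' q))"
    by (rule derivative_metric_add[OF Xp Y Z])
  have 2: "Y p (\<lambda>q. g q (X q) (vf_add Z Z' q)) = Y p (\<lambda>q. g q (X q) (Z q)) + Y p (\<lambda>q. g q (X q) (Z' q))"
    by (rule derivative_metric_add[OF Yp X Z])
  have 3: "g p (lie_bracket A X Y p) (vf_add Z Z' p) = g p (lie_bracket A X Y p) (Z p) + g p (lie_bracket A X Y p) (Z' p)"
    unfolding vf_add_def by (rule metric_add_right[OF Zp lie_bracket_tangent[OF U X Y]])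
  have 4: "g p (lie_bracket A W (vf_add Z Z') p) (V p) = g p (lie_bracket A W Z p) (V p) + g p (lie_bracket A W Z' p) (V p)"
    if W: "vf U W" and V: "vf U V" for W V
    unfolding lie_bracket_add_right[OF U W Z]
    by (rule metric_add_left[OF lie_bracket_tangent[OF U W Z(1)] lie_bracket_tangent[OF U W Z(2)] vf_tangent[OF V U(2)]])
  show ?thesis unfolding koszul_def 1 2 3 4[OF X Y] 4[OF Y X] by (simp add: vf_add_def)
qed

text \<open>The terms with a derivative of h come in pairs: one from differentiating an inner
  product and one, with the opposite sign, from the bracket with
  \<open>vf_scale h Z\<close>.\<close>

lemma koszul_scale_3:
  assumes Z: "vf U Z" and h: "sfun U h"
  shows "koszul X Y (vf_scale h Z) p = h p * koszul X Y Z p"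
proof -
  note Xp = vf_tangent[OF X U(2)] and Yp = vf_tangent[OF Y U(2)] and Zp = vf_tangent[OF Z U(2)]
  have 1: "X p (\<lambda>q. g q (Y q) (vf_scale h Z q)) = h p * X p (\<lambda>q. g q (Y q) (Z q)) + X p h * g p (Z p) (Y p)"
    unfolding derivative_metric_scale[OF Xp Y Z h] metric_sym[OF Zp Yp] ..
  have 2: "Y p (\<lambda>q. g q (X q) (vf_scale h Z q)) = h p * Y p (\<lambda>q. g q (X q) (Z q)) + Y p h * g p (Z p) (X p)"
    unfolding derivative_metric_scale[OF Yp X Z h] metric_sym[OF Zp Xp] ..
  have 3: "g p (lie_bracket A X Y p) (vf_scale h Z p) = h p * g p (lie_bracket A X Y p) (Z p)"
    unfolding vf_scale_def by (rule metric_scale_right[OF Zp lie_bracket_tangent[OF U X Y]])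
  have 4: "g p (lie_bracket A W (vf_scale h Z) p) (V p) = W p h * g p (Z p) (V p) + h p * g p (lie_bracket A W Z p) (V p)"
    if W: "vf U W" and V: "vf U V" for W V
    unfolding lie_bracket_scale_right[OF U h W Z]
    by (rule metric_lincomb_left[OF Zp lie_bracket_tangent[OF U W Z] vf_tangent[OF V U(2)]])
  show ?thesis unfolding koszul_def 1 2 3 4[OF X Y] 4[OF Y X] by (simp add: vf_scale_def algebra_simps)
qed

end

lemma koszul_cong:
  assumes vf: "vf U X" "vf U Y" "vf U Z"
    and eq: "\<And>q. q \<in> U \<Longrightarrow> X q = X' q" "\<And>q. q \<in> U \<Longrightarrow> Y q = Y' q" "\<And>q. q \<in> U \<Longrightarrow> Z q = Z' q"
  shows "koszul X Y Z p = koszul X' Y' Z' p"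
proof -
  note t = vf[THEN vf_tangent[OF _ U(2)]]
  have 1: "v (\<lambda>q. g q (V q) (W q)) = v (\<lambda>q. g q (V' q) (W' q))"
    if "v \<in> TS p" "\<And>q. q \<in> U \<Longrightarrow> V q = V' q" "\<And>q. q \<in> U \<Longrightarrow> W q = W' q" for v V W V' W'
    by (rule tangent_cong[OF that(1) U]) (use that in auto)
  show ?thesis unfolding koszul_def
    using 1[OF t(1) eq(2,3)] 1[OF t(2) eq(1,3)] 1[OF t(3) eq(1,2)] lie_bracket_cong[OF U vf(1,2) eq(1,2)]
      lie_bracket_cong[OF U vf(1,3) eq(1,3)] lie_bracket_cong[OF U vf(2,3) eq(2,3)] eq[OF U(2)]
    by simp
qed

end

lemma koszul_smooth:
  assumes U: "mopen U" and vf: "vf U X" "vf U Y" "vf U Z"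
  shows "sfun U (koszul X Y Z)"
proof -
  have "sfun U (\<lambda>p. koszul X Y Z p)"
    unfolding koszul_def
    by (intro smooth_fun_add smooth_fun_diff U vf[THEN vf_smooth] metric_smooth vf vf_lie_bracket)
  then show ?thesis .
qed

lemma koszul_tensorial:
  assumes X: "vf_near p X" and Y: "vf_near p Y"
  shows "tensorial_at p (\<lambda>Z. koszul X Y Z p)"
proof -
  obtain V where V: "mopen V" "p \<in> V" "vf V X" "vf V Y"
    using vf_near_common[OF X Y] .
  have *: "mopen (U \<inter> V)" "p \<in> U \<inter> V" "vf (U \<inter> V) X" "vf (U \<inter> V) Y"
    if "mopen U" "p \<in> U" for U
    using that V by (auto intro: vf_subset)
  show ?thesis
  proof (rule tensorial_atI)
    fix U Z Z' assume U: "mopen U" "p \<in> U" and Z: "vf U Z" "vf U Z'"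
    have Z': "vf (U \<inter> V) Z" "vf (U \<inter> V) Z'"
      using Z by (auto intro: vf_subset)
    show "koszul X Y (vf_add Z Z') p = koszul X Y Z p + koszul X Y Z' p"
      by (rule koszul_add_3[OF *[OF U] Z'])
    show "koszul X Y Z p = koszul X Y Z' p" if "\<And>q. q \<in> U \<Longrightarrow> Z q = Z' q"
      by (rule koszul_cong[OF *[OF U] Z'(1)]) (use that in auto)
  next
    fix U h Z assume U: "mopen U" "p \<in> U" and Z: "vf U Z" "sfun U h"
    show "koszul X Y (vf_scale h Z) p = h p * koszul X Y Z p"
      by (rule koszul_scale_3[OF *[OF U]]) (use Z in \<open>auto intro: vf_subset smooth_fun_subset\<close>)
  qed
qed

text \<open>The vector dual to half of \<open>koszul X Y\<close> at p. The frame may jump from point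
  to point, but by \<open>kconn_metric\<close> the vector does not depend on it.\<close>

definition kconn :: "'a vfield \<Rightarrow> 'a vfield \<Rightarrow> 'a vfield" where
  "kconn X Y p = (\<lambda>f. \<Sum>i\<in>Basis. koszul X Y (frame_at A g p i) p / 2 * frame_at A g p i p f)"

lemma kconn_tangent:
  assumes "p \<in> points A"
  shows "kconn X Y p \<in> TS p"
proof -
  obtain c where c: "c \<in> A" "p \<in> fst c" using assms by (auto simp: points_def)
  obtain U where "p \<in> U" "onf U (frame_at A g p)" using frame_at[OF assms] .
  then show ?thesis unfolding kconn_def by (intro tangent_sum[OF c]) (simp add: onf_tangent)
qed

lemma kconn_metric:
  assumes X: "vf_near p X" and Y: "vf_near p Y" and Z: "vf_near p Z"
  shows "g p (kconn X Y p) (Z p) = koszul X Y Z p / 2"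
proof -
  have "p \<in> points A" using tangent_points[OF vf_near_tangent[OF X]] .
  then obtain U where U: "mopen U" "p \<in> U" and F: "onf U (frame_at A g p)" using frame_at by blast
  let ?F = "frame_at A g p"
  note Ft = onf_tangent[OF F _ U(2)] and Zt = vf_near_tangent[OF Z]
  have "g p (kconn X Y p) (Z p) = (\<Sum>i\<in>Basis. koszul X Y (?F i) p / 2 * g p (?F i p) (Z p))"
    unfolding kconn_def by (rule metric_sum_left[OF Zt Ft])
  also have "\<dots> = (\<Sum>i\<in>Basis. g p (Z p) (?F i p) * koszul X Y (?F i) p) / 2"
    using metric_sym[OF Ft Zt] by (simp add: sum_divide_distrib mult.commute)
  also have "\<dots> = koszul X Y Z p / 2"
    using frame_expand_vf[OF koszul_tensorial[OF X Y] F U Z] by simp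
  finally show ?thesis .
qed

text \<open>Nondegeneracy reduces an identity of vectors to inner products with local fields Z,
  whose domains may be smaller than U.\<close>

lemma kconn_eqI:
  assumes U: "mopen U" "p \<in> U" and vf: "vf U X" "vf U Y"
    and v: "v \<in> TS p"
    and eq: "\<And>V Z. mopen V \<Longrightarrow> p \<in> V \<Longrightarrow> V \<subseteq> U \<Longrightarrow> vf V Z \<Longrightarrow> g p v (Z p) = koszul X Y Z p / 2"
  shows "kconn X Y p = v"
proof (rule metric_eqI[OF kconn_tangent[OF tangent_points[OF v]] v])
  fix u assume "u \<in> TS p"
  then obtain Z where Z: "vf_near p Z" "Z p = u" using vf_extend by blast
  then obtain V where V: "mopen V" "p \<in> V" "vf V Z" unfolding vf_near_def by blast
  have "g p v (Z p) = koszul X Y Z p / 2"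
    by (rule eq[of "U \<inter> V"]) (use U V in \<open>auto intro: vf_subset\<close>)
  then show "g p (kconn X Y p) u = g p v u"
    using kconn_metric[OF _ _ Z(1)] Z(2) vf U vf_nearI by metis
qed

text \<open>The frames \<open>frame_at A g p\<close> need not vary smoothly with p, so smoothness is
  read off from the expansion in a single frame over a chart.\<close>

lemma kconn_vf:
  assumes U: "mopen U" and vf: "vf U X" "vf U Y"
  shows "vf U (kconn X Y)"
proof (rule vf_local)
  fix p assume p: "p \<in> U"
  obtain c where c: "c \<in> A" "p \<in> fst c" using mopen_imp_chart U p by blast
  obtain E where "onf (fst c) E" using orthonormal_frame_chart[OF c(1)] by blast
  let ?W = "U \<inter> fst c"
  have W: "mopen ?W" "p \<in> ?W" using openin_Int[OF U mopen_chart[OF c(1)]] p c by auto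
  have E: "onf ?W E" using \<open>onf (fst c) E\<close> onf_subset by blast
  have vf': "vf ?W X" "vf ?W Y" using vf by (auto intro: vf_subset)
  have "vf ?W (\<lambda>p f. \<Sum>i\<in>Basis. (1/2 * koszul X Y (E i) p) * E i p f)"
    by (intro vf_sum W onf_vf[OF E] smooth_fun_mult smooth_fun_const koszul_smooth vf')
  then have "vf ?W (kconn X Y)"
  proof (rule vf_cong[OF W(1), rotated])
    fix q assume q: "q \<in> ?W"
    have n: "vf_near q X" "vf_near q Y" using vf_nearI[OF W(1) q] vf' by auto
    have t: "kconn X Y q \<in> TS q"
      using kconn_tangent tangent_points[OF vf_tangent[OF vf'(1) q]] by blast
    have "(1/2 * koszul X Y (E i) q) = g q (kconn X Y q) (E i q)" if "i \<in> Basis" for i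
      using kconn_metric[OF n onf_near[OF E that W(1) q]] by simp
    then show "(\<lambda>f. \<Sum>i\<in>Basis. (1/2 * koszul X Y (E i) q) * E i q f) = kconn X Y q"
      using frame_expand[OF E q t] by simp
  qed
  then show "\<exists>W. mopen W \<and> p \<in> W \<and> vf W (kconn X Y)" using W by blast
qed

text \<open>Each identity among the axioms is tested against a local field Z, where it becomes an
  identity for \<open>koszul\<close>.\<close>

lemma kconn_connection: "connection A kconn"
  unfolding connection_def
proof (intro allI impI conjI ballI)
  fix U X Y assume "mopen U" "vf U X" "vf U Y"
  then show "vf U (kconn X Y)" by (rule kconn_vf)
next
  fix U X X' Y p
  assume U: "mopen U" "p \<in> U" and vf: "vf U X" "vf U X'" "vf U Y"
  show "kconn (vf_add X X') Y p = vf_add (kconn X Y) (kconn X' Y) p"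
  proof (rule kconn_eqI[OF U vf_add[OF U(1) vf(1,2)] vf(3)])
    note t = kconn_vf[OF U(1) vf(1,3), THEN vf_tangent, OF U(2)]
      kconn_vf[OF U(1) vf(2,3), THEN vf_tangent, OF U(2)]
    show "vf_add (kconn X Y) (kconn X' Y) p \<in> TS p"
      unfolding vf_add_def by (rule tangent_add[OF t])
    fix V Z assume V: "mopen V" "p \<in> V" "V \<subseteq> U" and Z: "vf V Z"
    note vf' = vf[THEN vf_subset[OF _ V(3)]] and n = vf_nearI[OF V(1,2)]
    note a = vf_add[OF V(1) vf'(1,2)]
    \<comment> \<open>\<open>koszul_torsion\<close> moves the sum from the first argument to the
      second and \<open>koszul_metric\<close> from there to the third, where additivity is
      known.\<close>
    have "koszul (vf_add X X') Y Z p = koszul X Y Z p + koszul X' Y Z p"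
    proof -
      have b: "lie_bracket A (vf_add X X') Y p = (\<lambda>f. lie_bracket A X Y p f + lie_bracket A X' Y p f)"
        using lie_bracket_add_right[OF V(1,2) vf'(3,1,2)] lie_bracket_antisym[of "vf_add X X'" Y]
          lie_bracket_antisym[of X Y] lie_bracket_antisym[of X' Y] by simp
      have c: "g p (lie_bracket A (vf_add X X') Y p) (Z p) = g p (lie_bracket A X Y p) (Z p) + g p (lie_bracket A X' Y p) (Z p)"
        unfolding b using lie_bracket_tangent[OF V(1,2)] vf' vf_tangent[OF Z V(2)] by (intro metric_add_left)
      have d: "Y p (\<lambda>q. g q (vf_add X X' q) (Z q)) = Y p (\<lambda>q. g q (X q) (Z q)) + Y p (\<lambda>q. g q (X' q) (Z q))"
        using derivative_metric_add[OF V(1,2) vf_tangent[OF vf'(3) V(2)] Z vf'(1,2)]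
          derivative_metric_sym[OF V(1,2) vf_tangent[OF vf'(3) V(2)] Z] vf'(1,2) a by simp
      show ?thesis
        unfolding koszul_torsion[OF V(1,2) a vf'(3) Z] koszul_torsion[OF V(1,2) vf'(1,3) Z]
          koszul_torsion[OF V(1,2) vf'(2,3) Z] koszul_metric[OF V(1,2) vf'(3) a Z]
          koszul_metric[OF V(1,2) vf'(3,1) Z] koszul_metric[OF V(1,2) vf'(3,2) Z]
          koszul_add_3[OF V(1,2) vf'(3) Z vf'(1,2)] c d by simp
    qed
    moreover have "g p (vf_add (kconn X Y) (kconn X' Y) p) (Z p)
        = g p (kconn X Y p) (Z p) + g p (kconn X' Y p) (Z p)"
      unfolding vf_add_def by (rule metric_add_left[OF t vf_tangent[OF Z V(2)]])
    ultimately show "g p (vf_add (kconn X Y) (kconn X' Y) p) (Z p) = koszul (vf_add X X') Y Z p / 2"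
      using kconn_metric[OF n[OF vf'(1)] n[OF vf'(3)] n[OF Z]]
        kconn_metric[OF n[OF vf'(2)] n[OF vf'(3)] n[OF Z]] by simp
  qed
next
  fix U h X Y p
  assume U: "mopen U" "p \<in> U" and h: "sfun U h" and vf: "vf U X" "vf U Y"
  show "kconn (vf_scale h X) Y p = vf_scale h (kconn X Y) p"
  proof (rule kconn_eqI[OF U vf_scale[OF U(1) h vf(1)] vf(2)])
    note t = kconn_vf[OF U(1) vf, THEN vf_tangent, OF U(2)]
    show "vf_scale h (kconn X Y) p \<in> TS p"
      unfolding vf_scale_def by (rule tangent_scale[OF t])
    fix V Z assume V: "mopen V" "p \<in> V" "V \<subseteq> U" and Z: "vf V Z"
    note vf' = vf[THEN vf_subset[OF _ V(3)]] and n = vf_nearI[OF V(1,2)] and h' = smooth_fun_subset[OF h V(3)]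
    note a = vf_scale[OF V(1) h' vf'(1)] and tp = vf'[THEN vf_tangent, OF V(2)] and Zp = vf_tangent[OF Z V(2)]
    have "koszul (vf_scale h X) Y Z p = h p * koszul X Y Z p"
    proof -
      have b: "lie_bracket A (vf_scale h X) Y p = (\<lambda>f. h p * lie_bracket A X Y p f + (- Y p h) * X p f)"
        using lie_bracket_scale_right[OF V(1,2) h' vf'(2,1)] lie_bracket_antisym[of "vf_scale h X" Y]
          lie_bracket_antisym[of X Y] by (simp add: algebra_simps)
      have c: "g p (lie_bracket A (vf_scale h X) Y p) (Z p) = h p * g p (lie_bracket A X Y p) (Z p) + (- Y p h) * g p (X p) (Z p)"
        unfolding b by (rule metric_lincomb_left[OF lie_bracket_tangent[OF V(1,2) vf'] tp(1) Zp])
      have d: "Y p (\<lambda>q. g q (vf_scale h X q) (Z q)) = h p * Y p (\<lambda>q. g q (X q) (Z q)) + Y p h * g p (X p) (Z p)"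
        using derivative_metric_scale[OF V(1,2) tp(2) Z vf'(1) h']
          derivative_metric_sym[OF V(1,2) tp(2) Z vf'(1)] derivative_metric_sym[OF V(1,2) tp(2) Z a]
          metric_sym[OF tp(1) Zp] by simp
      show ?thesis
        unfolding koszul_torsion[OF V(1,2) a vf'(2) Z] koszul_torsion[OF V(1,2) vf' Z]
          koszul_metric[OF V(1,2) vf'(2) a Z] koszul_metric[OF V(1,2) vf'(2,1) Z]
          koszul_scale_3[OF V(1,2) vf'(2) Z vf'(1) h'] c d by (simp add: algebra_simps)
    qed
    moreover have "g p (vf_scale h (kconn X Y) p) (Z p) = h p * g p (kconn X Y p) (Z p)"
      unfolding vf_scale_def by (rule metric_scale_left[OF t Zp])
    ultimately show "g p (vf_scale h (kconn X Y) p) (Z p) = koszul (vf_scale h X) Y Z p / 2"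
      using kconn_metric[OF n[OF vf'(1)] n[OF vf'(2)] n[OF Z]] by simp
  qed
next
  fix U X Y Y' p
  assume U: "mopen U" "p \<in> U" and vf: "vf U X" "vf U Y" "vf U Y'"
  show "kconn X (vf_add Y Y') p = vf_add (kconn X Y) (kconn X Y') p"
  proof (rule kconn_eqI[OF U vf(1) vf_add[OF U(1) vf(2,3)]])
    note t = kconn_vf[OF U(1) vf(1,2), THEN vf_tangent, OF U(2)]
      kconn_vf[OF U(1) vf(1,3), THEN vf_tangent, OF U(2)]
    show "vf_add (kconn X Y) (kconn X Y') p \<in> TS p"
      unfolding vf_add_def by (rule tangent_add[OF t])
    fix V Z assume V: "mopen V" "p \<in> V" "V \<subseteq> U" and Z: "vf V Z"
    note vf' = vf[THEN vf_subset[OF _ V(3)]] and n = vf_nearI[OF V(1,2)]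
    note a = vf_add[OF V(1) vf'(2,3)] and Xp = vf_tangent[OF vf'(1) V(2)]
    have d: "X p (\<lambda>q. g q (vf_add Y Y' q) (Z q)) = X p (\<lambda>q. g q (Y q) (Z q)) + X p (\<lambda>q. g q (Y' q) (Z q))"
      using derivative_metric_add[OF V(1,2) Xp Z vf'(2,3)]
        derivative_metric_sym[OF V(1,2) Xp Z] vf'(2,3) a by simp
    have "koszul X (vf_add Y Y') Z p = koszul X Y Z p + koszul X Y' Z p"
      unfolding koszul_metric[OF V(1,2) vf'(1) a Z] koszul_metric[OF V(1,2) vf'(1,2) Z]
        koszul_metric[OF V(1,2) vf'(1,3) Z] koszul_add_3[OF V(1,2) vf'(1) Z vf'(2,3)] d by simp
    moreover have "g p (vf_add (kconn X Y) (kconn X Y') p) (Z p)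
        = g p (kconn X Y p) (Z p) + g p (kconn X Y' p) (Z p)"
      unfolding vf_add_def by (rule metric_add_left[OF t vf_tangent[OF Z V(2)]])
    ultimately show "g p (vf_add (kconn X Y) (kconn X Y') p) (Z p) = koszul X (vf_add Y Y') Z p / 2"
      using kconn_metric[OF n[OF vf'(1)] n[OF vf'(2)] n[OF Z]]
        kconn_metric[OF n[OF vf'(1)] n[OF vf'(3)] n[OF Z]] by simp
  qed
next
  fix U h X Y p
  assume U: "mopen U" "p \<in> U" and h: "sfun U h" and vf: "vf U X" "vf U Y"
  show "kconn X (vf_scale h Y) p = vf_add (vf_scale (\<lambda>q. X q h) Y) (vf_scale h (kconn X Y)) p"
  proof (rule kconn_eqI[OF U vf(1) vf_scale[OF U(1) h vf(2)]])
    note t = kconn_vf[OF U(1) vf, THEN vf_tangent, OF U(2)]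
    note Yp = vf_tangent[OF vf(2) U(2)]
    show "vf_add (vf_scale (\<lambda>q. X q h) Y) (vf_scale h (kconn X Y)) p \<in> TS p"
      unfolding vf_scale_def vf_add_def by (rule tangent_lincomb[OF Yp t])
    fix V Z assume V: "mopen V" "p \<in> V" "V \<subseteq> U" and Z: "vf V Z"
    note vf' = vf[THEN vf_subset[OF _ V(3)]] and n = vf_nearI[OF V(1,2)] and h' = smooth_fun_subset[OF h V(3)]
    note a = vf_scale[OF V(1) h' vf'(2)] and Xp = vf_tangent[OF vf'(1) V(2)] and Zp = vf_tangent[OF Z V(2)]
    have d: "X p (\<lambda>q. g q (vf_scale h Y q) (Z q)) = h p * X p (\<lambda>q. g q (Y q) (Z q)) + X p h * g p (Y p) (Z p)"
      using derivative_metric_scale[OF V(1,2) Xp Z vf'(2) h']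
        derivative_metric_sym[OF V(1,2) Xp Z vf'(2)] derivative_metric_sym[OF V(1,2) Xp Z a]
        metric_sym[OF Yp Zp] by simp
    \<comment> \<open>The factor 2 comes from \<open>koszul_metric\<close>; the division by 2 in
      \<open>kconn\<close> leaves exactly the Leibniz term.\<close>
    have "koszul X (vf_scale h Y) Z p = h p * koszul X Y Z p + 2 * X p h * g p (Y p) (Z p)"
      unfolding koszul_metric[OF V(1,2) vf'(1) a Z] koszul_metric[OF V(1,2) vf' Z]
        koszul_scale_3[OF V(1,2) vf'(1) Z vf'(2) h'] d by (simp add: algebra_simps)
    moreover have "g p (vf_add (vf_scale (\<lambda>q. X q h) Y) (vf_scale h (kconn X Y)) p) (Z p)
        = X p h * g p (Y p) (Z p) + h p * g p (kconn X Y p) (Z p)"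
      unfolding vf_scale_def vf_add_def by (rule metric_lincomb_left[OF Yp t Zp])
    ultimately show "g p (vf_add (vf_scale (\<lambda>q. X q h) Y) (vf_scale h (kconn X Y)) p) (Z p)
        = koszul X (vf_scale h Y) Z p / 2"
      using kconn_metric[OF n[OF vf'(1)] n[OF vf'(2)] n[OF Z]] by (simp add: add_divide_distrib)
  qed
next
  fix U X X' Y Y' p
  assume U: "mopen U" "p \<in> U" and vf: "vf U X" "vf U X'" "vf U Y" "vf U Y'"
    and eq: "\<forall>p\<in>U. X p = X' p \<and> Y p = Y' p"
  show "kconn X Y p = kconn X' Y' p"
  proof (rule kconn_eqI[OF U vf(1,3)])
    show "kconn X' Y' p \<in> TS p"
      by (rule kconn_vf[OF U(1) vf(2,4), THEN vf_tangent, OF U(2)])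
    fix V Z assume V: "mopen V" "p \<in> V" "V \<subseteq> U" and Z: "vf V Z"
    note vf' = vf[THEN vf_subset[OF _ V(3)]] and n = vf_nearI[OF V(1,2)]
    have "koszul X Y Z p = koszul X' Y' Z p"
      by (rule koszul_cong[OF V(1,2) vf'(1,3) Z]) (use eq V in auto)
    then show "g p (kconn X' Y' p) (Z p) = koszul X Y Z p / 2"
      using kconn_metric[OF n[OF vf'(2)] n[OF vf'(4)] n[OF Z]] by simp
  qed
qed

lemma kconn_torsion_free: "torsion_free A kconn"
  unfolding torsion_free_def
proof (intro allI impI ballI)
  fix U X Y p
  assume U: "mopen U" "p \<in> U" and vf: "vf U X" "vf U Y"
  note t = kconn_vf[OF U(1) vf(1,2), THEN vf_tangent, OF U(2)]
    kconn_vf[OF U(1) vf(2,1), THEN vf_tangent, OF U(2)]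
  note b = lie_bracket_tangent[OF U vf(2,1)]
  have "kconn X Y p = (\<lambda>f. kconn Y X p f + lie_bracket A X Y p f)"
  proof (rule kconn_eqI[OF U vf])
    show "(\<lambda>f. kconn Y X p f + lie_bracket A X Y p f) \<in> TS p"
      by (rule tangent_add[OF t(2) lie_bracket_tangent[OF U vf]])
    fix V Z assume V: "mopen V" "p \<in> V" "V \<subseteq> U" and Z: "vf V Z"
    note vf' = vf[THEN vf_subset[OF _ V(3)]] and n = vf_nearI[OF V(1,2)]
    have "g p (\<lambda>f. kconn Y X p f + lie_bracket A X Y p f) (Z p)
        = g p (kconn Y X p) (Z p) + g p (lie_bracket A X Y p) (Z p)"
      by (rule metric_add_left[OF t(2) lie_bracket_tangent[OF U vf] vf_tangent[OF Z V(2)]])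
    then show "g p (\<lambda>f. kconn Y X p f + lie_bracket A X Y p f) (Z p) = koszul X Y Z p / 2"
      using kconn_metric[OF n[OF vf'(2)] n[OF vf'(1)] n[OF Z]]
        koszul_torsion[OF V(1,2) vf' Z] by simp
  qed
  then show "vf_diff (kconn X Y) (kconn Y X) p = lie_bracket A X Y p"
    by (simp add: vf_diff_def)
qed

lemma kconn_metric_connection: "metric_connection A g kconn"
  unfolding metric_connection_def
proof (intro allI impI ballI)
  fix U X Y Z p
  assume U: "mopen U" "p \<in> U" and vf: "vf U X" "vf U Y" "vf U Z"
  note n = vf_nearI[OF U]
  have "g p (Y p) (kconn X Z p) = g p (kconn X Z p) (Y p)"
    by (rule metric_sym[OF vf_tangent[OF vf(2) U(2)]
          kconn_vf[OF U(1) vf(1,3), THEN vf_tangent, OF U(2)]])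
  then show "X p (\<lambda>q. g q (Y q) (Z q)) = g p (kconn X Y p) (Z p) + g p (Y p) (kconn X Z p)"
    using kconn_metric[OF n[OF vf(1)] n[OF vf(2)] n[OF vf(3)]]
      kconn_metric[OF n[OF vf(1)] n[OF vf(3)] n[OF vf(2)]] koszul_metric[OF U vf(1,2,3)] by simp
qed

abbreviation LC :: "'a vfield \<Rightarrow> 'a vfield \<Rightarrow> 'a vfield" where "LC \<equiv> levi_civita A g"

text \<open>Existence, witnessed by \<open>kconn\<close>, gives the choice operator in the
  definition its meaning; what follows works from these three properties.\<close>

lemma levi_civita: "connection A LC" "torsion_free A LC" "metric_connection A g LC"
proof -
  have "connection A LC \<and> torsion_free A LC \<and> metric_connection A g LC"
    unfolding levi_civita_def
    by (rule someI[where P = "\<lambda>D. connection A D \<and> torsion_free A D \<and> metric_connection A g D"])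
      (use kconn_connection kconn_torsion_free
        kconn_metric_connection in blast)
  then show "connection A LC" "torsion_free A LC" "metric_connection A g LC" by auto
qed

lemma torsion_free_near:
  assumes "torsion_free A D" "vf_near p X" "vf_near p Y"
  shows "D X Y p f - D Y X p f = lie_bracket A X Y p f"
proof -
  obtain U where "mopen U" "p \<in> U" "vf U X" "vf U Y"
    using vf_near_common[OF assms(2,3)] .
  then have "vf_diff (D X Y) (D Y X) p = lie_bracket A X Y p"
    using assms(1) unfolding torsion_free_def by blast
  then show ?thesis by (metis vf_diff_def)
qed

lemma LC_near: "vf_near p X \<Longrightarrow> vf_near p Y \<Longrightarrow> vf_near p (LC X Y)"
  using connection_near levi_civita(1) by blast

lemma LC_tangent: "vf_near p X \<Longrightarrow> vf_near p Y \<Longrightarrow> LC X Y p \<in> TS p"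
  using LC_near vf_near_tangent by blast

lemma LC_metric:
  assumes "vf_near p X" "vf_near p Y" "vf_near p Z"
  shows "X p (\<lambda>q. g q (Y q) (Z q)) = g p (LC X Y p) (Z p) + g p (Y p) (LC X Z p)"
proof -
  obtain U where U: "mopen U" "p \<in> U" "vf U X" "vf U Y"
    using vf_near_common[OF assms(1,2)] .
  obtain V where V: "mopen V" "p \<in> V" "vf V Z" using assms(3) unfolding vf_near_def by blast
  have "mopen (U \<inter> V)" "p \<in> U \<inter> V" "vf (U \<inter> V) X" "vf (U \<inter> V) Y" "vf (U \<inter> V) Z"
    using U V by (auto intro: vf_subset)
  then show ?thesis using levi_civita(3) unfolding metric_connection_def by blast
qed

lemma lie_bracket_near_tangent: "vf_near p X \<Longrightarrow> vf_near p Y \<Longrightarrow> lie_bracket A X Y p \<in> TS p"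
  using vf_near_common lie_bracket_tangent by metis

lemma LC_torsion:
  assumes "vf_near p X" "vf_near p Y" "w \<in> TS p"
  shows "g p (LC X Y p) w = g p (LC Y X p) w + g p (lie_bracket A X Y p) w"
proof -
  have "LC X Y p f = LC Y X p f + lie_bracket A X Y p f" for f
    using torsion_free_near[OF levi_civita(2) assms(1,2)] by (simp add: algebra_simps)
  then have "LC X Y p = (\<lambda>f. LC Y X p f + lie_bracket A X Y p f)" by blast
  then show ?thesis
    using metric_add_left[OF LC_tangent[OF assms(2,1)] lie_bracket_near_tangent[OF assms(1,2)] assms(3)] by simp
qed

text \<open>Differentiating the constant g(E, E) gives twice this inner product. In the torsion
  identity it removes the unknown derivative of a frame field and leaves only a bracket.\<close>

lemma LC_unit:
  assumes "mopen U" "p \<in> U" "vf U E" "\<And>q. q \<in> U \<Longrightarrow> g q (E q) (E q) = k" "vf_near p X"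
  shows "g p (LC X E p) (E p) = 0"
proof -
  have n: "vf_near p E" using assms vf_nearI by blast
  have "X p (\<lambda>q. g q (E q) (E q)) = X p (\<lambda>q. k)"
    by (rule tangent_cong[OF vf_near_tangent[OF assms(5)] assms(1,2,4)])
  also have "\<dots> = 0" by (rule tangent_fun_const[OF vf_near_tangent[OF assms(5)]])
  finally show ?thesis using LC_metric[OF assms(5) n n]
      metric_sym[OF LC_tangent[OF assms(5) n] vf_near_tangent[OF n]] by simp
qed

end

section \<open>Codifferentials of one-forms and of fundamental forms\<close>

context charted
begin

lemma tensorial_addD:
  "tensorial_at p L \<Longrightarrow> mopen U \<Longrightarrow> p \<in> U \<Longrightarrow> vf U X \<Longrightarrow> vf U Y \<Longrightarrow>
    L (vf_add X Y) = L X + L Y"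
  unfolding tensorial_at_def using smooth_fun_const by blast

lemma tensorial_scaleD:
  "tensorial_at p L \<Longrightarrow> mopen U \<Longrightarrow> p \<in> U \<Longrightarrow> vf U X \<Longrightarrow> sfun U h \<Longrightarrow>
    L (vf_scale h X) = h p * L X"
  unfolding tensorial_at_def by blast

lemma tensorial_eval: "tensorial_at p (\<lambda>X. X p f)"
  by (rule tensorial_atI) (auto simp: vf_add_def vf_scale_def)

lemma tensorial_diff:
  assumes "tensorial_at p L" "tensorial_at p L'"
  shows "tensorial_at p (\<lambda>X. L X - L' X)"
proof (rule tensorial_atI)
  fix U X Y assume U: "mopen U" "p \<in> U" "vf U X" "vf U Y"
  show "L (vf_add X Y) - L' (vf_add X Y) = L X - L' X + (L Y - L' Y)"
    using tensorial_addD[OF assms(1) U] tensorial_addD[OF assms(2) U] by simp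
  show "L X - L' X = L Y - L' Y" if "\<And>q. q \<in> U \<Longrightarrow> X q = Y q"
    using tensorial_cong[OF assms(1) U that] tensorial_cong[OF assms(2) U that] by simp
next
  fix U h X assume U: "mopen U" "p \<in> U" "vf U X" "sfun U h"
  show "L (vf_scale h X) - L' (vf_scale h X) = h p * (L X - L' X)"
    using tensorial_scaleD[OF assms(1) U] tensorial_scaleD[OF assms(2) U] by (simp add: algebra_simps)
qed

text \<open>Used with K an inner product with a fixed vector, or an evaluation of J applied to the
  argument.\<close>

lemma tensorial_linear:
  assumes S: "\<And>f. tensorial_at p (\<lambda>X. S X f)" "\<And>X. vf_near p X \<Longrightarrow> S X \<in> TS p"
    and K: "\<And>u v a b. u \<in> TS p \<Longrightarrow> v \<in> TS p \<Longrightarrow>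
      K (\<lambda>f. a * u f + b * v f) = a * K u + b * K v"
  shows "tensorial_at p (\<lambda>X. K (S X))"
proof (rule tensorial_atI)
  fix U X Y assume U: "mopen U" "p \<in> U" "vf U X" "vf U Y"
  have n: "vf_near p X" "vf_near p Y" using U vf_nearI by auto
  have "S (vf_add X Y) = (\<lambda>f. 1 * S X f + 1 * S Y f)" using tensorial_addD[OF S(1) U] by auto
  then show "K (S (vf_add X Y)) = K (S X) + K (S Y)"
    using K[OF S(2)[OF n(1)] S(2)[OF n(2)], of 1 1] by simp
  show "K (S X) = K (S Y)" if "\<And>q. q \<in> U \<Longrightarrow> X q = Y q"
    using tensorial_cong[OF S(1) U that] by (intro arg_cong[where f = K] ext)
next
  fix U h X assume U: "mopen U" "p \<in> U" "vf U X" "sfun U h"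
  have n: "vf_near p X" using U vf_nearI by auto
  have "S (vf_scale h X) = (\<lambda>f. h p * S X f + 0 * S X f)" using tensorial_scaleD[OF S(1) U] by auto
  then show "K (S (vf_scale h X)) = h p * K (S X)"
    using K[OF S(2)[OF n] S(2)[OF n], of "h p" 0] by simp
qed

end

context riemannian
begin

text \<open>Minus the divergence of T. By metric compatibility X g(T, X) splits into g(D_X T, X) and
  g(T, D_X X), and the latter is just what \<open>covariant_derivative\<close> subtracts. The form
  has to agree with T only on fields near points of U.\<close>

lemma codifferential_one_form:
  assumes U: "mopen U" "p \<in> U" and T: "vf U T" and E: "onf U E"
    and eta: "\<And>q X. q \<in> U \<Longrightarrow> vf_near q X \<Longrightarrow> \<eta> [X] q = g q (T q) (X q)"
  shows "codifferential A g \<eta> [] p = - (\<Sum>i\<in>Basis. g p (LC (E i) T p) (E i p))"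
proof -
  let ?F = "frame_at A g p"
  have "p \<in> points A" using tangent_points[OF vf_tangent[OF T U(2)]] .
  then obtain V where V: "mopen V" "p \<in> V" and F: "onf V ?F" using frame_at by blast
  have Tn: "vf_near p T" using U T vf_nearI by blast
  have "covariant_derivative LC (?F i) \<eta> [?F i] p = g p (LC (?F i) T p) (?F i p)" if i: "i \<in> Basis" for i
  proof -
    have Fn: "vf_near q (?F i)" if "q \<in> V" for q using onf_near[OF F i V(1) that] .
    have "?F i p (\<eta> [?F i]) = ?F i p (\<lambda>q. g q (T q) (?F i q))"
      by (rule tangent_cong[OF onf_tangent[OF F i V(2)], of "U \<inter> V"]) (use U V eta Fn in auto)
    moreover have "\<eta> [LC (?F i) (?F i)] p = g p (T p) (LC (?F i) (?F i) p)"
      by (rule eta[OF U(2) LC_near[OF Fn[OF V(2)] Fn[OF V(2)]]])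
    ultimately show ?thesis
      using LC_metric[OF Fn[OF V(2)] Tn Fn[OF V(2)]] by (simp add: covariant_derivative_def)
  qed
  then have "codifferential A g \<eta> [] p = - (\<Sum>i\<in>Basis. g p (LC (?F i) T p) (?F i p))"
    by (simp add: codifferential_def)
  also have "(\<Sum>i\<in>Basis. g p (LC (?F i) T p) (?F i p)) = (\<Sum>i\<in>Basis. g p (LC (E i) T p) (E i p))"
  proof (rule trace_frame_independent[OF E U F V, where B = "\<lambda>X Y. g p (LC X T p) (Y p)"])
    show "tensorial_at p (\<lambda>X. g p (LC X T p) (Y p))" if "vf_near p Y" for Y
      using connection_tensorial_left[OF levi_civita(1) Tn] LC_tangent[OF _ Tn]
        metric_lincomb_left[OF _ _ vf_near_tangent[OF that]] by (rule tensorial_linear)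
    show "tensorial_at p (\<lambda>Y. g p (LC X T p) (Y p))" if "vf_near p X" for X
      using tensorial_eval vf_near_tangent metric_lincomb_right[OF _ _ LC_tangent[OF that Tn]]
      by (rule tensorial_linear)
  qed
  finally show ?thesis .
qed

text \<open>The covariant derivative of the form along X is g((D_X J) Y, W) with (D_X J) Y = D_X (J
  Y) - J (D_X Y). This is tensorial in Y although neither summand is, because the terms X(h) J Y
  cancel; hence every orthonormal frame computes the trace.\<close>

lemma codifferential_fundamental_form:
  assumes U: "mopen U" "p \<in> U" and E: "onf U E" and W: "vf_near p W"
    and J: "\<And>q v. v \<in> TS q \<Longrightarrow> J q v \<in> TS q"
    and J_lincomb: "\<And>q u v a b. u \<in> TS q \<Longrightarrow> v \<in> TS q \<Longrightarrow>
      J q (\<lambda>f. a * u f + b * v f) = (\<lambda>f. a * J q u f + b * J q v f)"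
    and J_vf: "\<And>U X. mopen U \<Longrightarrow> vf U X \<Longrightarrow> vf U (\<lambda>q. J q (X q))"
  shows "codifferential A g (fundamental_form J g) [W] p =
    - (\<Sum>i\<in>Basis. g p (\<lambda>f. LC (E i) (\<lambda>q. J q (E i q)) p f - J p (LC (E i) (E i) p) f) (W p))"
proof -
  let ?F = "frame_at A g p"
  let ?DJ = "\<lambda>X Y f. LC X (\<lambda>q. J q (Y q)) p f - J p (LC X Y p) f"
  have "p \<in> points A" using tangent_points[OF vf_near_tangent[OF W]] .
  then obtain V where V: "mopen V" "p \<in> V" and F: "onf V ?F" using frame_at by blast
  note Wp = vf_near_tangent[OF W]
  have Jn: "vf_near p (\<lambda>q. J q (X q))" if "vf_near p X" for X
    using that J_vf unfolding vf_near_def by blast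
  have t: "LC X (\<lambda>q. J q (Y q)) p \<in> TS p" "J p (LC X Y p) \<in> TS p"
      "?DJ X Y \<in> TS p"
    if "vf_near p X" "vf_near p Y" for X Y
    using LC_tangent Jn J that tangent_diff by auto
  have "covariant_derivative LC (?F i) (fundamental_form J g) [?F i, W] p = g p (?DJ (?F i) (?F i)) (W p)"
    if i: "i \<in> Basis" for i
  proof -
    have Fn: "vf_near p (?F i)" using onf_near[OF F i V] .
    have "?F i p (\<lambda>q. g q (J q (?F i q)) (W q)) =
        g p (LC (?F i) (\<lambda>q. J q (?F i q)) p) (W p) + g p (J p (?F i p)) (LC (?F i) W p)"
      by (rule LC_metric[OF Fn Jn[OF Fn] W])
    \<comment> \<open>The two terms containing the derivative of W cancel.\<close>
    then show ?thesis using metric_diff_left[OF t(1)[OF Fn Fn] t(2)[OF Fn Fn] Wp]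
      by (simp add: covariant_derivative_def fundamental_form_def lessThan_Suc)
  qed
  then have "codifferential A g (fundamental_form J g) [W] p = - (\<Sum>i\<in>Basis. g p (?DJ (?F i) (?F i)) (W p))"
    by (simp add: codifferential_def)
  also have "(\<Sum>i\<in>Basis. g p (?DJ (?F i) (?F i)) (W p)) = (\<Sum>i\<in>Basis. g p (?DJ (E i) (E i)) (W p))"
  proof (rule trace_frame_independent[where B = "\<lambda>X Y. g p (?DJ X Y) (W p)", OF E U F V])
    note linW = metric_lincomb_left[OF _ _ Wp]
    have J_lin: "J p (\<lambda>f. a * u f + b * v f) f = a * J p u f + b * J p v f"
      if "u \<in> TS p" "v \<in> TS p" for a b u v f
      using J_lincomb[OF that] by simp
    fix Y assume Y: "vf_near p Y"
    show "tensorial_at p (\<lambda>X. g p (?DJ X Y) (W p))"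
    proof (rule tensorial_linear[where S = "\<lambda>X. ?DJ X Y" and K = "\<lambda>u. g p u (W p)", OF _ _ linW])
      fix f
      have "tensorial_at p (\<lambda>X. J p (LC X Y p) f)"
        by (rule tensorial_linear[where K = "\<lambda>u. J p u f"])
          (use connection_tensorial_left[OF levi_civita(1) Y] LC_tangent[OF _ Y] J_lin in auto)
      then show "tensorial_at p (\<lambda>X. ?DJ X Y f)"
        by (rule tensorial_diff[OF connection_tensorial_left[OF levi_civita(1) Jn[OF Y]]])
    qed (use t(3)[OF _ Y] in auto)
  next
    fix X assume X: "vf_near p X"
    show "tensorial_at p (\<lambda>Y. g p (?DJ X Y) (W p))"
    proof (rule tensorial_linear[OF _ t(3)[OF X] metric_lincomb_left[OF _ _ Wp]])
      fix f
      obtain V' where V': "mopen V'" "p \<in> V'" "vf V' X" using X unfolding vf_near_def by blast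
      have *: "mopen (U \<inter> V')" "p \<in> U \<inter> V'" "vf (U \<inter> V') X" if "mopen U" "p \<in> U" for U
        using that V' by (auto intro: vf_subset)
      show "tensorial_at p (\<lambda>Y. ?DJ X Y f)"
      proof (rule tensorial_atI)
        fix U Y Y' assume U: "mopen U" "p \<in> U" and Y: "vf U Y" "vf U Y'"
        note o = *[OF U]
        have Y': "vf (U \<inter> V') Y" "vf (U \<inter> V') Y'"
          using Y by (auto intro: vf_subset)
        note JY = J_vf[OF o(1) Y'(1)] J_vf[OF o(1) Y'(2)]
        note YY = vf_add[OF o(1) Y'] and n = Y'[THEN vf_nearI[OF o(1,2)]]
        have "LC X (\<lambda>q. J q (vf_add Y Y' q)) p = LC X (vf_add (\<lambda>q. J q (Y q)) (\<lambda>q. J q (Y' q))) p"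
        proof (rule connection_cong[OF levi_civita(1) o J_vf[OF o(1) YY] o(3) vf_add[OF o(1) JY]])
          show "J q (vf_add Y Y' q) = vf_add (\<lambda>q. J q (Y q)) (\<lambda>q. J q (Y' q)) q" if "q \<in> U \<inter> V'" for q
            using J_lincomb[OF vf_tangent[OF Y'(1) that] vf_tangent[OF Y'(2) that], of 1 1]
            by (simp add: vf_add_def)
        qed simp
        then have 1: "LC X (\<lambda>q. J q (vf_add Y Y' q)) p f = LC X (\<lambda>q. J q (Y q)) p f + LC X (\<lambda>q. J q (Y' q)) p f"
          using connection_add_right[OF levi_civita(1) o JY] by simp
        have "LC X (vf_add Y Y') p = (\<lambda>f. 1 * LC X Y p f + 1 * LC X Y' p f)"
          using connection_add_right[OF levi_civita(1) o Y'] by auto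
        then have "J p (LC X (vf_add Y Y') p) = (\<lambda>f. 1 * J p (LC X Y p) f + 1 * J p (LC X Y' p) f)"
          using J_lincomb[OF LC_tangent[OF X n(1)] LC_tangent[OF X n(2)], of 1 1] by simp
        then show "?DJ X (vf_add Y Y') f = ?DJ X Y f + ?DJ X Y' f" using 1 by simp
        show "?DJ X Y f = ?DJ X Y' f" if eq: "\<And>q. q \<in> U \<Longrightarrow> Y q = Y' q"
        proof -
          have "LC X (\<lambda>q. J q (Y q)) p = LC X (\<lambda>q. J q (Y' q)) p"
            by (rule connection_cong[OF levi_civita(1) o JY(1) o(3) JY(2)]) (use eq in auto)
          moreover have "LC X Y p = LC X Y' p"
            by (rule connection_cong[OF levi_civita(1) o Y'(1) o(3) Y'(2)]) (use eq in auto)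
          ultimately show ?thesis by simp
        qed
      next
        fix U h Y assume U: "mopen U" "p \<in> U" and Y: "vf U Y" "sfun U h"
        note o = *[OF U]
        have Y': "vf (U \<inter> V') Y" and h: "sfun (U \<inter> V') h"
          using Y by (auto intro: vf_subset smooth_fun_subset)
        note JY = J_vf[OF o(1) Y']
        note hY = vf_scale[OF o(1) h Y'] and n = Y'[THEN vf_nearI[OF o(1,2)]]
        have "LC X (\<lambda>q. J q (vf_scale h Y q)) p = LC X (vf_scale h (\<lambda>q. J q (Y q))) p"
        proof (rule connection_cong[OF levi_civita(1) o J_vf[OF o(1) hY] o(3) vf_scale[OF o(1) h JY]])
          show "J q (vf_scale h Y q) = vf_scale h (\<lambda>q. J q (Y q)) q" if "q \<in> U \<inter> V'" for q
            using J_lincomb[OF vf_tangent[OF Y' that] vf_tangent[OF Y' that], of "h q" 0]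
            by (simp add: vf_scale_def)
        qed simp
        then have 1: "LC X (\<lambda>q. J q (vf_scale h Y q)) p f = X p h * J p (Y p) f + h p * LC X (\<lambda>q. J q (Y q)) p f"
          using connection_leibniz[OF levi_civita(1) o(1,2) h o(3) JY] by simp
        have "LC X (vf_scale h Y) p = (\<lambda>f. X p h * Y p f + h p * LC X Y p f)"
          using connection_leibniz[OF levi_civita(1) o(1,2) h o(3) Y'] by auto
        then have "J p (LC X (vf_scale h Y) p) = (\<lambda>f. X p h * J p (Y p) f + h p * J p (LC X Y p) f)"
          using J_lincomb[OF vf_near_tangent[OF n] LC_tangent[OF X n]] by simp
        then show "?DJ X (vf_scale h Y) f = h p * ?DJ X Y f" using 1 by (simp add: algebra_simps)
      qed
    qed
  qed
  finally show ?thesis .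
qed

end

section \<open>The difference tensor and the Koszul forms\<close>

locale affine_riemannian = riemannian A g
  for A :: "('a, 'e::euclidean_space) atlas" and g +
  fixes nab :: "'a vfield \<Rightarrow> 'a vfield \<Rightarrow> 'a vfield"
  assumes nab: "connection A nab" and nab_torsion_free: "torsion_free A nab"
begin

abbreviation gam :: "'a vfield \<Rightarrow> 'a vfield \<Rightarrow> 'a vfield" where "gam \<equiv> difference_tensor A nab g"
abbreviation gam_adj :: "'a vfield \<Rightarrow> 'a vfield \<Rightarrow> 'a vfield" where "gam_adj \<equiv> difference_tensor_adj A nab g"
abbreviation tr :: "'a vfield" where "tr \<equiv> tr_gamma A nab g"
abbreviation tr_adj :: "'a vfield" where "tr_adj \<equiv> tr_gamma_adj A nab g"

lemma gam_eq: "gam X Y p f = LC X Y p f - nab X Y p f"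
  by (simp add: difference_tensor_def vf_diff_def)

lemma gam_vf: "mopen U \<Longrightarrow> vf U X \<Longrightarrow> vf U Y \<Longrightarrow> vf U (gam X Y)"
  unfolding difference_tensor_def using connection_vf[OF nab] connection_vf[OF levi_civita(1)]
  by (intro vf_diff) auto

lemma gam_tangent:
  assumes "vf_near p X" "vf_near p Y" shows "gam X Y p \<in> TS p"
  using vf_near_common[OF assms] gam_vf vf_tangent by metis

text \<open>Both connections have the Lie bracket as antisymmetric part, so it drops out of their
  difference.\<close>

lemma gam_sym:
  assumes "vf_near p X" "vf_near p Y" shows "gam X Y p = gam Y X p"
proof
  fix f
  have "LC X Y p f - LC Y X p f = nab X Y p f - nab Y X p f"
    using torsion_free_near[OF levi_civita(2) assms] torsion_free_near[OF nab_torsion_free assms] by simp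
  then show "gam X Y p f = gam Y X p f" by (simp add: gam_eq)
qed

lemma gam_tensorial_left: "vf_near p Y \<Longrightarrow> tensorial_at p (\<lambda>X. gam X Y p f)"
  unfolding gam_eq
  by (rule tensorial_diff[OF connection_tensorial_left[OF levi_civita(1)] connection_tensorial_left[OF nab]])

lemma gam_tensorial_right: "vf_near p X \<Longrightarrow> tensorial_at p (\<lambda>Y. gam X Y p f)"
  unfolding gam_eq by (rule connection_tensorial_diff_right[OF levi_civita(1) nab])

text \<open>Resolves the definite description by a Riesz argument: a frame supplies the dual vector,
  and nondegeneracy, tested on local extensions, its uniqueness.\<close>

lemma gam_adj:
  assumes X: "vf_near p X" and Y: "vf_near p Y"
  shows "gam_adj X Y p \<in> TS p"
    and "vf_near p Z \<Longrightarrow> g p (gam_adj X Y p) (Z p) = g p (Y p) (gam X Z p)"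
proof -
  let ?P = "\<lambda>w. w \<in> TS p \<and> (\<forall>U Z. mopen U \<and> p \<in> U \<and> vf U Z \<longrightarrow>
        g p w (Z p) = g p (Y p) (gam X Z p))"
  have Yp: "Y p \<in> TS p" using vf_near_tangent[OF Y] .
  obtain c where c: "c \<in> A" "p \<in> fst c" using tangent_space_chart[OF Yp] by blast
  obtain E where E: "onf (fst c) E" using orthonormal_frame_chart[OF c(1)] by blast
  note U = mopen_chart[OF c(1)] c(2) and Et = onf_tangent[OF E _ c(2)]
  let ?w = "\<lambda>f. \<Sum>i\<in>Basis. g p (Y p) (gam X (E i) p) * E i p f"
  have "?P ?w"
  proof (intro conjI allI impI)
    show "?w \<in> TS p" by (rule tangent_sum[OF c Et])
    fix V Z assume "mopen V \<and> p \<in> V \<and> vf V Z"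
    then have Z: "vf_near p Z" using vf_nearI by blast
    note Zp = vf_near_tangent[OF Z]
    have "tensorial_at p (\<lambda>Z. g p (Y p) (gam X Z p))"
      using gam_tensorial_right[OF X] gam_tangent[OF X] metric_lincomb_right[OF _ _ Yp] by (rule tensorial_linear)
    from frame_expand_vf[OF this E U Z]
    have "g p (Y p) (gam X Z p) = (\<Sum>i\<in>Basis. g p (Z p) (E i p) * g p (Y p) (gam X (E i) p))" .
    also have "\<dots> = (\<Sum>i\<in>Basis. g p (Y p) (gam X (E i) p) * g p (E i p) (Z p))"
      using metric_sym[OF Et Zp] by (simp add: mult.commute)
    also have "\<dots> = g p ?w (Z p)"
      by (rule metric_sum_left[OF Zp Et, symmetric])
    finally show "g p ?w (Z p) = g p (Y p) (gam X Z p)" by simp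
  qed
  moreover have "w = ?w" if "?P w" for w
  proof (rule metric_eqI)
    fix u assume "u \<in> TS p"
    then obtain Z where "vf_near p Z" "Z p = u" using vf_extend by blast
    then obtain V where V: "mopen V \<and> p \<in> V \<and> vf V Z" unfolding vf_near_def by blast
    have "g p w (Z p) = g p (Y p) (gam X Z p)" using that V by blast
    moreover have "g p ?w (Z p) = g p (Y p) (gam X Z p)" using \<open>?P ?w\<close> V by blast
    ultimately show "g p w u = g p ?w u" using \<open>Z p = u\<close> by simp
  qed (use that \<open>?P ?w\<close> in auto)
  ultimately have "?P (gam_adj X Y p)"
    unfolding difference_tensor_adj_def by (rule theI)
  then show "gam_adj X Y p \<in> TS p"
    and "vf_near p Z \<Longrightarrow> g p (gam_adj X Y p) (Z p) = g p (Y p) (gam X Z p)"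
    unfolding vf_near_def by blast+
qed

section \<open>Traces of the difference tensor and of its adjoint\<close>

context
  fixes U E
  assumes U: "mopen U" and E: "onf U E"
begin

lemma tr_frame: "p \<in> U \<Longrightarrow> tr p = (\<lambda>f. \<Sum>i\<in>Basis. gam (E i) (E i) p f)"
  unfolding tr_gamma_def
  by (intro ext metric_trace_frame[OF E U] gam_tensorial_left gam_tensorial_right)

lemma tr_vf: "vf U tr"
proof (rule vf_cong[OF U])
  show "vf U (\<lambda>p f. \<Sum>i\<in>Basis. 1 * gam (E i) (E i) p f)"
    by (intro vf_sum U smooth_fun_const gam_vf onf_vf[OF E])
qed (simp add: tr_frame)

lemma tr_metric:
  assumes "p \<in> U" "w \<in> TS p"
  shows "g p (tr p) w = (\<Sum>i\<in>Basis. g p (gam (E i) (E i) p) w)"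
  using metric_sum_left[OF assms(2), of Basis "\<lambda>i. gam (E i) (E i) p" "\<lambda>_. 1"]
    gam_tangent onf_near[OF E _ U assms(1)] by (simp add: tr_frame[OF assms(1)])

lemma tr_adj_tangent:
  assumes "p \<in> U" shows "tr_adj p \<in> TS p"
proof -
  obtain c where c: "c \<in> A" "p \<in> fst c" using mopen_imp_chart[OF U assms] by blast
  then have "p \<in> points A" by (auto simp: points_def)
  then obtain V where V: "mopen V" "p \<in> V" "onf V (frame_at A g p)" using frame_at by blast
  show ?thesis
    using tangent_sum[OF c, of Basis "\<lambda>i. gam_adj (frame_at A g p i) (frame_at A g p i) p" "\<lambda>_. 1"]
      gam_adj(1) onf_near[OF V(3) _ V(1,2)] by (simp add: tr_gamma_adj_def metric_trace_def)
qed

text \<open>The adjoint is moved to the other slot before the frame is changed, because tensoriality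
  is at hand for \<open>gam\<close>, whereas \<open>gam_adj\<close> is a pointwise
  description.\<close>

lemma tr_adj_metric:
  assumes p: "p \<in> U" and Z: "vf_near p Z"
  shows "g p (tr_adj p) (Z p) = (\<Sum>i\<in>Basis. g p (E i p) (gam (E i) Z p))"
proof -
  obtain c where c: "c \<in> A" "p \<in> fst c" using mopen_imp_chart[OF U p] by blast
  let ?F = "frame_at A g p"
  have "p \<in> points A" using c by (auto simp: points_def)
  then obtain V where V: "mopen V" "p \<in> V" and F: "onf V ?F" using frame_at by blast
  note Fn = onf_near[OF F _ V]
  have "g p (tr_adj p) (Z p) = (\<Sum>i\<in>Basis. g p (gam_adj (?F i) (?F i) p) (Z p))"
    using metric_sum_left[OF vf_near_tangent[OF Z], of Basis "\<lambda>i. gam_adj (?F i) (?F i) p" "\<lambda>_. 1"]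
      gam_adj(1) Fn by (simp add: tr_gamma_adj_def metric_trace_def)
  also have "\<dots> = (\<Sum>i\<in>Basis. g p (?F i p) (gam (?F i) Z p))"
    using gam_adj(2)[OF Fn Fn Z] by simp
  also have "\<dots> = (\<Sum>i\<in>Basis. g p (E i p) (gam (E i) Z p))"
  proof (rule trace_frame_independent[OF E U p F V, where B = "\<lambda>X Y. g p (Y p) (gam X Z p)"])
    show "tensorial_at p (\<lambda>X. g p (Y p) (gam X Z p))" if "vf_near p Y" for Y
      using gam_tensorial_left[OF Z] gam_tangent[OF _ Z] metric_lincomb_right[OF _ _ vf_near_tangent[OF that]]
      by (rule tensorial_linear)
    show "tensorial_at p (\<lambda>Y. g p (Y p) (gam X Z p))" if "vf_near p X" for X
      using tensorial_eval vf_near_tangent metric_lincomb_left[OF _ _ gam_tangent[OF that Z]]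
      by (rule tensorial_linear)
  qed
  finally show ?thesis .
qed

text \<open>The definition of \<open>tr_adj\<close> uses another frame at each point; smoothness
  shows in the components with respect to the one frame E.\<close>

lemma tr_adj_vf: "vf U tr_adj"
proof (rule vf_cong[OF U])
  show "vf U (\<lambda>p f. \<Sum>j\<in>Basis. (\<Sum>i\<in>Basis. g p (E i p) (gam (E i) (E j) p)) * E j p f)"
    by (intro vf_sum U smooth_fun_sum metric_smooth gam_vf onf_vf[OF E])
  show "(\<lambda>f. \<Sum>j\<in>Basis. (\<Sum>i\<in>Basis. g p (E i p) (gam (E i) (E j) p)) * E j p f) = tr_adj p" if p: "p \<in> U" for p
    using frame_expand[OF E p tr_adj_tangent[OF p]] tr_adj_metric[OF p onf_near[OF E _ U p]] by simp
qed

text \<open>\<alpha> - \<xi> is the one-form dual to \<open>vf_diff tr_adj tr\<close>.\<close>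

lemma codifferential_koszul:
  assumes p: "p \<in> U"
  shows "codifferential A g (\<lambda>Xs p. koszul_alpha A nab g Xs p - koszul_xi A nab g Xs p) [] p =
    - (\<Sum>i\<in>Basis. g p (LC (E i) (vf_diff tr_adj tr) p) (E i p))"
proof (rule codifferential_one_form[OF U p vf_diff[OF U tr_adj_vf tr_vf] E])
  fix q X assume "q \<in> U" "vf_near q X"
  then show "koszul_alpha A nab g [X] q - koszul_xi A nab g [X] q = g q (vf_diff tr_adj tr q) (X q)"
    using metric_diff_left[OF vf_tangent[OF tr_adj_vf] vf_tangent[OF tr_vf] vf_near_tangent]
    by (simp add: koszul_alpha_def koszul_xi_def vf_diff_def)
qed

end

end

section \<open>The tangent bundle\<close>

context charted
begin

abbreviation TA :: "('a \<times> 'a tvec, 'e \<times> 'e) atlas" where "TA \<equiv> tangent_atlas A"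
abbreviation Tc :: "('a, 'e) chart \<Rightarrow> ('a \<times> 'a tvec, 'e \<times> 'e) chart" where "Tc \<equiv> tangent_chart A"

text \<open>The part of TM over U. The second condition keeps to genuine tangent vectors, since the
  type of pairs contains arbitrary functionals.\<close>

definition tbundle :: "'a set \<Rightarrow> ('a \<times> 'a tvec) set" where
  "tbundle U = {z. fst z \<in> U \<and> snd z \<in> TS (fst z)}"

lemma fst_tangent_chart: "fst (Tc c) = tbundle (fst c)"
  by (auto simp: tangent_chart_def tbundle_def)

lemma snd_tangent_chart: "snd (Tc c) z = (snd c (fst z), chart_coords c (snd z))"
  by (simp add: tangent_chart_def chart_coords_def case_prod_beta)

lemma bundle_Int: "tbundle U \<inter> tbundle V = tbundle (U \<inter> V)"
  by (auto simp: tbundle_def)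

lemma bundle_mono: "U \<subseteq> V \<Longrightarrow> tbundle U \<subseteq> tbundle V"
  by (auto simp: tbundle_def)

text \<open>Every vector of the model space occurs as fibre coordinate, so images of charts are
  products, and openness on TM reduces to openness on the base.\<close>

lemma tangent_chart_image:
  assumes c: "c \<in> A" and U: "U \<subseteq> fst c"
  shows "snd (Tc c) ` tbundle U = snd c ` U \<times> UNIV"
proof
  show "snd c ` U \<times> UNIV \<subseteq> snd (Tc c) ` tbundle U"
  proof clarify
    fix p :: 'a and y :: 'e assume p: "p \<in> U"
    then have "p \<in> fst c" using U by auto
    then have "(p, chart_vec A c p y) \<in> tbundle U" "snd (Tc c) (p, chart_vec A c p y) = (snd c p, y)"
      using c p by (auto simp: tbundle_def snd_tangent_chart chart_vec_in_tangent_space chart_coords_chart_vec)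
    then show "(snd c p, y) \<in> snd (Tc c) ` tbundle U" by force
  qed
qed (auto simp: tbundle_def snd_tangent_chart)

lemma tangent_chart_inj: "c \<in> A \<Longrightarrow> inj_on (snd (Tc c)) (fst (Tc c))"
proof (rule inj_onI)
  fix z z' assume c: "c \<in> A" and z: "z \<in> fst (Tc c)" "z' \<in> fst (Tc c)" "snd (Tc c) z = snd (Tc c) z'"
  have p: "fst z = fst z'"
    using z chart_inj[OF c] by (auto simp: fst_tangent_chart snd_tangent_chart tbundle_def inj_on_def)
  have "snd z = snd z'"
    using z p chart_vec_chart_coords[OF c, of "fst z"]
    by (simp add: fst_tangent_chart snd_tangent_chart tbundle_def) metis
  with p show "z = z'" by (simp add: prod_eq_iff)
qed

lemma tangent_chart_inv:
  assumes c: "c \<in> A" and x: "x \<in> snd c ` fst c"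
  shows "chart_inv (Tc c) (x, y) = (chart_inv c x, chart_vec A c (chart_inv c x) y)"
proof -
  obtain p where p: "p \<in> fst c" "x = snd c p" using x by auto
  let ?z = "(p, chart_vec A c p y)"
  have "?z \<in> fst (Tc c)" "snd (Tc c) ?z = (x, y)"
    using c p by (auto simp: fst_tangent_chart tbundle_def snd_tangent_chart chart_vec_in_tangent_space chart_coords_chart_vec)
  then have "chart_inv (Tc c) (x, y) = ?z"
    unfolding chart_inv_def using inv_into_f_f[OF tangent_chart_inj[OF c]] by metis
  then show ?thesis using c p by (simp add: chart_inv_left)
qed

lemma smooth_on_fst_compose:
  fixes f :: "'b::euclidean_space \<Rightarrow> 'c::real_normed_vector"
  assumes "open S" "smooth_on S f"
  shows "smooth_on (S \<times> UNIV) (\<lambda>x. f (fst x))"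
  by (rule smooth_on_compose[OF _ assms(1) _ smooth_on_linear[OF _ bounded_linear_fst] assms(2)])
    (auto simp: assms open_Times)

text \<open>A transition map of TM sends (x, y) to the transition map of M at x and its Jacobian at
  x applied to y: smooth in x and, in the fibre part, linear in y.\<close>

lemma charted_tangent: "charted TA"
proof
  fix c' assume "c' \<in> TA"
  then obtain c where c: "c \<in> A" "c' = Tc c" by (auto simp: tangent_atlas_def)
  show "inj_on (snd c') (fst c')" unfolding c(2) by (rule tangent_chart_inj[OF c(1)])
  show "open (snd c' ` fst c')"
    unfolding c(2) fst_tangent_chart tangent_chart_image[OF c(1) order_refl]
    by (intro open_Times chart_open c open_UNIV)
next
  fix c' d' assume "c' \<in> TA" "d' \<in> TA"
  then obtain c d where c: "c \<in> A" "c' = Tc c" and d: "d \<in> A" "d' = Tc d" by (auto simp: tangent_atlas_def)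
  let ?U = "fst c \<inter> fst d" and ?S = "snd c ` (fst c \<inter> fst d)"
  have im: "snd c' ` (fst c' \<inter> fst d') = ?S \<times> UNIV"
    unfolding c(2) d(2) fst_tangent_chart bundle_Int by (rule tangent_chart_image[OF c(1)]) auto
  have oS: "open ?S" by (rule chart_overlap_open[OF c(1) d(1)])
  then have o: "open (?S \<times> (UNIV :: 'e set))" by (intro open_Times open_UNIV)
  then show "open (snd c' ` (fst c' \<inter> fst d'))" unfolding im .
  have mU: "mopen ?U" using openin_Int[OF mopen_chart[OF c(1)] mopen_chart[OF d(1)]] .
  have "smooth_on (?S \<times> UNIV) (snd d' \<circ> chart_inv c')"
  proof (rule smooth_on_componentwise[OF o])
    fix i :: "'e \<times> 'e" assume "i \<in> Basis"
    then consider k where "k \<in> Basis" "i = (k, 0)" | k where "k \<in> Basis" "i = (0, k)"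
      by (auto simp: Basis_prod_def)
    then show "smooth_on (?S \<times> UNIV) (\<lambda>x. (snd d' \<circ> chart_inv c') x \<bullet> i)"
    proof cases
      case 1
      have "smooth_on (?S \<times> UNIV) (\<lambda>x::'e \<times> 'e. (snd d \<circ> chart_inv c) (fst x) \<bullet> k)"
        by (intro smooth_on_inner_left o smooth_on_fst_compose oS chart_transition c d)
      then show ?thesis
        by (rule smooth_on_cong[OF o, rotated])
          (use c d 1 in \<open>auto simp: tangent_chart_inv snd_tangent_chart\<close>)
    next
      case 2
      \<comment> \<open>Row k of the Jacobian of the transition map, as functions of the base
        coordinates.\<close>
      let ?f = "\<lambda>j. (\<lambda>p. chart_vec A c p j (crd d k)) \<circ> chart_inv c"
      have "smooth_on ?S (?f j)" for j
        by (intro smooth_fun_chartD smooth_fun_partial[OF c(1)] mU c smooth_fun_subset[OF smooth_fun_coord[OF d(1)]]) auto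
      then have "smooth_on (?S \<times> UNIV) (\<lambda>x::'e \<times> 'e. \<Sum>j\<in>Basis. (snd x \<bullet> j) * ?f j (fst x))"
        by (intro smooth_on_sum smooth_on_mult o smooth_on_inner_left smooth_on_linear[OF o bounded_linear_snd]
            smooth_on_fst_compose oS)
      then show ?thesis
      proof (rule smooth_on_cong[OF o, rotated])
        fix x :: "'e \<times> 'e" assume "x \<in> ?S \<times> UNIV"
        then obtain p y where p: "p \<in> fst c" "p \<in> fst d" "x = (snd c p, y)" by auto
        have "chart_vec A c p y (crd d k) = (\<Sum>j\<in>Basis. (y \<bullet> j) * chart_vec A c p j (crd d k))"
          using chart_vec_sum[OF c(1) p(1), of Basis "\<lambda>j. y \<bullet> j" "\<lambda>j. j"] by (simp add: euclidean_representation)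
        then show "(\<Sum>j\<in>Basis. (snd x \<bullet> j) * ?f j (fst x)) = (snd d' \<circ> chart_inv c') x \<bullet> i"
          using c d 2 p by (simp add: tangent_chart_inv snd_tangent_chart chart_coords_inner chart_inv_left)
      qed
    qed
  qed
  then show "smooth_on (snd c' ` (fst c' \<inter> fst d')) (snd d' \<circ> chart_inv c')" unfolding im .
qed

interpretation T: charted TA by (rule charted_tangent)

lemma tangent_chart_in_atlas: "c \<in> A \<Longrightarrow> Tc c \<in> TA"
  by (simp add: tangent_atlas_def)

lemma points_tangent_atlas: "points TA = tbundle (points A)"
  by (auto simp: points_def tangent_atlas_def fst_tangent_chart tbundle_def)

lemma mopen_bundle:
  assumes "mopen U" shows "T.mopen (tbundle U)"
  unfolding T.mopen_iff points_tangent_atlas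
proof (intro conjI ballI)
  show "tbundle U \<subseteq> tbundle (points A)" using assms by (intro bundle_mono) (simp add: mopen_iff)
  fix c' assume "c' \<in> TA"
  then obtain c where c: "c \<in> A" "c' = Tc c" by (auto simp: tangent_atlas_def)
  have "snd c' ` (tbundle U \<inter> fst c') = snd c ` (U \<inter> fst c) \<times> UNIV"
    unfolding c(2) fst_tangent_chart bundle_Int by (rule tangent_chart_image[OF c(1)]) auto
  then show "open (snd c' ` (tbundle U \<inter> fst c'))"
    using mopen_imp_open[OF assms c(1)] by (simp add: open_Times)
qed

lemma mopen_bundle_chart: "c \<in> A \<Longrightarrow> T.mopen (tbundle (fst c))"
  by (intro mopen_bundle mopen_chart)

lemma smooth_fun_pullback:
  assumes U: "mopen U" and f: "sfun U f"
  shows "T.sfun (tbundle U) (\<lambda>z. f (fst z))"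
  unfolding smooth_fun_def
proof
  fix c' assume "c' \<in> TA"
  then obtain c where c: "c \<in> A" "c' = Tc c" by (auto simp: tangent_atlas_def)
  let ?S = "snd c ` (U \<inter> fst c)"
  have im: "snd c' ` (tbundle U \<inter> fst c') = ?S \<times> UNIV"
    unfolding c(2) fst_tangent_chart bundle_Int by (rule tangent_chart_image[OF c(1)]) auto
  have oS: "open ?S" using mopen_imp_open[OF U c(1)] .
  have "smooth_on ?S (f \<circ> chart_inv c)" using f c by (simp add: smooth_fun_def)
  from smooth_on_fst_compose[OF oS this]
  have "smooth_on (?S \<times> UNIV) (\<lambda>x::'e \<times> 'e. (f \<circ> chart_inv c) (fst x))" .
  then show "smooth_on (snd c' ` (tbundle U \<inter> fst c')) ((\<lambda>z. f (fst z)) \<circ> chart_inv c')"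
    unfolding im
    by (rule smooth_on_cong[rotated 2]) (use oS c in \<open>auto simp: open_Times tangent_chart_inv\<close>)
qed

lemma smooth_at_pullback:
  assumes "smooth_at A (fst z) f" "snd z \<in> TS (fst z)"
  shows "smooth_at TA z (\<lambda>z. f (fst z))"
proof -
  obtain U where "mopen U" "fst z \<in> U" "sfun U f" using assms by (auto simp: smooth_at_def)
  then show ?thesis using assms(2)
    by (intro T.smooth_atI[OF mopen_bundle] smooth_fun_pullback) (auto simp: tbundle_def)
qed

section \<open>Base and fibre coordinates on the tangent bundle\<close>

abbreviation fcrd :: "('a, 'e) chart \<Rightarrow> 'e \<Rightarrow> 'a \<times> 'a tvec \<Rightarrow> real" where
  "fcrd c i \<equiv> (\<lambda>z. snd z (crd c i))"
abbreviation bcrd :: "('a, 'e) chart \<Rightarrow> 'e \<Rightarrow> 'a \<times> 'a tvec \<Rightarrow> real" where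
  "bcrd c i \<equiv> (\<lambda>z. snd c (fst z) \<bullet> i)"

lemma tangent_crd_fibre: "i \<in> Basis \<Longrightarrow> T.crd (Tc c) (0, i) = fcrd c i"
  by (simp add: snd_tangent_chart chart_coords_inner fun_eq_iff)

lemma tangent_crd_base: "T.crd (Tc c) (i, 0) = bcrd c i"
  by (simp add: snd_tangent_chart fun_eq_iff)

lemma tangent_crd_cases:
  assumes "\<And>i. i \<in> Basis \<Longrightarrow> P (bcrd c i)" "\<And>i. i \<in> Basis \<Longrightarrow> P (fcrd c i)" "k \<in> Basis"
  shows "P (T.crd (Tc c) k)"
proof -
  consider i where "i \<in> Basis" "k = (i, 0)" | i where "i \<in> Basis" "k = (0, i)"
    using assms(3) by (auto simp: Basis_prod_def)
  then show ?thesis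
  proof cases
    case 1
    then show ?thesis using assms(1) tangent_crd_base by metis
  next
    case 2
    then show ?thesis using assms(2) tangent_crd_fibre by metis
  qed
qed

lemma smooth_fun_fcrd:
  assumes "c \<in> A" "i \<in> Basis" shows "T.sfun (tbundle (fst c)) (fcrd c i)"
  using T.smooth_fun_coord[OF tangent_chart_in_atlas[OF assms(1)], of "(0, i)"]
  unfolding tangent_crd_fibre[OF assms(2)] fst_tangent_chart .

lemma smooth_fun_bcrd: "c \<in> A \<Longrightarrow> T.sfun (tbundle (fst c)) (bcrd c i)"
  by (rule smooth_fun_pullback[OF mopen_chart smooth_fun_coord])

lemma bundle_tangent_eqI:
  assumes "c \<in> A" "z \<in> tbundle (fst c)" "v \<in> T.TS z" "w \<in> T.TS z"
    and "\<And>i. i \<in> Basis \<Longrightarrow> v (bcrd c i) = w (bcrd c i)" "\<And>i. i \<in> Basis \<Longrightarrow> v (fcrd c i) = w (fcrd c i)"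
  shows "v = w"
proof (rule T.tangent_eqI[OF tangent_chart_in_atlas[OF assms(1)] _ assms(3,4)])
  show "z \<in> fst (Tc c)" using assms(2) by (simp add: fst_tangent_chart)
  show "v (T.crd (Tc c) k) = w (T.crd (Tc c) k)" if "k \<in> Basis" for k
    by (rule tangent_crd_cases[where P = "\<lambda>f. v f = w f", OF assms(5,6) that])
qed

lemma bundle_vfI:
  assumes c: "c \<in> A" and V: "T.mopen V" "V \<subseteq> tbundle (fst c)" and X: "\<And>z. z \<in> V \<Longrightarrow> X z \<in> T.TS z"
    and "\<And>i. i \<in> Basis \<Longrightarrow> T.sfun V (\<lambda>z. X z (bcrd c i))"
    and "\<And>i. i \<in> Basis \<Longrightarrow> T.sfun V (\<lambda>z. X z (fcrd c i))"
  shows "T.vf V X"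
proof (rule T.vf_chartI[OF tangent_chart_in_atlas[OF c] V(1) _ X])
  show "V \<subseteq> fst (Tc c)" using V(2) by (simp add: fst_tangent_chart)
  show "T.sfun V (\<lambda>z. X z (T.crd (Tc c) k))" if "k \<in> Basis" for k
    by (rule tangent_crd_cases[where P = "\<lambda>f. T.sfun V (\<lambda>z. X z f)", OF assms(5,6) that])
qed

text \<open>x holds the base components and y the fibre components.\<close>

definition bundle_vec :: "('a, 'e) chart \<Rightarrow> 'a \<times> 'a tvec \<Rightarrow> 'e \<Rightarrow> 'e \<Rightarrow> ('a \<times> 'a tvec) tvec" where
  "bundle_vec c z x y = chart_vec TA (Tc c) z (x, y)"

context
  fixes c z
  assumes c: "c \<in> A" and z: "z \<in> tbundle (fst c)"
begin

private lemma cz: "fst z \<in> fst c" "snd z \<in> TS (fst z)" "z \<in> fst (Tc c)" "Tc c \<in> TA"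
  using c z by (auto simp: tbundle_def fst_tangent_chart tangent_chart_in_atlas)

lemma bundle_vec_tangent: "bundle_vec c z x y \<in> T.TS z"
  unfolding bundle_vec_def using T.chart_vec_in_tangent_space cz by blast

lemma bundle_vec_fcrd: "i \<in> Basis \<Longrightarrow> bundle_vec c z x y (fcrd c i) = y \<bullet> i"
  using T.chart_vec_coord[OF cz(4,3), of "(x, y)" "(0, i)"] by (simp add: tangent_crd_fibre bundle_vec_def)

lemma bundle_vec_pullback:
  assumes f: "smooth_at A (fst z) f"
  shows "bundle_vec c z x y (\<lambda>z. f (fst z)) = chart_vec A c (fst z) x f"
proof -
  let ?D = "frechet_derivative (f \<circ> chart_inv c) (at (snd c (fst z)))"
  let ?x = "snd (Tc c) z"
  have x: "fst ?x = snd c (fst z)" by (simp add: snd_tangent_chart)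
  have "((\<lambda>x. (f \<circ> chart_inv c) (fst x)) has_derivative (\<lambda>v. ?D (fst v))) (at ?x)"
    by (rule has_derivative_compose[OF bounded_linear_imp_has_derivative[OF bounded_linear_fst]])
      (unfold x, rule smooth_at_has_derivative[OF c cz(1) f])
  then have "(((\<lambda>z. f (fst z)) \<circ> chart_inv (Tc c)) has_derivative (\<lambda>v. ?D (fst v))) (at ?x)"
    by (rule has_derivative_transform_within_open[OF _ open_Times[OF chart_open[OF c] open_UNIV]])
      (use c cz in \<open>auto simp: tangent_chart_inv open_Times chart_open snd_tangent_chart\<close>)
  from T.chart_vec_eqI[OF cz(4,3) smooth_at_pullback[OF f cz(2)] this]
  show ?thesis using f by (simp add: bundle_vec_def chart_vec_def)
qed

text \<open>In the chart of TM the curve t -> u + t v is a straight line whose base coordinates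
  stand still.\<close>

lemma vertical_lift_eq:
  assumes v: "v \<in> TS (fst z)"
  shows "vertical_lift A z v = bundle_vec c z 0 (chart_coords c v)"
proof
  fix f
  show "vertical_lift A z v f = bundle_vec c z 0 (chart_coords c v) f"
  proof (cases "smooth_at TA z f")
    case True
    let ?x = "snd (Tc c) z" and ?v = "(0, chart_coords c v) :: 'e \<times> 'e"
    have eq: "f (fst z, \<lambda>h. snd z h + t * v h) = (f \<circ> chart_inv (Tc c)) (?x + t *\<^sub>R ?v)" for t
    proof -
      have "chart_vec A c (fst z) (chart_coords c (snd z) + t *\<^sub>R chart_coords c v) = (\<lambda>h. snd z h + t * v h)"
        using chart_vec_lincomb[OF c cz(1), of 1 "chart_coords c (snd z)" t "chart_coords c v"]
          chart_vec_chart_coords[OF c cz(1,2)] chart_vec_chart_coords[OF c cz(1) v] by auto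
      then show ?thesis using c cz by (simp add: snd_tangent_chart tangent_chart_inv chart_inv_left)
    qed
    have x0: "?x + 0 *\<^sub>R ?v = ?x" by (simp add: prod_eq_iff)
    have "((\<lambda>t. (f \<circ> chart_inv (Tc c)) (?x + t *\<^sub>R ?v)) has_real_derivative
        frechet_derivative (f \<circ> chart_inv (Tc c)) (at ?x) ?v) (at 0)"
      by (rule has_real_derivative_along_line, unfold x0, rule T.smooth_at_has_derivative[OF cz(4,3) True])
    from DERIV_imp_deriv[OF this] show ?thesis
      using True by (simp add: vertical_lift_def bundle_vec_def chart_vec_def eq)
  qed (simp add: vertical_lift_def bundle_vec_def chart_vec_def)
qed

end

text \<open>In another chart the image is a preimage under a transition map, which is
  continuous.\<close>

lemma mopen_chartI:
  assumes c: "c \<in> A" "W \<subseteq> fst c" "open (snd c ` W)"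
  shows "mopen W"
  unfolding mopen_iff
proof (intro conjI ballI)
  show "W \<subseteq> points A" using c by (auto simp: points_def)
  fix d assume d: "d \<in> A"
  let ?S = "snd d ` (fst d \<inter> fst c)"
  have "continuous_on ?S (snd c \<circ> chart_inv d)"
    using chart_transition[OF d c(1)] unfolding smooth_on_def by (metis Ck_on.simps(1))
  then have "open (?S \<inter> (snd c \<circ> chart_inv d) -` (snd c ` W))"
    using continuous_open_preimage chart_overlap_open[OF d c(1)] c(3) by blast
  moreover have "?S \<inter> (snd c \<circ> chart_inv d) -` (snd c ` W) = snd d ` (W \<inter> fst d)"
  proof
    show "?S \<inter> (snd c \<circ> chart_inv d) -` (snd c ` W) \<subseteq> snd d ` (W \<inter> fst d)"
    proof clarsimp
      fix p q assume p: "p \<in> fst d" "p \<in> fst c" and q: "q \<in> W" "snd c (chart_inv d (snd d p)) = snd c q"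
      then have "p = q" using c d chart_inj[OF c(1)] by (auto simp: chart_inv_left inj_on_def)
      then show "snd d p \<in> snd d ` (W \<inter> fst d)" using p q by blast
    qed
    show "snd d ` (W \<inter> fst d) \<subseteq> ?S \<inter> (snd c \<circ> chart_inv d) -` (snd c ` W)"
      using c d by (auto simp: chart_inv_left)
  qed
  ultimately show "open (snd d ` (W \<inter> fst d))" by simp
qed

text \<open>In charts the section is x -> (x, components of Y), so its derivative along v has base
  part v and fibre part the derivatives of these components. Most of the proof shows that F composed
  with the section is smooth at p: otherwise v would return its default value instead of a
  derivative.\<close>

lemma differential_section:
  assumes U: "mopen U" "p \<in> U" and Y: "vf U Y" and c: "c \<in> A" "p \<in> fst c"
    and v: "v \<in> TS p"
  shows "differential TA (\<lambda>q. (q, Y q)) p v =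
    bundle_vec c (p, Y p) (chart_coords c v) (\<Sum>i\<in>Basis. v (\<lambda>q. Y q (crd c i)) *\<^sub>R i)"
proof
  fix F
  let ?s = "\<lambda>q. (q, Y q)" and ?z = "(p, Y p)"
  let ?y = "\<Sum>i\<in>Basis. v (\<lambda>q. Y q (crd c i)) *\<^sub>R i"
  show "differential TA ?s p v F = bundle_vec c ?z (chart_coords c v) ?y F"
  proof (cases "smooth_at TA ?z F")
    case True
    let ?U = "U \<inter> fst c"
    have oU: "mopen ?U" "p \<in> ?U" using openin_Int[OF U(1) mopen_chart[OF c(1)]] U c by auto
    have z: "?z \<in> fst (Tc c)" using c vf_tangent[OF Y U(2)] by (simp add: fst_tangent_chart tbundle_def)
    have Tc: "Tc c \<in> TA" by (rule tangent_chart_in_atlas[OF c(1)])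
    obtain V where V: "T.mopen V" "?z \<in> V" "T.sfun V F" using True by (auto simp: smooth_at_def)
    \<comment> \<open>The section in coordinates.\<close>
    define a where "a x = (x, \<Sum>i\<in>Basis. ((\<lambda>q. Y q (crd c i)) \<circ> chart_inv c) x *\<^sub>R i)" for x :: 'e
    have Yi: "sfun ?U (\<lambda>q. Y q (crd c i))" for i
      by (rule vf_coord_smooth[OF vf_subset[OF Y] oU(1) c(1)]) auto
    have oS: "open (snd c ` ?U)" using mopen_imp_open[OF U(1) c(1)] .
    have aS: "a (snd c q) = snd (Tc c) (?s q)" if "q \<in> ?U" for q
      using that c by (simp add: a_def snd_tangent_chart chart_coords_def chart_inv_left)
    have a: "smooth_on (snd c ` ?U) a"
    proof (rule smooth_on_componentwise[OF oS])
      fix k :: "'e \<times> 'e" assume "k \<in> Basis"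
      then consider i where "i \<in> Basis" "k = (i, 0)" | i where "i \<in> Basis" "k = (0, i)"
        by (auto simp: Basis_prod_def)
      then show "smooth_on (snd c ` ?U) (\<lambda>x. a x \<bullet> k)"
      proof cases
        case 1
        then show ?thesis using smooth_on_linear[OF oS bounded_linear_inner_left[of i]] by (simp add: a_def)
      next
        case 2
        have "smooth_on (snd c ` ?U) ((\<lambda>q. Y q (crd c i)) \<circ> chart_inv c)"
          by (rule smooth_fun_chartD[OF Yi c(1)]) auto
        then show ?thesis using 2
          by (simp add: a_def o_def inner_sum_left inner_Basis if_distrib sum.delta cong: if_cong)
      qed
    qed
    let ?T = "snd (Tc c) ` (V \<inter> fst (Tc c))"
    have oT: "open ?T" using T.mopen_imp_open[OF V(1) Tc] .
    \<comment> \<open>The base points at which the section stays in the set V where F is smooth; an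
      open set, since a is continuous.\<close>
    define W where "W = {q \<in> ?U. ?s q \<in> V}"
    have W: "snd c ` W = snd c ` ?U \<inter> a -` ?T"
    proof
      show "snd c ` W \<subseteq> snd c ` ?U \<inter> a -` ?T"
      proof clarify
        fix q assume q: "q \<in> W"
        then have "?s q \<in> V \<inter> fst (Tc c)"
          using vf_tangent[OF Y] by (auto simp: W_def fst_tangent_chart tbundle_def)
        then show "snd c q \<in> snd c ` ?U \<inter> a -` ?T" using q aS[of q] by (auto simp: W_def)
      qed
      show "snd c ` ?U \<inter> a -` ?T \<subseteq> snd c ` W"
      proof
        fix x assume "x \<in> snd c ` ?U \<inter> a -` ?T"
        then obtain q z where x: "x = snd c q" and q: "q \<in> U" "q \<in> fst c"
          and z: "z \<in> V" "z \<in> fst (Tc c)" "a (snd c q) = snd (Tc c) z" by blast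
        have "?s q \<in> fst (Tc c)" using q vf_tangent[OF Y] by (auto simp: fst_tangent_chart tbundle_def)
        then have "?s q = z" using tangent_chart_inj[OF c(1)] z aS[of q] q by (auto simp: inj_on_def)
        then show "x \<in> snd c ` W" using x q z by (auto simp: W_def)
      qed
    qed
    have "continuous_on (snd c ` ?U) a" using a unfolding smooth_on_def by (metis Ck_on.simps(1))
    then have oW: "open (snd c ` W)" unfolding W by (rule continuous_open_preimage[OF _ oS oT])
    have mW: "mopen W" by (rule mopen_chartI[OF c(1) _ oW]) (auto simp: W_def)
    have pW: "p \<in> W" using oU V by (simp add: W_def)
    have Fa: "(F \<circ> chart_inv (Tc c)) (a (snd c q)) = F (?s q)" if "q \<in> ?U" for q
    proof -
      have "?s q \<in> fst (Tc c)" using that vf_tangent[OF Y] by (auto simp: fst_tangent_chart tbundle_def)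
      then show ?thesis using T.chart_inv_left[OF Tc] aS[OF that] by simp
    qed
    have "smooth_on (snd c ` W) (\<lambda>x. (F \<circ> chart_inv (Tc c)) (a x))"
    proof (rule smooth_on_compose[OF oW oT])
      show "a ` snd c ` W \<subseteq> ?T" using W by auto
      show "smooth_on (snd c ` W) a" by (rule smooth_on_subset[OF a]) (use W in auto)
      show "smooth_on ?T (F \<circ> chart_inv (Tc c))" using V(3) Tc by (simp add: smooth_fun_def)
    qed
    then have "smooth_on (snd c ` W) ((F \<circ> ?s) \<circ> chart_inv c)"
    proof (rule smooth_on_cong[OF oW, rotated])
      fix x assume "x \<in> snd c ` W"
      then obtain q where "q \<in> ?U" "x = snd c q" by (auto simp: W_def)
      then show "(F \<circ> chart_inv (Tc c)) (a x) = ((F \<circ> ?s) \<circ> chart_inv c) x"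
        using Fa[of q] c by (simp add: chart_inv_left)
    qed
    then have "sfun W (F \<circ> ?s)" by (intro smooth_fun_chartI[OF c(1) mW]) (auto simp: W_def)
    then have sm: "smooth_at A p (F \<circ> ?s)" using smooth_atI[OF mW pW] by blast
    define x where "x = chart_coords c v"
    have vx: "v = chart_vec A c p x" using chart_vec_chart_coords[OF c v] by (simp add: x_def)
    let ?Di = "\<lambda>i. frechet_derivative ((\<lambda>q. Y q (crd c i)) \<circ> chart_inv c) (at (snd c p))"
    have Yat: "smooth_at A p (\<lambda>q. Y q (crd c i))" for i using smooth_atI[OF oU Yi] .
    have a': "(a has_derivative (\<lambda>x. (x, \<Sum>i\<in>Basis. ?Di i x *\<^sub>R i))) (at (snd c p))"
      unfolding a_def
      by (intro has_derivative_Pair has_derivative_ident has_derivative_sum has_derivative_scaleR_left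
          smooth_at_has_derivative[OF c Yat])
    have ap: "a (snd c p) = snd (Tc c) ?z" using aS[OF oU(2)] .
    let ?DF = "frechet_derivative (F \<circ> chart_inv (Tc c)) (at (snd (Tc c) ?z))"
    have "((\<lambda>x. (F \<circ> chart_inv (Tc c)) (a x)) has_derivative (\<lambda>x. ?DF (x, \<Sum>i\<in>Basis. ?Di i x *\<^sub>R i))) (at (snd c p))"
      by (rule has_derivative_compose[OF a'], unfold ap, rule T.smooth_at_has_derivative[OF Tc z True])
    then have "(((F \<circ> ?s) \<circ> chart_inv c) has_derivative (\<lambda>x. ?DF (x, \<Sum>i\<in>Basis. ?Di i x *\<^sub>R i))) (at (snd c p))"
      by (rule has_derivative_transform_within_open[OF _ oS]) (use oU Fa c in \<open>auto simp: chart_inv_left\<close>)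
    from chart_vec_eqI[OF c sm this]
    have "v (F \<circ> ?s) = ?DF (x, \<Sum>i\<in>Basis. ?Di i x *\<^sub>R i)" by (simp add: vx)
    moreover have "?Di i x = v (\<lambda>q. Y q (crd c i))" for i
      using Yat[of i] by (simp add: vx chart_vec_def)
    ultimately show ?thesis using True by (simp add: differential_def bundle_vec_def chart_vec_def x_def)
  qed (simp add: differential_def bundle_vec_def chart_vec_def)
qed

section \<open>Horizontal lifts and the canonical Hermitian structure\<close>

lemma connection_sum:
  assumes D: "connection A D" and U: "mopen U" "p \<in> U" and X: "vf U X" and I: "finite I"
    and a: "\<And>i. i \<in> I \<Longrightarrow> sfun U (a i)" and Y: "\<And>i. i \<in> I \<Longrightarrow> vf U (Y i)"
  shows "D X (\<lambda>q f. \<Sum>i\<in>I. a i q * Y i q f) p f = (\<Sum>i\<in>I. X p (a i) * Y i p f + a i p * D X (Y i) p f)"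
  using I a Y
proof (induction I)
  case empty
  have "vf U (\<lambda>q f. 0)" using vf_sum[OF U(1), of "{}"] by simp
  from connection_leibniz[OF D U smooth_fun_const[OF U(1), of 0] X this, of f]
  show ?case by (simp add: vf_scale_def)
next
  case (insert i I)
  let ?Y = "\<lambda>q f. \<Sum>i\<in>I. a i q * Y i q f"
  have v: "vf U (vf_scale (a i) (Y i))" "vf U ?Y"
    using insert U by (auto intro!: vf_scale vf_sum)
  have "(\<lambda>q f. \<Sum>i\<in>insert i I. a i q * Y i q f) = vf_add (vf_scale (a i) (Y i)) ?Y"
    using insert.hyps by (simp add: vf_add_def vf_scale_def)
  then show ?case
    using connection_add_right[OF D U X v, of f] connection_leibniz[OF D U _ X, of "a i" "Y i" f] insert by simp
qed

abbreviation pd :: "('a, 'e) chart \<Rightarrow> 'e \<Rightarrow> 'a vfield" where "pd c k \<equiv> (\<lambda>q. chart_vec A c q k)"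

lemma pd_near: "c \<in> A \<Longrightarrow> p \<in> fst c \<Longrightarrow> vf_near p (pd c k)"
  using vf_nearI[OF mopen_chart _ vf_chart_vec] by blast

text \<open>The Leibniz rule for Y written in coordinate fields.\<close>

lemma connection_expand:
  assumes D: "connection A D" and c: "c \<in> A" "p \<in> fst c" and X: "vf_near p X" and Y: "vf_near p Y"
  shows "D X Y p f = (\<Sum>k\<in>Basis. X p (\<lambda>q. Y q (crd c k)) * pd c k p f + Y p (crd c k) * D X (pd c k) p f)"
proof -
  obtain U where U: "mopen U" "p \<in> U" "vf U X" "vf U Y"
    using vf_near_common[OF X Y] .
  let ?U = "U \<inter> fst c"
  have oU: "mopen ?U" "p \<in> ?U" using openin_Int[OF U(1) mopen_chart[OF c(1)]] U c by auto
  have vX: "vf ?U X" and vY: "vf ?U Y" using U vf_subset by auto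
  have a: "sfun ?U (\<lambda>q. Y q (crd c i))" for i
    using vf_coord_smooth[OF vY oU(1) c(1)] by simp
  have b: "vf ?U (pd c i)" for i
    using vf_subset[OF vf_chart_vec[OF c(1)]] by simp
  have vs: "vf ?U (\<lambda>q f. \<Sum>i\<in>Basis. Y q (crd c i) * pd c i q f)"
    by (intro vf_sum oU a b)
  have "D X Y p = D X (\<lambda>q f. \<Sum>i\<in>Basis. Y q (crd c i) * pd c i q f) p"
  proof (rule connection_cong[OF D oU vX vY vX vs])
    show "Y q = (\<lambda>f. \<Sum>i\<in>Basis. Y q (crd c i) * pd c i q f)" if "q \<in> ?U" for q
      by (rule ext, rule tangent_expand[OF c(1) _ vf_tangent[OF vY that]]) (use that in simp)
  qed simp
  then show ?thesis using connection_sum[OF D oU vX finite_Basis a b] by simp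
qed

end

context affine_riemannian
begin

interpretation T: charted TA by (rule charted_tangent)

abbreviation HL :: "'a \<times> 'a tvec \<Rightarrow> 'a tvec \<Rightarrow> ('a \<times> 'a tvec) tvec" where "HL \<equiv> horizontal_lift A nab"
abbreviation VL :: "'a \<times> 'a tvec \<Rightarrow> 'a tvec \<Rightarrow> ('a \<times> 'a tvec) tvec" where "VL \<equiv> vertical_lift A"
abbreviation G :: "'a \<times> 'a tvec \<Rightarrow> ('a \<times> 'a tvec) tvec \<Rightarrow> ('a \<times> 'a tvec) tvec \<Rightarrow> real" where
  "G \<equiv> canonical_metric A nab g"
abbreviation JJ :: "'a \<times> 'a tvec \<Rightarrow> ('a \<times> 'a tvec) tvec \<Rightarrow> ('a \<times> 'a tvec) tvec" where
  "JJ \<equiv> canonical_J A nab"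

lemma tangent_bundle_chart:
  assumes "w \<in> T.TS z"
  obtains c where "c \<in> A" "z \<in> tbundle (fst c)"
  using T.tangent_space_chart[OF assms] by (auto simp: tangent_atlas_def fst_tangent_chart)

text \<open>A section Y through u is parallel at p along X exactly if the derivatives of its
  components along X are the negative Christoffel terms of X and u, so its differential on X p does
  not depend on Y. This is uniqueness for the definite description; an explicit section gives
  existence.\<close>

lemma horizontal_lift_eq:
  assumes c: "c \<in> A" and z: "z \<in> tbundle (fst c)" and X: "vf_near (fst z) X"
  shows "HL z (X (fst z)) = bundle_vec c z (chart_coords c (X (fst z)))
    (\<Sum>i\<in>Basis. (- (\<Sum>k\<in>Basis. snd z (crd c k) * nab X (pd c k) (fst z) (crd c i))) *\<^sub>R i)"
    (is "_ = ?w")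
proof -
  define p u where "p = fst z" and "u = snd z"
  have zpu: "z = (p, u)" by (simp add: p_def u_def)
  have p: "p \<in> fst c" and u: "u \<in> TS p" using z by (auto simp: tbundle_def p_def u_def)
  note Xp = X[folded p_def]
  have Xt: "X p \<in> TS p" using vf_near_tangent[OF Xp] .
  define b where "b i = - (\<Sum>k\<in>Basis. u (crd c k) * nab X (pd c k) p (crd c i))" for i
  have w: "?w = bundle_vec c z (chart_coords c (X p)) (\<Sum>i\<in>Basis. b i *\<^sub>R i)"
    by (simp add: b_def p_def u_def)
  let ?P = "\<lambda>w. \<exists>U X' Y. mopen U \<and> p \<in> U \<and> vf U X' \<and> vf U Y \<and> X' p = X p \<and>
      Y p = u \<and> nab X' Y p = (\<lambda>f. 0) \<and> w = differential TA (\<lambda>q. (q, Y q)) p (X p)"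
  have unique: "w = ?w" if Pw: "?P w" for w
  proof -
    obtain U X' Y where U: "mopen U" "p \<in> U" and vf: "vf U X'" "vf U Y"
      and eq: "X' p = X p" "Y p = u" "nab X' Y p = (\<lambda>f. 0)" "w = differential TA (\<lambda>q. (q, Y q)) p (X p)"
      using Pw by blast
    note n = vf[THEN vf_nearI[OF U]]
    have "X p (\<lambda>q. Y q (crd c i)) = b i" if i: "i \<in> Basis" for i
    proof -
      \<comment> \<open>X' and X are only known to agree at p, which suffices by tensoriality in the
        direction.\<close>
      have nX: "nab X' (pd c k) p f = nab X (pd c k) p f" for k f
        by (rule tensorial_pointwise[OF connection_tensorial_left[OF nab pd_near[OF c p]] n(1) Xp eq(1)])
      have "0 = (\<Sum>k\<in>Basis. X' p (\<lambda>q. Y q (crd c k)) * pd c k p (crd c i) + Y p (crd c k) * nab X' (pd c k) p (crd c i))"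
        using connection_expand[OF nab c p n, of "crd c i"] eq(3) by simp
      also have "\<dots> = (\<Sum>k\<in>Basis. X p (\<lambda>q. Y q (crd c k)) * (k \<bullet> i)) + (\<Sum>k\<in>Basis. u (crd c k) * nab X (pd c k) p (crd c i))"
        unfolding eq(1,2) nX chart_vec_coord[OF c p] by (rule sum.distrib)
      also have "(\<Sum>k\<in>Basis. X p (\<lambda>q. Y q (crd c k)) * (k \<bullet> i)) = X p (\<lambda>q. Y q (crd c i))"
        using i by (simp add: inner_Basis if_distrib sum.delta cong: if_cong)
      finally show ?thesis by (simp add: b_def)
    qed
    then show ?thesis
      using differential_section[OF U vf(2) c p Xt] eq(2,4) w zpu by simp
  qed
  have "?P ?w"
  proof -
    define a where "a = chart_coords c (X p)"
    have Xa: "X p = chart_vec A c p a" using chart_vec_chart_coords[OF c p Xt] by (simp add: a_def)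
    obtain U where U: "mopen U" "p \<in> U" "vf U X" using Xp unfolding vf_near_def by blast
    let ?U = "U \<inter> fst c"
    have oU: "mopen ?U" "p \<in> ?U" using openin_Int[OF U(1) mopen_chart[OF c]] U p by auto
    have vX: "vf ?U X" using U vf_subset by auto
    (* Affine in the chart with derivative b along a; if a = 0 then b = 0, so the junk value of
       the division by a \<bullet> a is harmless. *)
    define y where "y i = (\<lambda>q. (u (crd c i) - b i * (snd c p \<bullet> a) / (a \<bullet> a)) + (b i / (a \<bullet> a)) * crd c a q)" for i
    define Y where "Y = (\<lambda>q f. \<Sum>i\<in>Basis. y i q * pd c i q f)"
    have cs: "sfun ?U (crd c a)" using smooth_fun_subset[OF smooth_fun_coord[OF c]] by simp
    have ys: "sfun ?U (y i)" for i unfolding y_def by (intro smooth_fun_intros oU cs)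
    have ps: "vf ?U (pd c i)" for i using vf_subset[OF vf_chart_vec[OF c]] by simp
    have Y: "vf ?U Y" unfolding Y_def by (intro vf_sum oU ys ps)
    have b0: "b i = 0" if "a = 0" for i
    proof -
      have "nab X (pd c k) p f = 0" for k f
        using tensorial_chart[OF connection_tensorial_left[OF nab pd_near[OF c p]] c p Xp, of k f] that
        by (simp add: Xa chart_vec_zero[OF c p])
      then show ?thesis by (simp add: b_def)
    qed
    have yp: "y i p = u (crd c i)" for i by (simp add: y_def)
    have Yp: "Y p = u" unfolding Y_def yp by (rule ext, rule tangent_expand[OF c p u, symmetric])
    have Xy: "X p (y i) = b i" for i
    proof -
      have s: "smooth_at A p (crd c a)" "smooth_at A p (\<lambda>q. k)" "smooth_at A p (\<lambda>q. k * crd c a q)" for k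
        using smooth_atI[OF oU] cs smooth_fun_const[OF oU(1)] smooth_fun_mult[OF oU(1) smooth_fun_const[OF oU(1)] cs]
        by auto
      have "X p (y i) = b i / (a \<bullet> a) * X p (crd c a)"
        unfolding y_def tangent_fun_add[OF Xt s(2,3)] tangent_fun_mult[OF Xt s(2,1)] tangent_fun_const[OF Xt] by simp
      also have "X p (crd c a) = a \<bullet> a" unfolding Xa by (rule chart_vec_coord[OF c p])
      finally show ?thesis using b0[of i] by auto
    qed
    have "nab X Y p f = 0" for f
    proof -
      have "nab X Y p f = (\<Sum>i\<in>Basis. X p (y i) * pd c i p f + y i p * nab X (pd c i) p f)"
        unfolding Y_def by (rule connection_sum[OF nab oU vX finite_Basis ys ps])
      also have "\<dots> = (\<Sum>i\<in>Basis. b i * pd c i p f) + (\<Sum>i\<in>Basis. u (crd c i) * nab X (pd c i) p f)"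
        unfolding Xy yp by (rule sum.distrib)
      also have "(\<Sum>i\<in>Basis. u (crd c i) * nab X (pd c i) p f)
          = (\<Sum>i\<in>Basis. \<Sum>k\<in>Basis. u (crd c i) * nab X (pd c i) p (crd c k) * pd c k p f)"
      proof (rule sum.cong[OF refl])
        fix i :: 'e
        have "nab X (pd c i) p \<in> TS p"
          using vf_near_tangent[OF connection_near[OF nab Xp pd_near[OF c p]]] .
        from tangent_expand[OF c p this, of f]
        show "u (crd c i) * nab X (pd c i) p f = (\<Sum>k\<in>Basis. u (crd c i) * nab X (pd c i) p (crd c k) * pd c k p f)"
          by (simp add: sum_distrib_left mult.assoc)
      qed
      also have "\<dots> = (\<Sum>k\<in>Basis. \<Sum>i\<in>Basis. u (crd c i) * nab X (pd c i) p (crd c k) * pd c k p f)"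
        by (rule sum.swap)
      also have "\<dots> = (\<Sum>k\<in>Basis. - b k * pd c k p f)"
        by (simp add: b_def sum_distrib_right)
      finally show ?thesis by (simp add: sum_negf)
    qed
    then have n0: "nab X Y p = (\<lambda>f. 0)" by blast
    \<comment> \<open>By uniqueness any admissible section has differential \<open>?w\<close>, so
      that of the explicit section is not computed again.\<close>
    have "?w = differential TA (\<lambda>q. (q, Y q)) p (X p)"
      by (rule unique[symmetric]) (use oU vX Y Yp n0 in blast)
    then show ?thesis using oU vX Y Yp n0 by blast
  qed
  then have "(THE w. ?P w) = ?w" using unique by (rule the_equality)
  then show ?thesis by (simp add: horizontal_lift_def p_def u_def)
qed

text \<open>Christoffel symbols: j is the direction, k the coordinate field that is differentiated,
  i the component.\<close>

definition chr :: "('a, 'e) chart \<Rightarrow> 'e \<Rightarrow> 'e \<Rightarrow> 'e \<Rightarrow> 'a \<Rightarrow> real" where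
  "chr c j k i q = nab (pd c j) (pd c k) q (crd c i)"

lemma chr_smooth: "c \<in> A \<Longrightarrow> sfun (fst c) (chr c j k i)"
  using vf_coord_smooth[OF connection_vf[OF nab mopen_chart vf_chart_vec vf_chart_vec] mopen_chart]
  unfolding chr_def by simp

text \<open>The components of the vertical part of w, that is, the connection map. The fibre
  components of the horizontal lift of the base part are subtracted; being negative Christoffel
  terms, they enter with a plus sign.\<close>

definition vcoord :: "('a, 'e) chart \<Rightarrow> 'a \<times> 'a tvec \<Rightarrow> ('a \<times> 'a tvec) tvec \<Rightarrow> 'e \<Rightarrow> real" where
  "vcoord c z w i =
    w (fcrd c i) + (\<Sum>k\<in>Basis. \<Sum>j\<in>Basis. snd z (crd c k) * (w (bcrd c j) * chr c j k i (fst z)))"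

section \<open>Horizontal and vertical parts of vectors on the tangent bundle\<close>

context
  fixes c z
  assumes c: "c \<in> A" and z: "z \<in> tbundle (fst c)"
begin

private lemma cz: "fst z \<in> fst c" "snd z \<in> TS (fst z)"
  using z by (auto simp: tbundle_def)

lemma VL_tangent: "v \<in> TS (fst z) \<Longrightarrow> VL z v \<in> T.TS z"
  unfolding vertical_lift_eq[OF c z] by (rule bundle_vec_tangent[OF c z])

lemma VL_fcrd: "v \<in> TS (fst z) \<Longrightarrow> i \<in> Basis \<Longrightarrow> VL z v (fcrd c i) = v (crd c i)"
  unfolding vertical_lift_eq[OF c z] by (simp add: bundle_vec_fcrd[OF c z] chart_coords_inner)

lemma VL_pullback:
  "v \<in> TS (fst z) \<Longrightarrow> smooth_at A (fst z) f \<Longrightarrow> VL z v (\<lambda>z. f (fst z)) = 0"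
  unfolding vertical_lift_eq[OF c z] by (simp add: bundle_vec_pullback[OF c z] chart_vec_zero[OF c cz(1)])

lemma HL_tangent:
  assumes v: "v \<in> TS (fst z)" shows "HL z v \<in> T.TS z"
proof -
  obtain X where X: "vf_near (fst z) X" "X (fst z) = v" using vf_extend[OF v] .
  have "HL z (X (fst z)) \<in> T.TS z"
    unfolding horizontal_lift_eq[OF c z X(1)] by (rule bundle_vec_tangent[OF c z])
  then show ?thesis using X(2) by simp
qed

text \<open>This form serves lifts of fields; the form with Christoffel symbols in
  \<open>HL_fcrd\<close> serves single vectors and shows linearity.\<close>

lemma HL_fcrd_vf:
  assumes "vf_near (fst z) X" "i \<in> Basis"
  shows "HL z (X (fst z)) (fcrd c i) = - (\<Sum>k\<in>Basis. snd z (crd c k) * nab X (pd c k) (fst z) (crd c i))"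
  unfolding horizontal_lift_eq[OF c z assms(1)] bundle_vec_fcrd[OF c z assms(2)]
  using assms(2) by (simp add: inner_diff_left inner_sum_left inner_Basis if_distrib sum.delta cong: if_cong)

lemma HL_fcrd:
  assumes v: "v \<in> TS (fst z)" and i: "i \<in> Basis"
  shows "HL z v (fcrd c i) = - (\<Sum>k\<in>Basis. \<Sum>j\<in>Basis. snd z (crd c k) * (v (crd c j) * chr c j k i (fst z)))"
proof -
  obtain X where X: "vf_near (fst z) X" "X (fst z) = v" using vf_extend[OF v] .
  have "nab X (pd c k) (fst z) (crd c i) = (\<Sum>j\<in>Basis. v (crd c j) * chr c j k i (fst z))" for k
    using tensorial_chart[OF connection_tensorial_left[OF nab pd_near[OF c cz(1)]] c cz(1) X(1)] X(2)
    by (simp add: chr_def)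
  then show ?thesis using HL_fcrd_vf[OF X(1) i] X(2) by (simp add: sum_distrib_left)
qed

lemma HL_pullback:
  assumes v: "v \<in> TS (fst z)" and f: "smooth_at A (fst z) f"
  shows "HL z v (\<lambda>z. f (fst z)) = v f"
proof -
  obtain X where X: "vf_near (fst z) X" "X (fst z) = v" using vf_extend[OF v] .
  show ?thesis
    using horizontal_lift_eq[OF c z X(1)] bundle_vec_pullback[OF c z f] X(2)
      chart_vec_chart_coords[OF c cz(1) v] by simp
qed

lemma HL_bcrd: "v \<in> TS (fst z) \<Longrightarrow> HL z v (bcrd c i) = v (crd c i)"
  by (rule HL_pullback[OF _ smooth_at_coord[OF c cz(1)]])

lemma VL_bcrd: "v \<in> TS (fst z) \<Longrightarrow> VL z v (bcrd c i) = 0"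
  by (rule VL_pullback[OF _ smooth_at_coord[OF c cz(1)]])

lemma HL_lincomb:
  assumes v: "v \<in> TS (fst z)" "w \<in> TS (fst z)"
  shows "HL z (\<lambda>f. a * v f + b * w f) = (\<lambda>F. a * HL z v F + b * HL z w F)"
proof (rule bundle_tangent_eqI[OF c z])
  note l = tangent_lincomb[OF v, of a b]
  show "HL z (\<lambda>f. a * v f + b * w f) \<in> T.TS z" by (rule HL_tangent[OF l])
  show "(\<lambda>F. a * HL z v F + b * HL z w F) \<in> T.TS z"
    by (intro T.tangent_lincomb HL_tangent v)
  show "HL z (\<lambda>f. a * v f + b * w f) (bcrd c i) = a * HL z v (bcrd c i) + b * HL z w (bcrd c i)" for i
    unfolding HL_bcrd[OF l] HL_bcrd[OF v(1)] HL_bcrd[OF v(2)] ..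
  show "HL z (\<lambda>f. a * v f + b * w f) (fcrd c i) = a * HL z v (fcrd c i) + b * HL z w (fcrd c i)"
    if i: "i \<in> Basis" for i
    unfolding HL_fcrd[OF l i] HL_fcrd[OF v(1) i] HL_fcrd[OF v(2) i]
    by (simp add: sum_distrib_left sum.distrib algebra_simps flip: sum_negf)
qed

lemma VL_lincomb:
  assumes v: "v \<in> TS (fst z)" "w \<in> TS (fst z)"
  shows "VL z (\<lambda>f. a * v f + b * w f) = (\<lambda>F. a * VL z v F + b * VL z w F)"
proof (rule bundle_tangent_eqI[OF c z])
  note l = tangent_lincomb[OF v, of a b]
  show "VL z (\<lambda>f. a * v f + b * w f) \<in> T.TS z" by (rule VL_tangent[OF l])
  show "(\<lambda>F. a * VL z v F + b * VL z w F) \<in> T.TS z"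
    by (intro T.tangent_lincomb VL_tangent v)
  show "VL z (\<lambda>f. a * v f + b * w f) (bcrd c i) = a * VL z v (bcrd c i) + b * VL z w (bcrd c i)" for i
    unfolding VL_bcrd[OF l] VL_bcrd[OF v(1)] VL_bcrd[OF v(2)] by simp
  show "VL z (\<lambda>f. a * v f + b * w f) (fcrd c i) = a * VL z v (fcrd c i) + b * VL z w (fcrd c i)"
    if i: "i \<in> Basis" for i
    unfolding VL_fcrd[OF l i] VL_fcrd[OF v(1) i] VL_fcrd[OF v(2) i] ..
qed

lemma HL_zero: "HL z (\<lambda>f. 0) = (\<lambda>F. 0)"
  using HL_lincomb[OF cz(2) cz(2), of 0 0] by simp

lemma VL_zero: "VL z (\<lambda>f. 0) = (\<lambda>F. 0)"
  using VL_lincomb[OF cz(2) cz(2), of 0 0] by simp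

text \<open>The splitting is triangular: base coordinates see only the horizontal part and fix x,
  after which fibre coordinates fix y.\<close>

lemma lift_parts_eq:
  assumes x: "x \<in> TS (fst z)" and y: "y \<in> TS (fst z)"
  shows "lift_parts A nab z (\<lambda>F. HL z x F + VL z y F) = (x, y)"
  unfolding lift_parts_def
proof (rule the_equality)
  show "fst (x, y) \<in> TS (fst z) \<and> snd (x, y) \<in> TS (fst z) \<and>
    (\<lambda>F. HL z x F + VL z y F) = (\<lambda>F. HL z (fst (x, y)) F + VL z (snd (x, y)) F)" using x y by simp
next
  fix xy assume xy: "fst xy \<in> TS (fst z) \<and> snd xy \<in> TS (fst z) \<and>
    (\<lambda>F. HL z x F + VL z y F) = (\<lambda>F. HL z (fst xy) F + VL z (snd xy) F)"
  then have eq: "HL z x F + VL z y F = HL z (fst xy) F + VL z (snd xy) F" for F by metis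
  have xy': "fst xy \<in> TS (fst z)" "snd xy \<in> TS (fst z)" using xy by auto
  have "x = fst xy"
    by (rule tangent_eqI[OF c cz(1) x xy'(1)])
      (use eq[of "bcrd c _"] HL_bcrd[OF x] HL_bcrd[OF xy'(1)] VL_bcrd[OF y] VL_bcrd[OF xy'(2)] in simp)
  moreover have "y = snd xy"
  proof (rule tangent_eqI[OF c cz(1) y xy'(2)])
    fix i :: 'e assume i: "i \<in> Basis"
    show "y (crd c i) = snd xy (crd c i)"
      using eq[of "fcrd c i"] VL_fcrd[OF y i] VL_fcrd[OF xy'(2) i] \<open>x = fst xy\<close> by simp
  qed
  ultimately show "xy = (x, y)" by simp
qed

lemma lift_decomposition:
  assumes w: "w \<in> T.TS z"
  defines "x \<equiv> (\<lambda>f. \<Sum>i\<in>Basis. w (bcrd c i) * pd c i (fst z) f)"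
    and "y \<equiv> (\<lambda>f. \<Sum>i\<in>Basis. vcoord c z w i * pd c i (fst z) f)"
  shows "x \<in> TS (fst z)" "y \<in> TS (fst z)"
    "w = (\<lambda>F. HL z x F + VL z y F)" "lift_parts A nab z w = (x, y)"
proof -
  note pt = chart_vec_in_tangent_space[OF c cz(1)]
  show x: "x \<in> TS (fst z)" unfolding x_def by (rule tangent_sum[OF c cz(1) pt])
  show y: "y \<in> TS (fst z)" unfolding y_def by (rule tangent_sum[OF c cz(1) pt])
  have xi: "x (crd c i) = w (bcrd c i)" if "i \<in> Basis" for i
    using that unfolding x_def chart_vec_coord[OF c cz(1)]
    by (simp add: inner_Basis if_distrib sum.delta cong: if_cong)
  have yi: "y (crd c i) = vcoord c z w i" if "i \<in> Basis" for i
    using that unfolding y_def chart_vec_coord[OF c cz(1)]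
    by (simp add: inner_Basis if_distrib sum.delta cong: if_cong)
  show eq: "w = (\<lambda>F. HL z x F + VL z y F)"
  proof (rule bundle_tangent_eqI[OF c z w])
    show "(\<lambda>F. HL z x F + VL z y F) \<in> T.TS z"
      by (intro T.tangent_add HL_tangent VL_tangent x y)
    show "w (bcrd c i) = HL z x (bcrd c i) + VL z y (bcrd c i)" if "i \<in> Basis" for i
      using xi[OF that] HL_bcrd[OF x] VL_bcrd[OF y] by simp
    show "w (fcrd c i) = HL z x (fcrd c i) + VL z y (fcrd c i)" if i: "i \<in> Basis" for i
      unfolding HL_fcrd[OF x i] VL_fcrd[OF y i] yi[OF i] vcoord_def using xi by simp
  qed
  show "lift_parts A nab z w = (x, y)" by (subst eq) (rule lift_parts_eq[OF x y])
qed

lemma bundle_tangentE: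
  assumes "w \<in> T.TS z"
  obtains x y where "x \<in> TS (fst z)" "y \<in> TS (fst z)"
    "w = (\<lambda>F. HL z x F + VL z y F)"
  using lift_decomposition[OF assms] that by blast

lemma G_eq:
  assumes "x \<in> TS (fst z)" "y \<in> TS (fst z)"
    "x' \<in> TS (fst z)" "y' \<in> TS (fst z)"
  shows "G z (\<lambda>F. HL z x F + VL z y F) (\<lambda>F. HL z x' F + VL z y' F) = g (fst z) x x' + g (fst z) y y'"
  by (simp add: canonical_metric_def lift_parts_eq assms)

lemma JJ_eq:
  assumes "x \<in> TS (fst z)" "y \<in> TS (fst z)"
  shows "JJ z (\<lambda>F. HL z x F + VL z y F) = (\<lambda>F. VL z x F - HL z y F)"
  by (simp add: canonical_J_def lift_parts_eq assms)

lemma JJ_tangent: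
  assumes w: "w \<in> T.TS z" shows "JJ z w \<in> T.TS z"
proof -
  obtain x y where x: "x \<in> TS (fst z)" "y \<in> TS (fst z)" "w = (\<lambda>F. HL z x F + VL z y F)"
    using bundle_tangentE[OF w] .
  show ?thesis unfolding x(3) JJ_eq[OF x(1,2)] by (intro T.tangent_diff HL_tangent VL_tangent x)
qed

lemma JJ_lincomb:
  assumes v: "v \<in> T.TS z" and w: "w \<in> T.TS z"
  shows "JJ z (\<lambda>F. a * v F + b * w F) = (\<lambda>F. a * JJ z v F + b * JJ z w F)"
proof -
  obtain x y where x: "x \<in> TS (fst z)" "y \<in> TS (fst z)" "v = (\<lambda>F. HL z x F + VL z y F)"
    using bundle_tangentE[OF v] .
  obtain x' y' where x': "x' \<in> TS (fst z)" "y' \<in> TS (fst z)" "w = (\<lambda>F. HL z x' F + VL z y' F)"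
    using bundle_tangentE[OF w] .
  have "(\<lambda>F. a * v F + b * w F) = (\<lambda>F. HL z (\<lambda>f. a * x f + b * x' f) F + VL z (\<lambda>f. a * y f + b * y' f) F)"
    unfolding HL_lincomb[OF x(1) x'(1)] VL_lincomb[OF x(2) x'(2)] x(3) x'(3) by (simp add: algebra_simps)
  then have "JJ z (\<lambda>F. a * v F + b * w F) = (\<lambda>F. (a * VL z x F + b * VL z x' F) - (a * HL z y F + b * HL z y' F))"
    by (simp only: JJ_eq[OF tangent_lincomb[OF x(1) x'(1)] tangent_lincomb[OF x(2) x'(2)]]
        VL_lincomb[OF x(1) x'(1)] HL_lincomb[OF x(2) x'(2)])
  then show ?thesis unfolding x(3) x'(3) JJ_eq[OF x(1,2)] JJ_eq[OF x'(1,2)] by (simp add: algebra_simps)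
qed

lemma G_lincomb:
  assumes v: "v \<in> T.TS z" and w: "w \<in> T.TS z" and t: "t \<in> T.TS z"
  shows "G z (\<lambda>F. a * v F + b * w F) t = a * G z v t + b * G z w t"
proof -
  obtain x y where x: "x \<in> TS (fst z)" "y \<in> TS (fst z)" "v = (\<lambda>F. HL z x F + VL z y F)"
    using bundle_tangentE[OF v] .
  obtain x' y' where x': "x' \<in> TS (fst z)" "y' \<in> TS (fst z)" "w = (\<lambda>F. HL z x' F + VL z y' F)"
    using bundle_tangentE[OF w] .
  obtain x'' y'' where x'': "x'' \<in> TS (fst z)" "y'' \<in> TS (fst z)" "t = (\<lambda>F. HL z x'' F + VL z y'' F)"
    using bundle_tangentE[OF t] .
  have "(\<lambda>F. a * v F + b * w F) = (\<lambda>F. HL z (\<lambda>f. a * x f + b * x' f) F + VL z (\<lambda>f. a * y f + b * y' f) F)"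
    unfolding HL_lincomb[OF x(1) x'(1)] VL_lincomb[OF x(2) x'(2)] x(3) x'(3) by (simp add: algebra_simps)
  then show ?thesis
    unfolding x(3) x'(3) x''(3)
    by (simp add: G_eq x x' x'' tangent_lincomb metric_lincomb_left) (simp add: algebra_simps)
qed

lemma G_sym:
  assumes v: "v \<in> T.TS z" and w: "w \<in> T.TS z"
  shows "G z v w = G z w v"
proof -
  obtain x y where x: "x \<in> TS (fst z)" "y \<in> TS (fst z)" "v = (\<lambda>F. HL z x F + VL z y F)"
    using bundle_tangentE[OF v] .
  obtain x' y' where x': "x' \<in> TS (fst z)" "y' \<in> TS (fst z)" "w = (\<lambda>F. HL z x' F + VL z y' F)"
    using bundle_tangentE[OF w] .
  show ?thesis unfolding x(3) x'(3) G_eq[OF x(1,2) x'(1,2)] G_eq[OF x'(1,2) x(1,2)]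
    metric_sym[OF x(1) x'(1)] metric_sym[OF x(2) x'(2)] ..
qed

lemma G_pos:
  assumes v: "v \<in> T.TS z" and "v \<noteq> (\<lambda>F. 0)"
  shows "G z v v > 0"
proof -
  obtain x y where x: "x \<in> TS (fst z)" "y \<in> TS (fst z)" "v = (\<lambda>F. HL z x F + VL z y F)"
    using bundle_tangentE[OF v] .
  have "x \<noteq> (\<lambda>f. 0) \<or> y \<noteq> (\<lambda>f. 0)" using assms(2) x(3) HL_zero VL_zero by auto
  moreover have "g (fst z) u u \<ge> 0" if "u \<in> TS (fst z)" for u
    using metric_pos[OF that] metric_zero_left[OF that] by fastforce
  ultimately have "g (fst z) x x + g (fst z) y y > 0"
    using metric_pos x(1,2) by (metis add_nonneg_pos add_pos_nonneg)
  then show ?thesis unfolding x(3) G_eq[OF x(1,2) x(1,2)] .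
qed

end

text \<open>In a chart the two parts of a smooth field have smooth components, namely its base
  components and \<open>vcoord\<close>, and the coefficients of g are pulled back from the
  base.\<close>

lemma canonical_metric_smooth:
  assumes V: "T.mopen V" and W: "T.vf V W" and W': "T.vf V W'"
  shows "T.sfun V (\<lambda>z. G z (W z) (W' z))"
proof (rule T.smooth_fun_local)
  fix z assume z: "z \<in> V"
  obtain c where c: "c \<in> A" "z \<in> tbundle (fst c)" using tangent_bundle_chart[OF T.vf_tangent[OF W z]] .
  let ?V = "V \<inter> tbundle (fst c)"
  have oV: "T.mopen ?V" "z \<in> ?V" using openin_Int[OF V mopen_bundle_chart[OF c(1)]] z c by auto
  have sub: "?V \<subseteq> tbundle (fst c)" by auto
  note vf = T.vf_subset[OF W, of ?V, simplified] T.vf_subset[OF W', of ?V, simplified]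
  have b: "T.sfun ?V (\<lambda>z. X z (bcrd c i))" and f: "i \<in> Basis \<Longrightarrow> T.sfun ?V (\<lambda>z. X z (fcrd c i))"
    if "T.vf ?V X" for X i
    using T.vf_smooth[OF that oV(1) T.smooth_fun_subset[OF smooth_fun_bcrd[OF c(1)] sub]]
      T.vf_smooth[OF that oV(1) T.smooth_fun_subset[OF smooth_fun_fcrd[OF c(1)] sub]] by auto
  have u: "T.sfun ?V (fcrd c k)" if "k \<in> Basis" for k
    by (rule T.smooth_fun_subset[OF smooth_fun_fcrd[OF c(1) that] sub])
  have pb: "T.sfun ?V (\<lambda>z. h (fst z))" if "sfun (fst c) h" for h
    by (rule T.smooth_fun_subset[OF smooth_fun_pullback[OF mopen_chart[OF c(1)] that] sub])
  have vc: "T.sfun ?V (\<lambda>z. vcoord c z (X z) i)" if X: "T.vf ?V X" and i: "i \<in> Basis" for X i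
    unfolding vcoord_def
    by (intro T.smooth_fun_add T.smooth_fun_sum T.smooth_fun_mult oV b[OF X] f[OF X i] u pb chr_smooth c)
  let ?g = "\<lambda>i j z. g (fst z) (pd c i (fst z)) (pd c j (fst z))"
  have gs: "T.sfun ?V (?g i j)" for i j
    by (rule pb[OF metric_smooth[OF mopen_chart[OF c(1)] vf_chart_vec[OF c(1)] vf_chart_vec[OF c(1)]]])
  have "T.sfun ?V (\<lambda>z. (\<Sum>i\<in>Basis. W z (bcrd c i) * (\<Sum>j\<in>Basis. W' z (bcrd c j) * ?g i j z))
      + (\<Sum>i\<in>Basis. vcoord c z (W z) i * (\<Sum>j\<in>Basis. vcoord c z (W' z) j * ?g i j z)))"
    by (intro T.smooth_fun_add T.smooth_fun_sum T.smooth_fun_mult oV b vc vf gs)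
  then have "T.sfun ?V (\<lambda>z. G z (W z) (W' z))"
  proof (rule T.smooth_fun_cong[OF oV(1), rotated])
    fix z assume z: "z \<in> ?V"
    then have zc: "z \<in> tbundle (fst c)" "fst z \<in> fst c" by (auto simp: tbundle_def)
    note d = lift_decomposition[OF c(1) zc(1) T.vf_tangent[OF vf(1) z]]
      and d' = lift_decomposition[OF c(1) zc(1) T.vf_tangent[OF vf(2) z]]
    note pt = chart_vec_in_tangent_space[OF c(1) zc(2)]
    have e: "g (fst z) (\<lambda>f. \<Sum>i\<in>Basis. a i * pd c i (fst z) f) (\<lambda>f. \<Sum>i\<in>Basis. b i * pd c i (fst z) f)
        = (\<Sum>i\<in>Basis. a i * (\<Sum>j\<in>Basis. b j * ?g i j z))" for a b
      unfolding metric_sum_left[OF tangent_sum[OF c(1) zc(2) pt] pt] metric_sum_right[OF pt pt] ..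
    show "(\<Sum>i\<in>Basis. W z (bcrd c i) * (\<Sum>j\<in>Basis. W' z (bcrd c j) * ?g i j z))
      + (\<Sum>i\<in>Basis. vcoord c z (W z) i * (\<Sum>j\<in>Basis. vcoord c z (W' z) j * ?g i j z)) = G z (W z) (W' z)"
      unfolding canonical_metric_def d(4) d'(4) by (simp add: e)
  qed
  then show "\<exists>W''. T.mopen W'' \<and> z \<in> W'' \<and> T.sfun W'' (\<lambda>z. G z (W z) (W' z))" using oV by blast
qed

text \<open>From here the general results on Riemannian metrics, including existence of the
  Levi-Civita connection, apply to TM as well.\<close>

lemma riemannian_tangent: "riemannian TA G"
proof
  show "riemannian_metric TA G"
    unfolding riemannian_metric_def
  proof (intro conjI ballI allI impI)
    fix z assume "z \<in> points TA"
    then obtain c where c: "c \<in> A" "z \<in> tbundle (fst c)"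
      by (auto simp: points_def tangent_atlas_def fst_tangent_chart)
    show "G z u v = G z v u" if "u \<in> T.TS z" "v \<in> T.TS z" for u v
      by (rule G_sym[OF c that])
    show "G z (\<lambda>f. a * u f + b * v f) w = a * G z u w + b * G z v w"
      if "u \<in> T.TS z" "v \<in> T.TS z" "w \<in> T.TS z" for u v w a b
      by (rule G_lincomb[OF c that])
    show "0 < G z u u" if "u \<in> T.TS z" "u \<noteq> (\<lambda>f. 0)" for u
      by (rule G_pos[OF c that])
  qed (rule canonical_metric_smooth)
qed

text \<open>\<open>JJ\<close> exchanges base components and \<open>vcoord\<close> up to sign;
  Christoffel terms lead back to chart components, and all of these are smooth.\<close>

lemma canonical_J_vf:
  assumes V: "T.mopen V" and W: "T.vf V W"
  shows "T.vf V (\<lambda>z. JJ z (W z))"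
proof (rule T.vf_local)
  fix z assume z: "z \<in> V"
  obtain c where c: "c \<in> A" "z \<in> tbundle (fst c)" using tangent_bundle_chart[OF T.vf_tangent[OF W z]] .
  let ?V = "V \<inter> tbundle (fst c)"
  have oV: "T.mopen ?V" "z \<in> ?V" using openin_Int[OF V mopen_bundle_chart[OF c(1)]] z c by auto
  have sub: "?V \<subseteq> tbundle (fst c)" by auto
  note vf = T.vf_subset[OF W, of ?V, simplified]
  have b: "T.sfun ?V (\<lambda>z. W z (bcrd c i))" for i
    using T.vf_smooth[OF vf oV(1) T.smooth_fun_subset[OF smooth_fun_bcrd[OF c(1)] sub]] .
  have f: "T.sfun ?V (\<lambda>z. W z (fcrd c i))" if "i \<in> Basis" for i
    using T.vf_smooth[OF vf oV(1) T.smooth_fun_subset[OF smooth_fun_fcrd[OF c(1) that] sub]] .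
  have u: "T.sfun ?V (fcrd c k)" if "k \<in> Basis" for k
    by (rule T.smooth_fun_subset[OF smooth_fun_fcrd[OF c(1) that] sub])
  have pb: "T.sfun ?V (\<lambda>z. h (fst z))" if "sfun (fst c) h" for h
    by (rule T.smooth_fun_subset[OF smooth_fun_pullback[OF mopen_chart[OF c(1)] that] sub])
  have vc: "T.sfun ?V (\<lambda>z. vcoord c z (W z) i)" if i: "i \<in> Basis" for i
    unfolding vcoord_def
    by (intro T.smooth_fun_add T.smooth_fun_sum T.smooth_fun_mult oV b f[OF i] u pb chr_smooth c)
  have "T.vf ?V (\<lambda>z. JJ z (W z))"
  proof (rule bundle_vfI[OF c(1) oV(1) sub])
    show "JJ z (W z) \<in> T.TS z" if "z \<in> ?V" for z
      using JJ_tangent[OF c(1) _ T.vf_tangent[OF vf that]] that by auto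
    fix i :: 'e assume i: "i \<in> Basis"
    have J: "JJ z (W z) (bcrd c i) = - 1 * vcoord c z (W z) i"
      "JJ z (W z) (fcrd c i) = W z (bcrd c i) +
        (\<Sum>k\<in>Basis. \<Sum>j\<in>Basis. snd z (crd c k) * (vcoord c z (W z) j * chr c j k i (fst z)))" if z: "z \<in> ?V" for z
    proof -
      have zc: "z \<in> tbundle (fst c)" "fst z \<in> fst c" using z by (auto simp: tbundle_def)
      note d = lift_decomposition[OF c(1) zc(1) T.vf_tangent[OF vf z]]
      have co: "(\<Sum>k\<in>Basis. a k * pd c k (fst z) (crd c j)) = a j" if "j \<in> Basis" for a j
        unfolding chart_vec_coord[OF c(1) zc(2)] using that
        by (simp add: inner_Basis if_distrib sum.delta cong: if_cong)
      have JW: "JJ z (W z) = (\<lambda>F. VL z (\<lambda>f. \<Sum>i\<in>Basis. W z (bcrd c i) * pd c i (fst z) f) F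
          - HL z (\<lambda>f. \<Sum>i\<in>Basis. vcoord c z (W z) i * pd c i (fst z) f) F)"
        unfolding canonical_J_def d(4) by simp
      show "JJ z (W z) (bcrd c i) = - 1 * vcoord c z (W z) i"
        unfolding JW VL_bcrd[OF c(1) zc(1) d(1)] HL_bcrd[OF c(1) zc(1) d(2)] using co[OF i] by simp
      show "JJ z (W z) (fcrd c i) = W z (bcrd c i) +
        (\<Sum>k\<in>Basis. \<Sum>j\<in>Basis. snd z (crd c k) * (vcoord c z (W z) j * chr c j k i (fst z)))"
        unfolding JW VL_fcrd[OF c(1) zc(1) d(1) i] HL_fcrd[OF c(1) zc(1) d(2) i] using co i by simp
    qed
    have "T.sfun ?V (\<lambda>z. - 1 * vcoord c z (W z) i)"
      by (intro T.smooth_fun_mult T.smooth_fun_const oV vc i)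
    then show "T.sfun ?V (\<lambda>z. JJ z (W z) (bcrd c i))"
      by (rule T.smooth_fun_cong[OF oV(1), rotated]) (use J in simp)
    have "T.sfun ?V (\<lambda>z. W z (bcrd c i) +
        (\<Sum>k\<in>Basis. \<Sum>j\<in>Basis. snd z (crd c k) * (vcoord c z (W z) j * chr c j k i (fst z))))"
      by (intro T.smooth_fun_add T.smooth_fun_sum T.smooth_fun_mult oV b vc u pb chr_smooth c)
    then show "T.sfun ?V (\<lambda>z. JJ z (W z) (fcrd c i))"
      by (rule T.smooth_fun_cong[OF oV(1), rotated]) (use J in simp)
  qed
  then show "\<exists>V. T.mopen V \<and> z \<in> V \<and> T.vf V (\<lambda>z. JJ z (W z))" using oV by blast
qed

end

section \<open>The Lee form of the canonical Hermitian structure\<close>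

context affine_riemannian
begin

interpretation T: riemannian TA G by (rule riemannian_tangent)

abbreviation hX :: "'a vfield \<Rightarrow> ('a \<times> 'a tvec) vfield" where "hX X \<equiv> (\<lambda>z. HL z (X (fst z)))"
abbreviation vX :: "'a vfield \<Rightarrow> ('a \<times> 'a tvec) vfield" where "vX X \<equiv> (\<lambda>z. VL z (X (fst z)))"

text \<open>In a chart the components of lifts are pulled back from the base, except for the fibre
  components of \<open>hX X\<close>, which are linear in the fibre coordinates.\<close>

lemma lift_vf:
  assumes U: "mopen U" and X: "vf U X"
  shows "T.vf (tbundle U) (hX X)" "T.vf (tbundle U) (vX X)"
proof -
  have "\<exists>V. T.mopen V \<and> z \<in> V \<and> T.vf V (hX X) \<and> T.vf V (vX X)" if z: "z \<in> tbundle U" for z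
  proof -
    have "fst z \<in> U" using z by (auto simp: tbundle_def)
    then obtain c where c: "c \<in> A" "fst z \<in> fst c" using mopen_imp_chart[OF U] by blast
    let ?U = "U \<inter> fst c" and ?V = "tbundle (U \<inter> fst c)"
    have oU: "mopen ?U" using openin_Int[OF U mopen_chart[OF c(1)]] .
    have oV: "T.mopen ?V" "z \<in> ?V" using mopen_bundle[OF oU] z c by (auto simp: tbundle_def)
    have sub: "?V \<subseteq> tbundle (fst c)" by (auto simp: tbundle_def)
    have X': "vf ?U X" using X vf_subset by blast
    have b: "T.sfun ?V (\<lambda>z. X (fst z) (crd c i))" for i
      by (rule smooth_fun_pullback[OF oU vf_coord_smooth[OF X' oU c(1)]]) auto
    have n: "T.sfun ?V (\<lambda>z. nab X (pd c k) (fst z) (crd c i))" for k i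
    proof -
      have p: "vf ?U (pd c k)" using vf_subset[OF vf_chart_vec[OF c(1)]] by simp
      show ?thesis
        by (rule smooth_fun_pullback[OF oU vf_coord_smooth[OF connection_vf[OF nab oU X' p] oU c(1)]]) auto
    qed
    have u: "T.sfun ?V (fcrd c k)" if "k \<in> Basis" for k
      by (rule T.smooth_fun_subset[OF smooth_fun_fcrd[OF c(1) that] sub])
    have t: "X (fst y) \<in> TS (fst y)" "vf_near (fst y) X" "y \<in> tbundle (fst c)" if "y \<in> ?V" for y
      using that vf_tangent[OF X'] vf_nearI[OF oU _ X'] by (auto simp: tbundle_def)
    have "T.vf ?V (hX X)"
    proof (rule bundle_vfI[OF c(1) oV(1) sub])
      show "HL y (X (fst y)) \<in> T.TS y" if "y \<in> ?V" for y
        by (rule HL_tangent[OF c(1) t(3)[OF that] t(1)[OF that]])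
      fix i :: 'e assume i: "i \<in> Basis"
      show "T.sfun ?V (\<lambda>y. HL y (X (fst y)) (bcrd c i))"
        by (rule T.smooth_fun_cong[OF oV(1) _ b[of i]]) (use HL_bcrd[OF c(1) t(3) t(1)] in simp)
      have "T.sfun ?V (\<lambda>y. 0 - (\<Sum>k\<in>Basis. fcrd c k y * nab X (pd c k) (fst y) (crd c i)))"
        by (intro T.smooth_fun_diff T.smooth_fun_const T.smooth_fun_sum T.smooth_fun_mult oV u n)
      then show "T.sfun ?V (\<lambda>y. HL y (X (fst y)) (fcrd c i))"
        by (rule T.smooth_fun_cong[OF oV(1), rotated]) (use HL_fcrd_vf[OF c(1) t(3) t(2) i] in simp)
    qed
    moreover have "T.vf ?V (vX X)"
    proof (rule bundle_vfI[OF c(1) oV(1) sub])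
      show "VL y (X (fst y)) \<in> T.TS y" if "y \<in> ?V" for y
        by (rule VL_tangent[OF c(1) t(3)[OF that] t(1)[OF that]])
      fix i :: 'e assume i: "i \<in> Basis"
      show "T.sfun ?V (\<lambda>y. VL y (X (fst y)) (bcrd c i))"
        by (rule T.smooth_fun_cong[OF oV(1) _ T.smooth_fun_const[OF oV(1), of 0]])
          (use VL_bcrd[OF c(1) t(3) t(1)] in simp)
      show "T.sfun ?V (\<lambda>y. VL y (X (fst y)) (fcrd c i))"
        by (rule T.smooth_fun_cong[OF oV(1) _ b[of i]]) (use VL_fcrd[OF c(1) t(3) t(1) i] in simp)
    qed
    ultimately show ?thesis using oV by blast
  qed
  note local = this
  show "T.vf (tbundle U) (hX X)" by (rule T.vf_local) (use local in blast)
  show "T.vf (tbundle U) (vX X)" by (rule T.vf_local) (use local in blast)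
qed

lemma lift_near:
  assumes "vf_near (fst z) X" "snd z \<in> TS (fst z)"
  shows "T.vf_near z (hX X)" "T.vf_near z (vX X)"
proof -
  obtain U where U: "mopen U" "fst z \<in> U" "vf U X" using assms(1) unfolding vf_near_def by blast
  then have "T.mopen (tbundle U)" "z \<in> tbundle U" using mopen_bundle assms(2) by (auto simp: tbundle_def)
  then show "T.vf_near z (hX X)" "T.vf_near z (vX X)" using lift_vf[OF U(1,3)] T.vf_nearI by blast+
qed

section \<open>Inner products, complex structure and brackets of lifts\<close>

context
  fixes c z
  assumes c: "c \<in> A" and z: "z \<in> tbundle (fst c)"
begin

private lemma pz: "fst z \<in> fst c" "snd z \<in> TS (fst z)"
  using z by (auto simp: tbundle_def)

private lemmas H_tangent = HL_tangent[OF c z]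
private lemmas V_tangent = VL_tangent[OF c z]

lemma zero_tangent: "(\<lambda>f. 0) \<in> TS (fst z)"
  by (rule tangent_zero[OF c pz(1)])

lemma G_HH: "x \<in> TS (fst z) \<Longrightarrow> y \<in> TS (fst z) \<Longrightarrow> G z (HL z x) (HL z y) = g (fst z) x y"
  using G_eq[OF c z, of x "\<lambda>f. 0" y "\<lambda>f. 0"] zero_tangent VL_zero[OF c z] metric_zero_left[OF zero_tangent] by simp

lemma G_VV: "x \<in> TS (fst z) \<Longrightarrow> y \<in> TS (fst z) \<Longrightarrow> G z (VL z x) (VL z y) = g (fst z) x y"
  using G_eq[OF c z, of "\<lambda>f. 0" x "\<lambda>f. 0" y] zero_tangent HL_zero[OF c z] metric_zero_left[OF zero_tangent] by simp

lemma G_HV: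
  assumes "x \<in> TS (fst z)" "y \<in> TS (fst z)"
  shows "G z (HL z x) (VL z y) = 0" "G z (VL z y) (HL z x) = 0"
proof -
  show "G z (HL z x) (VL z y) = 0"
    using G_eq[OF c z, of x "\<lambda>f. 0" "\<lambda>f. 0" y] assms zero_tangent HL_zero[OF c z] VL_zero[OF c z]
      metric_zero_left[OF assms(2)] metric_zero_left[OF assms(1)] metric_sym[OF assms(1) zero_tangent] by simp
  then show "G z (VL z y) (HL z x) = 0" using T.metric_sym H_tangent V_tangent assms by metis
qed

lemma JJ_H: "x \<in> TS (fst z) \<Longrightarrow> JJ z (HL z x) = VL z x"
  using JJ_eq[OF c z, of x "\<lambda>f. 0"] zero_tangent HL_zero[OF c z] VL_zero[OF c z] by simp

lemma JJ_V: "y \<in> TS (fst z) \<Longrightarrow> JJ z (VL z y) = (\<lambda>F. - HL z y F)"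
  using JJ_eq[OF c z, of "\<lambda>f. 0" y] zero_tangent HL_zero[OF c z] VL_zero[OF c z] by simp

text \<open>The test vectors are values of lifted fields, because brackets and covariant derivatives
  are computed for those.\<close>

lemma bundle_metric_eqI:
  assumes v: "v \<in> T.TS z" and w: "w \<in> T.TS z"
    and H: "\<And>Z. vf_near (fst z) Z \<Longrightarrow> G z v (HL z (Z (fst z))) = G z w (HL z (Z (fst z)))"
    and V: "\<And>Z. vf_near (fst z) Z \<Longrightarrow> G z v (VL z (Z (fst z))) = G z w (VL z (Z (fst z)))"
  shows "v = w"
proof (rule T.metric_eqI[OF v w])
  fix t assume "t \<in> T.TS z"
  then obtain x y where x: "x \<in> TS (fst z)" "y \<in> TS (fst z)"
    and t: "t = (\<lambda>F. HL z x F + VL z y F)" by (rule bundle_tangentE[OF c z])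
  obtain X where X: "vf_near (fst z) X" "X (fst z) = x" using vf_extend[OF x(1)] .
  obtain Y where Y: "vf_near (fst z) Y" "Y (fst z) = y" using vf_extend[OF x(2)] .
  show "G z v t = G z w t"
    unfolding t T.metric_add_right[OF H_tangent[OF x(1)] V_tangent[OF x(2)] v]
      T.metric_add_right[OF H_tangent[OF x(1)] V_tangent[OF x(2)] w]
    using H[OF X(1)] V[OF Y(1)] X(2) Y(2) by simp
qed

private lemma smooth_bcrd: "smooth_at TA z (bcrd c i)"
  by (rule T.smooth_atI[OF mopen_bundle_chart[OF c] z smooth_fun_bcrd[OF c]])

private lemma smooth_fcrd: "i \<in> Basis \<Longrightarrow> smooth_at TA z (fcrd c i)"
  by (rule T.smooth_atI[OF mopen_bundle_chart[OF c] z smooth_fun_fcrd[OF c]])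

context
  fixes X
  assumes X: "vf_near (fst z) X"
begin

private lemma vf_chart_domain:
  obtains U where "mopen U" "fst z \<in> U" "vf U X" "U \<subseteq> fst c"
    "T.mopen (tbundle U)" "z \<in> tbundle U"
proof -
  obtain V where V: "mopen V" "fst z \<in> V" "vf V X" using X unfolding vf_near_def by blast
  have U: "mopen (V \<inter> fst c)" using openin_Int[OF V(1) mopen_chart[OF c]] .
  show thesis
    by (rule that[OF U _ vf_subset[OF V(3)] _ mopen_bundle[OF U]]) (use V(2) pz in \<open>auto simp: tbundle_def\<close>)
qed

lemma smooth_at_vf_coord: "smooth_at A (fst z) (\<lambda>q. X q (crd c i))"
proof -
  obtain U where U: "mopen U" "fst z \<in> U" "vf U X" "U \<subseteq> fst c" using vf_chart_domain .
  then show ?thesis using smooth_atI[OF U(1,2) vf_coord_smooth[OF U(3,1) c U(4)]] by blast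
qed

text \<open>Coordinate derivatives that occur in brackets of lifts. The components concerned are
  constant along the fibres, so their vertical derivatives vanish.\<close>

lemma HL_vf_bcrd: "HL z v (\<lambda>y. HL y (X (fst y)) (bcrd c i)) = v (\<lambda>q. X q (crd c i))"
  "HL z v (\<lambda>y. VL y (X (fst y)) (fcrd c i)) = v (\<lambda>q. X q (crd c i))"
  "VL z v (\<lambda>y. HL y (X (fst y)) (bcrd c i)) = 0"
  "VL z v (\<lambda>y. VL y (X (fst y)) (fcrd c i)) = 0"
  "HL z v (\<lambda>y. VL y (X (fst y)) (bcrd c i)) = 0"
  "VL z v (\<lambda>y. VL y (X (fst y)) (bcrd c i)) = 0"
  if v: "v \<in> TS (fst z)" and i: "i \<in> Basis"
proof -
  obtain U where U: "mopen U" "fst z \<in> U" "vf U X" "U \<subseteq> fst c" "T.mopen (tbundle U)" "z \<in> tbundle U"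
    using vf_chart_domain .
  have t: "y \<in> tbundle (fst c)" "X (fst y) \<in> TS (fst y)" if "y \<in> tbundle U" for y
    using that U vf_tangent[OF U(3)] by (auto simp: tbundle_def)
  note s = smooth_at_vf_coord[of i]
  have e: "w (\<lambda>y. HL y (X (fst y)) (bcrd c i)) = w (\<lambda>y. X (fst y) (crd c i))"
      "w (\<lambda>y. VL y (X (fst y)) (fcrd c i)) = w (\<lambda>y. X (fst y) (crd c i))"
      "w (\<lambda>y. VL y (X (fst y)) (bcrd c i)) = 0"
    if w: "w \<in> T.TS z" for w
  proof -
    show "w (\<lambda>y. HL y (X (fst y)) (bcrd c i)) = w (\<lambda>y. X (fst y) (crd c i))"
      by (rule T.tangent_cong[OF w U(5,6)]) (rule HL_bcrd[OF c t])
    show "w (\<lambda>y. VL y (X (fst y)) (fcrd c i)) = w (\<lambda>y. X (fst y) (crd c i))"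
      by (rule T.tangent_cong[OF w U(5,6)]) (rule VL_fcrd[OF c t i])
    have "w (\<lambda>y. VL y (X (fst y)) (bcrd c i)) = w (\<lambda>y. 0)"
      by (rule T.tangent_cong[OF w U(5,6)]) (rule VL_bcrd[OF c t])
    then show "w (\<lambda>y. VL y (X (fst y)) (bcrd c i)) = 0" using T.tangent_fun_const[OF w] by simp
  qed
  note h = e[OF H_tangent[OF v]] and w = e[OF V_tangent[OF v]]
  show "HL z v (\<lambda>y. HL y (X (fst y)) (bcrd c i)) = v (\<lambda>q. X q (crd c i))"
    using h(1) HL_pullback[OF c z v s] by simp
  show "HL z v (\<lambda>y. VL y (X (fst y)) (fcrd c i)) = v (\<lambda>q. X q (crd c i))"
    using h(2) HL_pullback[OF c z v s] by simp
  show "VL z v (\<lambda>y. HL y (X (fst y)) (bcrd c i)) = 0" using w(1) VL_pullback[OF c z v s] by simp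
  show "VL z v (\<lambda>y. VL y (X (fst y)) (fcrd c i)) = 0" using w(2) VL_pullback[OF c z v s] by simp
  show "HL z v (\<lambda>y. VL y (X (fst y)) (bcrd c i)) = 0" by (rule h(3))
  show "VL z v (\<lambda>y. VL y (X (fst y)) (bcrd c i)) = 0" by (rule w(3))
qed

text \<open>The fibre components of a horizontal lift are linear in the point of the fibre, so the
  derivative along v puts v in its place.\<close>

lemma VL_HL_fcrd:
  assumes v: "v \<in> TS (fst z)" and i: "i \<in> Basis"
  shows "VL z v (\<lambda>y. HL y (X (fst y)) (fcrd c i)) = - (\<Sum>k\<in>Basis. v (crd c k) * nab X (pd c k) (fst z) (crd c i))"
proof -
  obtain U where U: "mopen U" "fst z \<in> U" "vf U X" "U \<subseteq> fst c" "T.mopen (tbundle U)" "z \<in> tbundle U"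
    using vf_chart_domain .
  have t: "y \<in> tbundle (fst c)" "vf_near (fst y) X" if "y \<in> tbundle U" for y
    using that U vf_nearI[OF U(1) _ U(3)] by (auto simp: tbundle_def)
  note w = V_tangent[OF v]
  let ?n = "\<lambda>k q. nab X (pd c k) q (crd c i)"
  have n: "sfun U (?n k)" for k
    by (rule vf_coord_smooth[OF connection_vf[OF nab U(1,3) vf_subset[OF vf_chart_vec[OF c] U(4)]] U(1) c U(4)])
  have n': "T.sfun (tbundle U) (\<lambda>y. ?n k (fst y))" for k by (rule smooth_fun_pullback[OF U(1) n])
  have u: "T.sfun (tbundle U) (fcrd c k)" if "k \<in> Basis" for k
    by (rule T.smooth_fun_subset[OF smooth_fun_fcrd[OF c that] bundle_mono[OF U(4)]])
  have m: "T.sfun (tbundle U) (\<lambda>y. fcrd c k y * ?n k (fst y))" if "k \<in> Basis" for k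
    by (rule T.smooth_fun_mult[OF U(5) u[OF that] n'])
  have "VL z v (\<lambda>y. HL y (X (fst y)) (fcrd c i)) = VL z v (\<lambda>y. (- 1) * (\<Sum>k\<in>Basis. fcrd c k y * ?n k (fst y)))"
    by (rule T.tangent_cong[OF w U(5,6)]) (use HL_fcrd_vf[OF c t i] in simp)
  also have "\<dots> = (- 1) * VL z v (\<lambda>y. \<Sum>k\<in>Basis. fcrd c k y * ?n k (fst y))"
    using T.tangent_fun_mult[OF w T.smooth_atI[OF U(5,6) T.smooth_fun_const[OF U(5), of "- 1"]]
        T.smooth_atI[OF U(5,6) T.smooth_fun_sum[OF U(5) m]]] T.tangent_fun_const[OF w] by simp
  also have "VL z v (\<lambda>y. \<Sum>k\<in>Basis. fcrd c k y * ?n k (fst y)) = (\<Sum>k\<in>Basis. VL z v (\<lambda>y. fcrd c k y * ?n k (fst y)))"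
    by (rule T.tangent_fun_sum[OF w U(5,6) m])
  also have "\<dots> = (\<Sum>k\<in>Basis. v (crd c k) * ?n k (fst z))"
  proof (rule sum.cong[OF refl])
    fix k :: 'e assume k: "k \<in> Basis"
    show "VL z v (\<lambda>y. fcrd c k y * ?n k (fst y)) = v (crd c k) * ?n k (fst z)"
      using T.tangent_fun_mult[OF w smooth_fcrd[OF k] T.smooth_atI[OF U(5,6) n'[of k]]]
        VL_fcrd[OF c z v k] VL_pullback[OF c z v smooth_atI[OF U(1,2) n[of k]]] by simp
  qed
  finally show ?thesis by simp
qed

end

context
  fixes X Y
  assumes X: "vf_near (fst z) X" and Y: "vf_near (fst z) Y"
begin

private lemmas Xt = vf_near_tangent[OF X]
private lemmas Yt = vf_near_tangent[OF Y]
private lemmas nX = lift_near[OF X pz(2)]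
private lemmas nY = lift_near[OF Y pz(2)]

text \<open>The base components of the bracket come from M. Its vertical part, where curvature would
  appear, is orthogonal to horizontal vectors.\<close>

lemma bracket_hh:
  assumes w: "w \<in> TS (fst z)"
  shows "G z (lie_bracket TA (hX X) (hX Y) z) (HL z w) = g (fst z) (lie_bracket A X Y (fst z)) w"
proof -
  let ?b = "lie_bracket TA (hX X) (hX Y) z"
  have b: "?b \<in> T.TS z" by (rule T.lie_bracket_near_tangent[OF nX(1) nY(1)])
  obtain x y where x: "x \<in> TS (fst z)" "y \<in> TS (fst z)"
    and eq: "?b = (\<lambda>F. HL z x F + VL z y F)" using bundle_tangentE[OF c z b] .
  have "x = lie_bracket A X Y (fst z)"
  proof (rule tangent_eqI[OF c pz(1) x(1) lie_bracket_near_tangent[OF X Y]])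
    fix i :: 'e assume i: "i \<in> Basis"
    have "x (crd c i) = ?b (bcrd c i)"
      unfolding eq HL_bcrd[OF c z x(1)] VL_bcrd[OF c z x(2)] by simp
    also have "\<dots> = lie_bracket A X Y (fst z) (crd c i)"
      using HL_vf_bcrd(1)[OF Y Xt i] HL_vf_bcrd(1)[OF X Yt i] smooth_bcrd smooth_at_coord[OF c pz(1)]
      by (simp add: lie_bracket_def)
    finally show "x (crd c i) = lie_bracket A X Y (fst z) (crd c i)" .
  qed
  then show ?thesis
    unfolding eq T.metric_add_left[OF H_tangent[OF x(1)] V_tangent[OF x(2)] H_tangent[OF w]]
    using G_HH[OF x(1) w] G_HV[OF w x(2)] by simp
qed

text \<open>The components of \<nabla>_Y X are assembled from two sources: the horizontal derivative
  of the components of X gives Y(X^i), and the vertical derivative of the horizontal field gives the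
  Christoffel terms.\<close>

lemma bracket_vh: "lie_bracket TA (vX X) (hX Y) z = (\<lambda>F. - VL z (nab Y X (fst z)) F)"
proof (rule bundle_tangent_eqI[OF c z])
  have nt: "nab Y X (fst z) \<in> TS (fst z)"
    by (rule vf_near_tangent[OF connection_near[OF nab Y X]])
  show "lie_bracket TA (vX X) (hX Y) z \<in> T.TS z"
    by (rule T.lie_bracket_near_tangent[OF nX(2) nY(1)])
  show "(\<lambda>F. - VL z (nab Y X (fst z)) F) \<in> T.TS z"
    using T.tangent_scale[OF V_tangent[OF nt], of "-1"] by simp
  fix i :: 'e assume i: "i \<in> Basis"
  show "lie_bracket TA (vX X) (hX Y) z (bcrd c i) = - VL z (nab Y X (fst z)) (bcrd c i)"
    using HL_vf_bcrd(3)[OF Y Xt i] HL_vf_bcrd(5)[OF X Yt i] smooth_bcrd VL_bcrd[OF c z nt]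
    by (simp add: lie_bracket_def)
  have "nab Y X (fst z) (crd c i) = (\<Sum>k\<in>Basis. Y (fst z) (\<lambda>q. X q (crd c k)) * (k \<bullet> i))
      + (\<Sum>k\<in>Basis. X (fst z) (crd c k) * nab Y (pd c k) (fst z) (crd c i))"
    unfolding connection_expand[OF nab c pz(1) Y X, of "crd c i"] chart_vec_coord[OF c pz(1)] by (rule sum.distrib)
  also have "(\<Sum>k\<in>Basis. Y (fst z) (\<lambda>q. X q (crd c k)) * (k \<bullet> i)) = Y (fst z) (\<lambda>q. X q (crd c i))"
    using i by (simp add: inner_Basis if_distrib sum.delta cong: if_cong)
  finally show "lie_bracket TA (vX X) (hX Y) z (fcrd c i) = - VL z (nab Y X (fst z)) (fcrd c i)"
    using VL_HL_fcrd[OF Y Xt i] HL_vf_bcrd(2)[OF X Yt i] smooth_fcrd[OF i] VL_fcrd[OF c z nt i]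
    by (simp add: lie_bracket_def)
qed

lemma bracket_vv: "lie_bracket TA (vX X) (vX Y) z = (\<lambda>F. 0)"
proof (rule bundle_tangent_eqI[OF c z])
  show "lie_bracket TA (vX X) (vX Y) z \<in> T.TS z"
    by (rule T.lie_bracket_near_tangent[OF nX(2) nY(2)])
  show "(\<lambda>F. 0) \<in> T.TS z" using V_tangent[OF zero_tangent] VL_zero[OF c z] by simp
  fix i :: 'e assume i: "i \<in> Basis"
  show "lie_bracket TA (vX X) (vX Y) z (bcrd c i) = 0"
    using HL_vf_bcrd(6)[OF Y Xt i] HL_vf_bcrd(6)[OF X Yt i] by (simp add: lie_bracket_def)
  show "lie_bracket TA (vX X) (vX Y) z (fcrd c i) = 0"
    using HL_vf_bcrd(4)[OF Y Xt i] HL_vf_bcrd(4)[OF X Yt i] by (simp add: lie_bracket_def)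
qed

end

lemma bracket_hv:
  "vf_near (fst z) X \<Longrightarrow> vf_near (fst z) Y \<Longrightarrow> lie_bracket TA (hX X) (vX Y) z = VL z (nab X Y (fst z))"
  unfolding T.lie_bracket_antisym[of "hX X" "vX Y"] by (simp add: bracket_vh)

end

text \<open>Inner products of lifts are pulled back from M or vanish, and this on a neighbourhood of
  z, so that derivatives inherit it.\<close>

lemma derivative_G_lift:
  assumes c: "c \<in> A" and z: "z \<in> tbundle (fst c)" and X: "vf_near (fst z) X" and Y: "vf_near (fst z) Y"
    and w: "w \<in> T.TS z"
  shows "w (\<lambda>y. G y (HL y (X (fst y))) (HL y (Y (fst y)))) = w (\<lambda>y. g (fst y) (X (fst y)) (Y (fst y)))"
    "w (\<lambda>y. G y (VL y (X (fst y))) (VL y (Y (fst y)))) = w (\<lambda>y. g (fst y) (X (fst y)) (Y (fst y)))"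
    "w (\<lambda>y. G y (HL y (X (fst y))) (VL y (Y (fst y)))) = 0"
    "w (\<lambda>y. G y (VL y (X (fst y))) (HL y (Y (fst y)))) = 0"
    "smooth_at A (fst z) (\<lambda>q. g q (X q) (Y q))"
proof -
  obtain U where U: "mopen U" "fst z \<in> U" "vf U X" "vf U Y"
    using vf_near_common[OF X Y] .
  show "smooth_at A (fst z) (\<lambda>q. g q (X q) (Y q))" by (rule smooth_at_metric[OF U])
  let ?V = "tbundle (U \<inter> fst c)"
  have V: "T.mopen ?V" "z \<in> ?V"
    using mopen_bundle[OF openin_Int[OF U(1) mopen_chart[OF c]]] U z by (auto simp: tbundle_def)
  have t: "y \<in> tbundle (fst c)" "X (fst y) \<in> TS (fst y)" "Y (fst y) \<in> TS (fst y)"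
    if "y \<in> ?V" for y
    using that vf_tangent[OF U(3)] vf_tangent[OF U(4)] by (auto simp: tbundle_def)
  show "w (\<lambda>y. G y (HL y (X (fst y))) (HL y (Y (fst y)))) = w (\<lambda>y. g (fst y) (X (fst y)) (Y (fst y)))"
    by (rule T.tangent_cong[OF w V]) (rule G_HH[OF c t])
  show "w (\<lambda>y. G y (VL y (X (fst y))) (VL y (Y (fst y)))) = w (\<lambda>y. g (fst y) (X (fst y)) (Y (fst y)))"
    by (rule T.tangent_cong[OF w V]) (rule G_VV[OF c t])
  have "w (\<lambda>y. G y (HL y (X (fst y))) (VL y (Y (fst y)))) = w (\<lambda>y. 0)"
    by (rule T.tangent_cong[OF w V]) (rule G_HV(1)[OF c t])
  then show "w (\<lambda>y. G y (HL y (X (fst y))) (VL y (Y (fst y)))) = 0" using T.tangent_fun_const[OF w] by simp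
  have "w (\<lambda>y. G y (VL y (X (fst y))) (HL y (Y (fst y)))) = w (\<lambda>y. 0)"
    by (rule T.tangent_cong[OF w V]) (rule G_HV(2)[OF c t(1,3,2)])
  then show "w (\<lambda>y. G y (VL y (X (fst y))) (HL y (Y (fst y)))) = 0" using T.tangent_fun_const[OF w] by simp
qed

text \<open>A basis vector of the product has exactly one nonzero half; a zero second half marks the
  horizontal fields.\<close>

definition lifted_frame :: "('e \<Rightarrow> 'a vfield) \<Rightarrow> 'e \<times> 'e \<Rightarrow> ('a \<times> 'a tvec) vfield" where
  "lifted_frame E k = (if snd k = 0 then hX (E (fst k)) else vX (E (snd k)))"

section \<open>Levi-Civita derivatives of the lifted frame\<close>

context
  fixes c E
  assumes c: "c \<in> A" and E: "onf (fst c) E"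
begin

private lemmas U = mopen_chart[OF c]
private lemmas TU = mopen_bundle_chart[OF c]

lemma lifted_frame_onf: "T.onf (tbundle (fst c)) (lifted_frame E)"
  unfolding orthonormal_frame_on_def
proof (intro conjI ballI)
  fix k :: "'e \<times> 'e" assume "k \<in> Basis"
  then show "T.vf (tbundle (fst c)) (lifted_frame E k)"
    using lift_vf[OF U onf_vf[OF E]] by (auto simp: Basis_prod_def lifted_frame_def)
next
  fix z k l assume z: "z \<in> tbundle (fst c)" and k: "k \<in> (Basis :: ('e \<times> 'e) set)" and l: "l \<in> (Basis :: ('e \<times> 'e) set)"
  have p: "fst z \<in> fst c" using z by (simp add: tbundle_def)
  note t = onf_tangent[OF E _ p] and o = onf_inner[OF E _ _ p]
  show "G z (lifted_frame E k z) (lifted_frame E l z) = (if k = l then 1 else 0)"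
    using k l by (auto simp: Basis_prod_def lifted_frame_def G_HH[OF c z] G_VV[OF c z] G_HV[OF c z] t o split: if_split_asm)
qed

context
  fixes z
  assumes z: "z \<in> tbundle (fst c)"
begin

private lemma p: "fst z \<in> fst c" and u: "snd z \<in> TS (fst z)"
  using z by (auto simp: tbundle_def)

private lemmas En = onf_near[OF E _ U p]
private lemmas Et = onf_tangent[OF E _ p]
private lemmas n = lift_near[OF _ u]
private lemmas Ht = HL_tangent[OF c z]
private lemmas Vt = VL_tangent[OF c z]

private lemma unit: "X = E i \<Longrightarrow> i \<in> Basis \<Longrightarrow> vf_near (fst z) Z \<Longrightarrow> g (fst z) (LC Z X (fst z)) (X (fst z)) = 0"
  using LC_unit[OF U p onf_vf[OF E], of i 1 Z] onf_inner[OF E] by simp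

private lemma unit_H:
  assumes i: "i \<in> Basis" and Z: "T.vf_near z Z"
  shows "G z (T.LC Z (hX (E i)) z) (HL z (E i (fst z))) = 0"
proof (rule T.LC_unit[OF TU z lift_vf(1)[OF U onf_vf[OF E i]] _ Z, of 1])
  fix y assume y: "y \<in> tbundle (fst c)"
  then have "fst y \<in> fst c" by (simp add: tbundle_def)
  then show "G y (HL y (E i (fst y))) (HL y (E i (fst y))) = 1"
    using G_HH[OF c y] onf_tangent[OF E i] onf_inner[OF E i i] by simp
qed

private lemma unit_V:
  assumes i: "i \<in> Basis" and Z: "T.vf_near z Z"
  shows "G z (T.LC Z (vX (E i)) z) (VL z (E i (fst z))) = 0"
proof (rule T.LC_unit[OF TU z lift_vf(2)[OF U onf_vf[OF E i]] _ Z, of 1])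
  fix y assume y: "y \<in> tbundle (fst c)"
  then have "fst y \<in> fst c" by (simp add: tbundle_def)
  then show "G y (VL y (E i (fst y))) (VL y (E i (fst y))) = 1"
    using G_VV[OF c y] onf_tangent[OF E i] onf_inner[OF E i i] by simp
qed

text \<open>The other term of the torsion identity, g(D_Z E_i, E_i), vanishes because E_i has unit
  length.\<close>

lemma LC_frame_torsion:
  assumes i: "i \<in> Basis" and Z: "vf_near (fst z) Z"
  shows "g (fst z) (LC (E i) Z (fst z)) (E i (fst z)) = g (fst z) (lie_bracket A (E i) Z (fst z)) (E i (fst z))"
  using LC_torsion[OF En[OF i] Z Et[OF i]] unit[OF refl i Z] by simp

text \<open>The same reduction on TM turns the left side into a bracket of horizontal lifts, whose
  horizontal part comes from M.\<close>

lemma LC_HH: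
  assumes i: "i \<in> Basis" and Z: "vf_near (fst z) Z"
  shows "G z (T.LC (hX (E i)) (hX Z) z) (HL z (E i (fst z))) = g (fst z) (LC (E i) Z (fst z)) (E i (fst z))"
  using T.LC_torsion[OF n(1)[OF En[OF i]] n(1)[OF Z] Ht[OF Et[OF i]]] unit_H[OF i n(1)[OF Z]]
    bracket_hh[OF c z En[OF i] Z Et[OF i]] LC_frame_torsion[OF i Z] by simp

text \<open>Metric compatibility moves the derivative onto the test field. Against
  \<open>hX Z\<close> this is the computation on M, by \<open>LC_HH\<close>; against
  \<open>vX Z\<close> the remaining bracket is vertical and pairs to 0 with
  \<open>hX (E i)\<close>.\<close>

lemma LC_HE:
  assumes i: "i \<in> Basis"
  shows "T.LC (hX (E i)) (hX (E i)) z = HL z (LC (E i) (E i) (fst z))"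
proof (rule bundle_metric_eqI[OF c z])
  note e = En[OF i] and et = Et[OF i]
  note he = n(1)[OF e] and L = LC_tangent[OF e e]
  show "T.LC (hX (E i)) (hX (E i)) z \<in> T.TS z" by (rule T.LC_tangent[OF he he])
  show "HL z (LC (E i) (E i) (fst z)) \<in> T.TS z" by (rule Ht[OF L])
  fix Z assume Z: "vf_near (fst z) Z"
  note Zt = vf_near_tangent[OF Z]
  note D = derivative_G_lift[OF c z e Z Ht[OF et]]
  have "G z (HL z (E i (fst z))) (T.LC (hX (E i)) (hX Z) z) = g (fst z) (E i (fst z)) (LC (E i) Z (fst z))"
    using LC_HH[OF i Z] T.metric_sym[OF Ht[OF et] T.LC_tangent[OF he n(1)[OF Z]]] metric_sym[OF et LC_tangent[OF e Z]]
    by simp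
  then show "G z (T.LC (hX (E i)) (hX (E i)) z) (HL z (Z (fst z))) = G z (HL z (LC (E i) (E i) (fst z))) (HL z (Z (fst z)))"
    using T.LC_metric[OF he he n(1)[OF Z]] LC_metric[OF e e Z] D(1) HL_pullback[OF c z et D(5)] G_HH[OF c z L Zt] by simp
  have "G z (T.LC (hX (E i)) (vX Z) z) (HL z (E i (fst z))) = 0"
    using T.LC_torsion[OF he n(2)[OF Z] Ht[OF et]] unit_H[OF i n(2)[OF Z]] bracket_hv[OF c z e Z]
      G_HV(2)[OF c z et vf_near_tangent[OF connection_near[OF nab e Z]]] by simp
  then show "G z (T.LC (hX (E i)) (hX (E i)) z) (VL z (Z (fst z))) = G z (HL z (LC (E i) (E i) (fst z))) (VL z (Z (fst z)))"
    using T.LC_metric[OF he he n(2)[OF Z]] D(3) G_HV(1)[OF c z L Zt]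
      T.metric_sym[OF Ht[OF et] T.LC_tangent[OF he n(2)[OF Z]]] by simp
qed

text \<open>Against \<open>hX Z\<close>, metric compatibility and the unit length of E leave minus
  the pairing of the bracket of \<open>vX E\<close> and \<open>hX Z\<close> with
  \<open>vX E\<close>, which is g(\<nabla>_Z E, E). As g(D_Z E, E) = 0, this is - g(\<gamma>_Z E,
  E), and symmetry of \<gamma> makes it - g(E, \<gamma>_E Z), where the adjoint appears. Against
  \<open>vX Z\<close> both sides vanish.\<close>

lemma LC_VE:
  assumes i: "i \<in> Basis"
  shows "T.LC (vX (E i)) (vX (E i)) z = (\<lambda>F. - HL z (gam_adj (E i) (E i) (fst z)) F)"
proof (rule bundle_metric_eqI[OF c z])
  note e = En[OF i] and et = Et[OF i]
  note ve = n(2)[OF e] and L = gam_adj(1)[OF e e]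
  show "T.LC (vX (E i)) (vX (E i)) z \<in> T.TS z" by (rule T.LC_tangent[OF ve ve])
  show "(\<lambda>F. - HL z (gam_adj (E i) (E i) (fst z)) F) \<in> T.TS z"
    using T.tangent_scale[OF Ht[OF L], of "-1"] by simp
  fix Z assume Z: "vf_near (fst z) Z"
  note Zt = vf_near_tangent[OF Z]
  note D = derivative_G_lift[OF c z e Z Vt[OF et]]
  have nt: "nab Z (E i) (fst z) \<in> TS (fst z)"
    by (rule vf_near_tangent[OF connection_near[OF nab Z e]])
  have "G z (T.LC (vX (E i)) (hX Z) z) (VL z (E i (fst z))) = - g (fst z) (nab Z (E i) (fst z)) (E i (fst z))"
    using T.LC_torsion[OF ve n(1)[OF Z] Vt[OF et]] unit_V[OF i n(1)[OF Z]] bracket_vh[OF c z e Z]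
      T.metric_minus_left[OF Vt[OF nt] Vt[OF et]] G_VV[OF c z nt et] by simp
  moreover have "g (fst z) (gam_adj (E i) (E i) (fst z)) (Z (fst z)) = - g (fst z) (nab Z (E i) (fst z)) (E i (fst z))"
  proof -
    have "g (fst z) (gam_adj (E i) (E i) (fst z)) (Z (fst z)) = g (fst z) (gam Z (E i) (fst z)) (E i (fst z))"
      using gam_adj(2)[OF e e Z] gam_sym[OF e Z] metric_sym[OF et gam_tangent[OF Z e]] by simp
    also have "gam Z (E i) (fst z) = (\<lambda>f. LC Z (E i) (fst z) f - nab Z (E i) (fst z) f)" by (auto simp: gam_eq)
    finally show ?thesis using metric_diff_left[OF LC_tangent[OF Z e] nt et] unit[OF refl i Z] by simp
  qed
  ultimately show "G z (T.LC (vX (E i)) (vX (E i)) z) (HL z (Z (fst z))) = G z (\<lambda>F. - HL z (gam_adj (E i) (E i) (fst z)) F) (HL z (Z (fst z)))"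
    using T.LC_metric[OF ve ve n(1)[OF Z]] D(4) G_HH[OF c z L Zt] T.metric_minus_left[OF Ht[OF L] Ht[OF Zt]]
      T.metric_sym[OF Vt[OF et] T.LC_tangent[OF ve n(1)[OF Z]]] by simp
  have "G z (T.LC (vX (E i)) (vX Z) z) (VL z (E i (fst z))) = 0"
    using T.LC_torsion[OF ve n(2)[OF Z] Vt[OF et]] unit_V[OF i n(2)[OF Z]] bracket_vv[OF c z e Z]
      T.metric_zero_left[OF Vt[OF et]] by simp
  then show "G z (T.LC (vX (E i)) (vX (E i)) z) (VL z (Z (fst z))) = G z (\<lambda>F. - HL z (gam_adj (E i) (E i) (fst z)) F) (VL z (Z (fst z)))"
    using T.LC_metric[OF ve ve n(2)[OF Z]] D(2) VL_pullback[OF c z et D(5)] G_HV(1)[OF c z L Zt]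
      T.metric_minus_left[OF Ht[OF L] Vt[OF Zt]]
      T.metric_sym[OF Vt[OF et] T.LC_tangent[OF ve n(2)[OF Z]]] by simp
qed

text \<open>The two mixed derivatives are not known separately, but the opposite signs in
  \<open>JJ_H\<close> and \<open>JJ_V\<close> make them occur as a difference, hence as a bracket.
  Then \<nabla>_E E - D_E E = - \<gamma>_E E joins the adjoint term.\<close>

lemma LC_canonical_J:
  assumes i: "i \<in> Basis" and t: "t \<in> T.TS z"
  shows "G z (\<lambda>F. T.LC (hX (E i)) (\<lambda>y. JJ y (hX (E i) y)) z F - JJ z (T.LC (hX (E i)) (hX (E i)) z) F) t
     + G z (\<lambda>F. T.LC (vX (E i)) (\<lambda>y. JJ y (vX (E i) y)) z F - JJ z (T.LC (vX (E i)) (vX (E i)) z) F) t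
    = G z (VL z (\<lambda>f. gam_adj (E i) (E i) (fst z) f - gam (E i) (E i) (fst z) f)) t"
proof -
  note e = En[OF i] and et = Et[OF i]
  note he = n(1)[OF e] and ve = n(2)[OF e] and ga = gam_adj(1)[OF e e] and L = LC_tangent[OF e e]
  note nt = vf_near_tangent[OF connection_near[OF nab e e]]
  note hv = lift_vf[OF U onf_vf[OF E i]]
  have ee: "E i (fst y) \<in> TS (fst y)" if "y \<in> tbundle (fst c)" for y
    using onf_tangent[OF E i] that by (simp add: tbundle_def)
  have s: "T.sfun (tbundle (fst c)) (\<lambda>_. - 1)" by (rule T.smooth_fun_const[OF TU])
  have 1: "T.LC (hX (E i)) (\<lambda>y. JJ y (hX (E i) y)) z = T.LC (hX (E i)) (vX (E i)) z"
    by (rule T.connection_cong[OF T.levi_civita(1) TU z hv(1) canonical_J_vf[OF TU hv(1)] hv])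
      (use JJ_H[OF c _ ee] in auto)
  \<comment> \<open>The sign is written as a constant function so that the Leibniz rule extracts
    it.\<close>
  have "T.LC (vX (E i)) (\<lambda>y. JJ y (vX (E i) y)) z = T.LC (vX (E i)) (vf_scale (\<lambda>_. - 1) (hX (E i))) z"
    by (rule T.connection_cong[OF T.levi_civita(1) TU z hv(2) canonical_J_vf[OF TU hv(2)] hv(2) T.vf_scale[OF TU s hv(1)]])
      (use JJ_V[OF c _ ee] in \<open>auto simp: vf_scale_def\<close>)
  then have 2: "T.LC (vX (E i)) (\<lambda>y. JJ y (vX (E i) y)) z F = - T.LC (vX (E i)) (hX (E i)) z F" for F
    using T.connection_leibniz[OF T.levi_civita(1) TU z s hv(2,1)] T.tangent_fun_const[OF Vt[OF et]] by simp
  have 3: "JJ z (T.LC (hX (E i)) (hX (E i)) z) = VL z (LC (E i) (E i) (fst z))"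
    unfolding LC_HE[OF i] by (rule JJ_H[OF c z L])
  have 4: "JJ z (T.LC (vX (E i)) (vX (E i)) z) = (\<lambda>F. - VL z (gam_adj (E i) (E i) (fst z)) F)"
    using JJ_lincomb[OF c z Ht[OF ga] Ht[OF ga], of "-1" 0] JJ_H[OF c z ga] unfolding LC_VE[OF i] by simp
  have 5: "T.LC (hX (E i)) (vX (E i)) z F - T.LC (vX (E i)) (hX (E i)) z F = VL z (nab (E i) (E i) (fst z)) F" for F
    using T.torsion_free_near[OF T.levi_civita(2) he ve] bracket_hv[OF c z e e] by simp
  have gt: "gam (E i) (E i) (fst z) \<in> TS (fst z)" by (rule gam_tangent[OF e e])
  have 6: "VL z (gam (E i) (E i) (fst z)) = (\<lambda>F. VL z (LC (E i) (E i) (fst z)) F - VL z (nab (E i) (E i) (fst z)) F)"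
    using VL_lincomb[OF c z L nt, of 1 "-1"] by (simp add: gam_eq[abs_def])
  have 7: "VL z (\<lambda>f. gam_adj (E i) (E i) (fst z) f - gam (E i) (E i) (fst z) f)
      = (\<lambda>F. VL z (gam_adj (E i) (E i) (fst z)) F - VL z (gam (E i) (E i) (fst z)) F)"
    using VL_lincomb[OF c z ga gt, of 1 "-1"] by simp
  let ?a = "\<lambda>F. T.LC (hX (E i)) (\<lambda>y. JJ y (hX (E i) y)) z F - JJ z (T.LC (hX (E i)) (hX (E i)) z) F"
  let ?b = "\<lambda>F. T.LC (vX (E i)) (\<lambda>y. JJ y (vX (E i) y)) z F - JJ z (T.LC (vX (E i)) (vX (E i)) z) F"
  have at: "?a \<in> T.TS z"
    unfolding 1 3 by (rule T.tangent_diff[OF T.LC_tangent[OF he ve] Vt[OF L]])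
  have bt: "?b \<in> T.TS z"
    unfolding 2 4 using T.tangent_lincomb[OF T.LC_tangent[OF ve he] Vt[OF ga], of "-1" 1] by simp
  have "(\<lambda>F. ?a F + ?b F) = VL z (\<lambda>f. gam_adj (E i) (E i) (fst z) f - gam (E i) (E i) (fst z) f)"
  proof
    show "?a F + ?b F = VL z (\<lambda>f. gam_adj (E i) (E i) (fst z) f - gam (E i) (E i) (fst z) f) F" for F
      unfolding 1 2 3 4 7 6 using 5[of F] by simp
  qed
  from arg_cong[where f = "\<lambda>w. G z w t", OF this]
  show ?thesis by (rule trans[OF T.metric_add_left[OF at bt t, symmetric]])
qed

text \<open>The trace of the derivative of J is the vertical lift of T. The Lee form pairs it with J
  W, whose vertical part is the horizontal part of W, and this makes T horizontal. The signs in
  \<open>lee_form\<close> and in the codifferential cancel.\<close>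

lemma lee_form_canonical:
  assumes W: "T.vf_near z W"
  shows "lee_form TA JJ G [W] z = G z (HL z (vf_diff tr_adj tr (fst z))) (W z)"
proof -
  have Wt: "W z \<in> T.TS z" using T.vf_near_tangent[OF W] .
  obtain x y where x: "x \<in> TS (fst z)" "y \<in> TS (fst z)"
    and Wz: "W z = (\<lambda>F. HL z x F + VL z y F)" using bundle_tangentE[OF c z Wt] .
  have JW: "JJ z (W z) = (\<lambda>F. VL z x F - HL z y F)" unfolding Wz by (rule JJ_eq[OF c z x])
  have JWt: "JJ z (W z) \<in> T.TS z" by (rule JJ_tangent[OF c z Wt])
  have JWn: "T.vf_near z (\<lambda>y. JJ y (W y))"
    using W canonical_J_vf unfolding T.vf_near_def by blast
  have Jt: "JJ q v \<in> T.TS q" if "v \<in> T.TS q" for q v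
    by (rule tangent_bundle_chart[OF that]) (rule JJ_tangent[OF _ _ that])
  have Jl: "JJ q (\<lambda>f. a * v f + b * w f) = (\<lambda>f. a * JJ q v f + b * JJ q w f)"
    if "v \<in> T.TS q" "w \<in> T.TS q" for q v w a b
    by (rule tangent_bundle_chart[OF that(1)]) (rule JJ_lincomb[OF _ _ that])
  \<comment> \<open>An extension of x, because the trace of the adjoint is paired with
    fields.\<close>
  obtain X where X: "vf_near (fst z) X" "X (fst z) = x" using vf_extend[OF x(1)] .
  let ?t = "\<lambda>i f. gam_adj (E i) (E i) (fst z) f - gam (E i) (E i) (fst z) f"
  let ?K = "\<lambda>k. G z (\<lambda>F. T.LC (lifted_frame E k) (\<lambda>q. JJ q (lifted_frame E k q)) z F
      - JJ z (T.LC (lifted_frame E k) (lifted_frame E k) z) F) (JJ z (W z))"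
  have frame: "lifted_frame E (i, 0) = hX (E i)" "i \<in> Basis \<Longrightarrow> lifted_frame E (0, i) = vX (E i)" for i
    by (auto simp: lifted_frame_def)
  have "codifferential TA G (fundamental_form JJ G) [\<lambda>q. JJ q (W q)] z = - sum ?K Basis"
    by (rule T.codifferential_fundamental_form[where J = JJ, OF TU z lifted_frame_onf JWn])
      (erule Jt, erule (1) Jl, erule (1) canonical_J_vf)
  then have "lee_form TA JJ G [W] z = sum ?K Basis" by (simp only: lee_form_def nth_Cons_0 minus_minus)
  also have "\<dots> = (\<Sum>i\<in>Basis. ?K (i, 0)) + (\<Sum>i\<in>Basis. ?K (0, i))" by (rule sum_Basis_prod)
  also have "\<dots> = (\<Sum>i\<in>Basis. ?K (i, 0) + ?K (0, i))" by (rule sum.distrib[symmetric])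
  also have "\<dots> = (\<Sum>i\<in>Basis. g (fst z) (gam_adj (E i) (E i) (fst z)) x - g (fst z) (gam (E i) (E i) (fst z)) x)"
  proof (rule sum.cong[OF refl])
    fix i :: 'e assume i: "i \<in> Basis"
    note ga = gam_adj(1)[OF En[OF i] En[OF i]] and gt = gam_tangent[OF En[OF i] En[OF i]]
    note tt = tangent_diff[OF ga gt]
    have "?K (i, 0) + ?K (0, i) = G z (VL z (?t i)) (JJ z (W z))"
      unfolding frame(1) frame(2)[OF i] by (rule LC_canonical_J[OF i JWt])
    also have "\<dots> = g (fst z) (?t i) x"
      unfolding JW T.metric_diff_right[OF Vt[OF x(1)] Ht[OF x(2)] Vt[OF tt]]
      using G_VV[OF c z tt x(1)] G_HV(2)[OF c z x(2) tt] by simp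
    also have "\<dots> = g (fst z) (gam_adj (E i) (E i) (fst z)) x - g (fst z) (gam (E i) (E i) (fst z)) x"
      by (rule metric_diff_left[OF ga gt x(1)])
    finally show "?K (i, 0) + ?K (0, i) =
      g (fst z) (gam_adj (E i) (E i) (fst z)) x - g (fst z) (gam (E i) (E i) (fst z)) x" .
  qed
  also have "\<dots> = g (fst z) (tr_adj (fst z)) x - g (fst z) (tr (fst z)) x"
    using tr_adj_metric[OF U E p X(1)] tr_metric[OF U E p x(1)] gam_adj(2)[OF En En X(1)] X(2)
    by (simp add: sum_subtractf)
  also have "\<dots> = g (fst z) (vf_diff tr_adj tr (fst z)) x"
    unfolding vf_diff_def
    by (rule metric_diff_left[OF tr_adj_tangent[OF U E p] vf_tangent[OF tr_vf[OF U E] p] x(1), symmetric])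
  also have "\<dots> = G z (HL z (vf_diff tr_adj tr (fst z))) (W z)"
  proof -
    have tt: "vf_diff tr_adj tr (fst z) \<in> TS (fst z)"
      by (rule vf_tangent[OF vf_diff[OF U tr_adj_vf[OF U E] tr_vf[OF U E]] p])
    show ?thesis unfolding Wz T.metric_add_right[OF Ht[OF x(1)] Vt[OF x(2)] Ht[OF tt]]
      using G_HH[OF c z tt x(1)] G_HV(1)[OF c z tt x(2)] by simp
  qed
  finally show ?thesis .
qed

end

lemma codifferential_lee_form:
  assumes z: "z \<in> tbundle (fst c)"
  shows "codifferential TA G (lee_form TA JJ G) [] z =
    codifferential A g (\<lambda>Xs p. koszul_alpha A nab g Xs p - koszul_xi A nab g Xs p) [] (fst z)
      - g (fst z) (vf_diff tr_adj tr (fst z)) (tr_adj (fst z))"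
proof -
  let ?T = "vf_diff tr_adj tr"
  have p: "fst z \<in> fst c" and u: "snd z \<in> TS (fst z)" using z by (auto simp: tbundle_def)
  have vT: "vf (fst c) ?T" by (rule vf_diff[OF U tr_adj_vf[OF U E] tr_vf[OF U E]])
  have Tn: "vf_near (fst z) ?T" by (rule vf_nearI[OF U p vT])
  have Tt: "?T (fst z) \<in> TS (fst z)" by (rule vf_near_tangent[OF Tn])
  note En = onf_near[OF E _ U p] and Et = onf_tangent[OF E _ p]
  let ?K = "\<lambda>k. G z (T.LC (lifted_frame E k) (hX ?T) z) (lifted_frame E k z)"
  have frame: "lifted_frame E (i, 0) = hX (E i)" "i \<in> Basis \<Longrightarrow> lifted_frame E (0, i) = vX (E i)" for i
    by (auto simp: lifted_frame_def)
  have "codifferential TA G (lee_form TA JJ G) [] z = - sum ?K Basis"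
    by (rule T.codifferential_one_form[OF TU z lift_vf(1)[OF U vT] lifted_frame_onf]) (rule lee_form_canonical)
  moreover have "sum ?K Basis = (\<Sum>i\<in>Basis. ?K (i, 0)) + (\<Sum>i\<in>Basis. ?K (0, i))" by (rule sum_Basis_prod)
  moreover have "(\<Sum>i\<in>Basis. ?K (i, 0)) = (\<Sum>i\<in>Basis. g (fst z) (LC (E i) ?T (fst z)) (E i (fst z)))"
    unfolding frame(1) by (rule sum.cong[OF refl]) (rule LC_HH[OF z _ Tn])
  moreover have "(\<Sum>i\<in>Basis. ?K (0, i)) = (\<Sum>i\<in>Basis. g (fst z) (E i (fst z)) (gam (E i) ?T (fst z)))"
  proof (rule sum.cong[OF refl])
    fix i :: 'e assume i: "i \<in> Basis"
    note e = En[OF i] and et = Et[OF i]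
    note ve = lift_near(2)[OF e u] and hT = lift_near(1)[OF Tn u]
    note ga = gam_adj(1)[OF e e]
    \<comment> \<open>\<open>hX ?T\<close> and \<open>vX (E i)\<close> are orthogonal near z.
      Differentiating this relation trades the unknown derivative of \<open>hX ?T\<close> for that
      of the frame field, known from \<open>LC_VE\<close>.\<close>
    have "0 = G z (T.LC (vX (E i)) (hX ?T) z) (VL z (E i (fst z))) + G z (HL z (?T (fst z))) (T.LC (vX (E i)) (vX (E i)) z)"
      using T.LC_metric[OF ve hT ve] derivative_G_lift(3)[OF c z Tn e VL_tangent[OF c z et]] by simp
    moreover have "G z (HL z (?T (fst z))) (T.LC (vX (E i)) (vX (E i)) z) = - g (fst z) (gam_adj (E i) (E i) (fst z)) (?T (fst z))"
      using T.metric_scale_right[OF HL_tangent[OF c z ga] HL_tangent[OF c z Tt], of "-1"]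
        G_HH[OF c z Tt ga] metric_sym[OF Tt ga] unfolding LC_VE[OF z i] by simp
    ultimately show "?K (0, i) = g (fst z) (E i (fst z)) (gam (E i) ?T (fst z))"
      unfolding frame(2)[OF i] using gam_adj(2)[OF e e Tn] by simp
  qed
  moreover have "(\<Sum>i\<in>Basis. g (fst z) (E i (fst z)) (gam (E i) ?T (fst z))) = g (fst z) (?T (fst z)) (tr_adj (fst z))"
    using tr_adj_metric[OF U E p Tn] metric_sym[OF Tt tr_adj_tangent[OF U E p]] by simp
  ultimately show ?thesis using codifferential_koszul[OF U E p] by (simp only: minus_add_distrib add_uminus_conv_diff)
qed

end

end

theorem proposition3p5:
  fixes A :: "('a, 'e::euclidean_space) atlas"
    and nab :: "'a vfield \<Rightarrow> 'a vfield \<Rightarrow> 'a vfield"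
    and g :: "'a \<Rightarrow> 'a tvec \<Rightarrow> 'a tvec \<Rightarrow> real"
  assumes "affine_riemann_manifold A nab g"
  shows "(\<forall>z\<in>points (tangent_atlas A).
      codifferential (tangent_atlas A) (canonical_metric A nab g)
        (lee_form (tangent_atlas A) (canonical_J A nab) (canonical_metric A nab g)) [] z
      = codifferential A g (\<lambda>Xs p. koszul_alpha A nab g Xs p - koszul_xi A nab g Xs p) [] (fst z)
        - g (fst z) (vf_diff (tr_gamma_adj A nab g) (tr_gamma A nab g) (fst z))
            (tr_gamma_adj A nab g (fst z)))
    \<and> (gauduchon (tangent_atlas A) (canonical_J A nab) (canonical_metric A nab g) \<longleftrightarrow>
       (\<forall>p\<in>points A.
          codifferential A g (\<lambda>Xs p. koszul_alpha A nab g Xs p - koszul_xi A nab g Xs p) [] p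
          = g p (tr_gamma_adj A nab g p) (tr_gamma_adj A nab g p)
            - g p (tr_gamma_adj A nab g p) (tr_gamma A nab g p)))"
proof -
  have "charted A" using assms smooth_manifold_charted unfolding affine_riemann_manifold_def by blast
  then interpret charted A .
  interpret affine_riemannian A g nab
    by unfold_locales (use assms in \<open>auto simp: affine_riemann_manifold_def\<close>)
  let ?a = "tr_gamma_adj A nab g" and ?b = "tr_gamma A nab g"
  let ?d = "codifferential A g (\<lambda>Xs p. koszul_alpha A nab g Xs p - koszul_xi A nab g Xs p) []"
  have main: "codifferential TA G (lee_form TA JJ G) [] z = ?d (fst z) - g (fst z) (vf_diff ?a ?b (fst z)) (?a (fst z))"
    if z: "z \<in> points TA" for z
  proof -
    obtain c where c: "c \<in> A" "z \<in> tbundle (fst c)"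
      using z by (auto simp: points_def tangent_atlas_def fst_tangent_chart)
    obtain E where "onf (fst c) E" using orthonormal_frame_chart[OF c(1)] by blast
    then show ?thesis using codifferential_lee_form[OF c(1) _ c(2)] by blast
  qed
  have inner: "g p (vf_diff ?a ?b p) (?a p) = g p (?a p) (?a p) - g p (?a p) (?b p)" if p: "p \<in> points A" for p
  proof -
    obtain c where c: "c \<in> A" "p \<in> fst c" using p by (auto simp: points_def)
    obtain E where E: "onf (fst c) E" using orthonormal_frame_chart[OF c(1)] by blast
    note a = tr_adj_tangent[OF mopen_chart[OF c(1)] E c(2)] and b = vf_tangent[OF tr_vf[OF mopen_chart[OF c(1)] E] c(2)]
    show ?thesis using metric_diff_left[OF a b a] metric_sym[OF b a] by (simp add: vf_diff_def)
  qed
  have pts: "z \<in> points TA \<longleftrightarrow> fst z \<in> points A \<and> snd z \<in> TS (fst z)" for z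
    by (simp add: points_tangent_atlas tbundle_def)
  have "gauduchon TA JJ G \<longleftrightarrow> (\<forall>p\<in>points A. ?d p = g p (?a p) (?a p) - g p (?a p) (?b p))"
  proof
    assume gd: "gauduchon TA JJ G"
    show "\<forall>p\<in>points A. ?d p = g p (?a p) (?a p) - g p (?a p) (?b p)"
    proof
      fix p assume p: "p \<in> points A"
      then obtain c where c: "c \<in> A" "p \<in> fst c" by (auto simp: points_def)
      \<comment> \<open>The codifferential depends on z only through the base point, so one point of
        the fibre over p is enough; the zero vector serves.\<close>
      have "(p, \<lambda>f. 0) \<in> points TA" using pts p tangent_zero[OF c] by simp
      then show "?d p = g p (?a p) (?a p) - g p (?a p) (?b p)"
        using gd main inner[OF p] unfolding gauduchon_def by fastforce
    qed
  next
    assume "\<forall>p\<in>points A. ?d p = g p (?a p) (?a p) - g p (?a p) (?b p)"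
    then show "gauduchon TA JJ G" unfolding gauduchon_def using main inner pts by simp
  qed
  then show ?thesis using main by blast
qed

end
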